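(* Let $\Bbbk$ be an algebraically closed field, let $A$ be the Kronecker algebra over $\Bbbk$, and let $M=(M(\alpha),M(\beta))$ be a finite-dimensional $A$-module with dimension vector $(d_1,d_2)$, so $M(\alpha),M(\beta)$ are $d_2\times d_1$ matrices over $\Bbbk$. Then for all $n\ge 1$ and $\lambda\in\mathbb{P}^1(\Bbbk)=\Bbbk\cup\{\infty\}$: $$\boldsymbol{d}_M(P_n)=\begin{cases}2p_n(M)-p_{n-1}(M)-p_{n+1}(M)&(n\ge2)\\ d_2-p_2(M)&(n=1),\end{cases}$$ $$\boldsymbol{d}_M(I_n)=\begin{cases}2i_{n-1}(M)-i_n(M)-i_{n-2}(M)&(n\ge2)\\ d_1-i_1(M)&(n=1),\end{cases}$$ $$\boldsymbol{d}_M(R_n(\lambda))=\begin{cases}r_{n-1}(\lambda,M)+r_{n+1}(\lambda,M)-2r_n(\lambda,M)&(n\ge2)\\ r_2(\lambda,M)-2r_1(\lambda,M)&(n=1).\end{cases}$$ Moreover $\boldsymbol{d}_M(P_1)=\dim\operatorname{Coker}\begin{bmatrix}M(\beta)&M(\alpha)\end{bmatrix}$ and $\boldsymbol{d}_M(I_1)=\dim\operatorname{Ker}\begin{bmatrix}M(\beta)\\ M(\alpha)\end{bmatrix}$.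
   Context: The Kronecker algebra $A$ is the path algebra over $\Bbbk$ of the quiver with two vertices $1,2$ and two arrows $\alpha,\beta\colon1\to2$. Finite-dimensional $A$-modules are identified with representations $M$ of this quiver; with $\underline{\dim}M=(\dim M(1),\dim M(2))=(d_1,d_2)$ one takes $M(1)=\Bbbk^{d_1}$, $M(2)=\Bbbk^{d_2}$, and writes $M=(M(\alpha),M(\beta))$ with $d_2\times d_1$ matrices acting by left multiplication (empty matrices allowed). A complete list $\mathcal{L}$ of representatives of isoclasses of indecomposable $A$-modules is given, for $n\ge1$ and $\lambda\in\Bbbk$, by $P_n=\left(\begin{bmatrix}E_{n-1}\\ 0\end{bmatrix},\begin{bmatrix}0\\ E_{n-1}\end{bmatrix}\right)$ (matrices of size $n\times(n-1)$), $I_n=([E_{n-1}\ 0],[0\ E_{n-1}])$ (size $(n-1)\times n$), $R_n(\lambda)=(E_n,J_n(\lambda))$, and $R_n(\infty)=(J_n(0),E_n)$, where $E_n$ is the identity matrix and $J_n(\lambda)$ the (upper triangular) Jordan cell of size $n$ with eigenvalue $\lambda$. For an $A$-module $M$, $\boldsymbol{d}_M\colon\mathcal{L}\to\mathbb{N}_0$ is the unique map with $M\cong\bigoplus_{L\in\mathcal{L}}L^{(\boldsymbol{d}_M(L))}$. Block matrices associated to $M$ (unspecified blocks are zero): - $P_n(M)$ has $n-1$ block rows and $n$ block columns; its $(i,i)$ block is $M(\beta)$ and its $(i,i+1)$ block is $M(\alpha)$ for $1\le i\le n-1$. - $I_n(M)$ has $n+1$ block rows and $n$ block columns; its $(i,i)$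 block is $M(\beta)$ and its $(i+1,i)$ block is $M(\alpha)$ for $1\le i\le n$. - For $\lambda\in\Bbbk$, $R_n(\lambda,M)$ has $n$ block rows and $n$ block columns; its diagonal blocks are $\lambda M(\alpha)-M(\beta)$ and its $(i+1,i)$ blocks are $M(\alpha)$ for $1\le i\le n-1$. - $R_n(\infty,M)$ has $n$ block rows and $n$ block columns; its diagonal blocks are $M(\alpha)$ and its $(i+1,i)$ blocks are $-M(\beta)$ for $1\le i\le n-1$. Put $p_1(M)=0$, $p_n(M)=\operatorname{rank}P_n(M)$ for $n\ge2$; $i_0(M)=0$, $i_n(M)=\operatorname{rank}I_n(M)$ for $n\ge1$; $r_n(\lambda,M)=\operatorname{rank}R_n(\lambda,M)$ for $n\ge1$, $\lambda\in\mathbb{P}^1(\Bbbk)$. *)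

theory Defs
  imports
    "Jordan_Normal_Form.DL_Rank"
    "Jordan_Normal_Form.Matrix_Kernel"
    "Jordan_Normal_Form.Jordan_Normal_Form"
    "HOL-Algebra.AbelCoset"
begin

text \<open>A finite-dimensional module over the Kronecker algebra, given by the two matrices of the
  arrows \<open>1 \<rightarrow> 2\<close>. With dimension vector \<open>(d1, d2)\<close> both matrices have \<open>d2\<close> rows and
  \<open>d1\<close> columns; \<open>d1\<close> and \<open>d2\<close> may be zero.\<close>

datatype 'a kron_rep = Rep (alpha: "'a mat") (beta: "'a mat")

definition kron_reps :: "nat \<Rightarrow> nat \<Rightarrow> 'a kron_rep set" where
  "kron_reps d1 d2 = {M. alpha M \<in> carrier_mat d2 d1 \<and> beta M \<in> carrier_mat d2 d1}"

definition kron_iso :: "'a::field kron_rep \<Rightarrow> 'a kron_rep \<Rightarrow> bool" where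
  "kron_iso M N \<longleftrightarrow> (\<exists>S1 S2.
     S1 \<in> carrier_mat (dim_col (alpha N)) (dim_col (alpha M)) \<and> invertible_mat S1 \<and>
     S2 \<in> carrier_mat (dim_row (alpha N)) (dim_row (alpha M)) \<and> invertible_mat S2 \<and>
     S2 * alpha M = alpha N * S1 \<and> S2 * beta M = beta N * S1)"

definition kron_direct_sum :: "'a::zero kron_rep list \<Rightarrow> 'a kron_rep" where
  "kron_direct_sum Ls = Rep (diag_block_mat (map alpha Ls)) (diag_block_mat (map beta Ls))"


datatype 'a proj_line = Pt 'a | Infty

text \<open>The block row \<open>[A B]\<close>; the block column is the library's \<open>append_rows\<close>.\<close>

definition append_cols :: "'a::zero mat \<Rightarrow> 'a mat \<Rightarrow> 'a mat" where
  "append_cols A B = four_block_mat A B (0\<^sub>m 0 (dim_col A)) (0\<^sub>m 0 (dim_col B))"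

definition ind_P :: "nat \<Rightarrow> 'a::field kron_rep" where
  "ind_P n = Rep (1\<^sub>m (n - 1) @\<^sub>r 0\<^sub>m 1 (n - 1)) (0\<^sub>m 1 (n - 1) @\<^sub>r 1\<^sub>m (n - 1))"

definition ind_I :: "nat \<Rightarrow> 'a::field kron_rep" where
  "ind_I n = Rep (append_cols (1\<^sub>m (n - 1)) (0\<^sub>m (n - 1) 1))
                 (append_cols (0\<^sub>m (n - 1) 1) (1\<^sub>m (n - 1)))"

fun ind_R :: "nat \<Rightarrow> 'a::field proj_line \<Rightarrow> 'a kron_rep" where
  "ind_R n (Pt l) = Rep (1\<^sub>m n) (jordan_block n l)"
| "ind_R n Infty = Rep (jordan_block n 0) (1\<^sub>m n)"

definition indecs :: "'a::field kron_rep set" where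
  "indecs = {ind_P n | n. n \<ge> 1} \<union> {ind_I n | n. n \<ge> 1} \<union> {ind_R n l | n l. n \<ge> 1}"

text \<open>\<open>is_decomposition M d\<close> says \<open>M \<cong> \<Oplus>\<^bsub>L \<in> indecs\<^esub> L\<^bsup>(d L)\<^esup>\<close>, where the finitely many nonzero
  summands are listed, with multiplicity, in an arbitrary order. Off \<open>indecs\<close> the function \<open>d\<close>
  is zero, so that it is determined by its restriction to \<open>indecs\<close>.\<close>

definition is_decomposition :: "'a::field kron_rep \<Rightarrow> ('a kron_rep \<Rightarrow> nat) \<Rightarrow> bool" where
  "is_decomposition M d \<longleftrightarrow> (\<exists>Ls. set Ls \<subseteq> indecs \<and> (\<forall>L. d L = count_list Ls L) \<and>
     kron_iso M (kron_direct_sum Ls))"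

definition kron_mult :: "'a::field kron_rep \<Rightarrow> 'a kron_rep \<Rightarrow> nat" where
  "kron_mult M = (THE d. is_decomposition M d)"


text \<open>The matrix with \<open>r \<times> c\<close> blocks of size \<open>d2 \<times> d1\<close> whose block in position \<open>(i, j)\<close> is
  \<open>B i j\<close>; block indices start at 0.\<close>

definition block_matrix ::
    "nat \<Rightarrow> nat \<Rightarrow> nat \<Rightarrow> nat \<Rightarrow> (nat \<Rightarrow> nat \<Rightarrow> 'a mat) \<Rightarrow> 'a mat" where
  "block_matrix d2 d1 r c B =
     mat (r * d2) (c * d1) (\<lambda>(i, j). B (i div d2) (j div d1) $$ (i mod d2, j mod d1))"

definition kron_blocks ::
    "'a::field kron_rep \<Rightarrow> nat \<Rightarrow> nat \<Rightarrow> (nat \<Rightarrow> nat \<Rightarrow> 'a mat) \<Rightarrow> 'a mat" where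
  "kron_blocks M = block_matrix (dim_row (alpha M)) (dim_col (alpha M))"

abbreviation zero_block :: "'a::field kron_rep \<Rightarrow> 'a mat" where
  "zero_block M \<equiv> 0\<^sub>m (dim_row (alpha M)) (dim_col (alpha M))"

definition P_mat :: "nat \<Rightarrow> 'a::field kron_rep \<Rightarrow> 'a mat" where
  "P_mat n M = kron_blocks M (n - 1) n
     (\<lambda>i j. if j = i then beta M else if j = i + 1 then alpha M else zero_block M)"

definition I_mat :: "nat \<Rightarrow> 'a::field kron_rep \<Rightarrow> 'a mat" where
  "I_mat n M = kron_blocks M (n + 1) n
     (\<lambda>i j. if i = j then beta M else if i = j + 1 then alpha M else zero_block M)"

fun R_mat :: "nat \<Rightarrow> 'a::field proj_line \<Rightarrow> 'a kron_rep \<Rightarrow> 'a mat" where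
  "R_mat n (Pt l) M = kron_blocks M n n
     (\<lambda>i j. if i = j then l \<cdot>\<^sub>m alpha M - beta M else if i = j + 1 then alpha M else zero_block M)"
| "R_mat n Infty M = kron_blocks M n n
     (\<lambda>i j. if i = j then alpha M else if i = j + 1 then - beta M else zero_block M)"

definition mat_rank :: "'a::field mat \<Rightarrow> nat" where
  "mat_rank A = vec_space.rank (dim_row A) A"

text \<open>Only \<open>p_rank n\<close> and \<open>r_rank n\<close> with \<open>n \<ge> 1\<close> are meaningful.\<close>

definition p_rank :: "nat \<Rightarrow> 'a::field kron_rep \<Rightarrow> nat" where
  "p_rank n M = (if n \<le> 1 then 0 else mat_rank (P_mat n M))"

definition i_rank :: "nat \<Rightarrow> 'a::field kron_rep \<Rightarrow> nat" where
  "i_rank n M = (if n = 0 then 0 else mat_rank (I_mat n M))"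

definition r_rank :: "nat \<Rightarrow> 'a::field proj_line \<Rightarrow> 'a kron_rep \<Rightarrow> nat" where
  "r_rank n l M = mat_rank (R_mat n l M)"


definition quotient_space :: "('k, 'v, 'm) module_scheme \<Rightarrow> 'v set \<Rightarrow> ('k, 'v set) module" where
  "quotient_space V W =
     \<lparr>carrier = a_rcosets\<^bsub>V\<^esub> W, monoid.mult = undefined, one = undefined, zero = W, add = set_add V,
      module.smult = (\<lambda>c C. \<Union>v\<in>C. W +>\<^bsub>V\<^esub> (c \<odot>\<^bsub>V\<^esub> v))\<rparr>"

text \<open>The dimension of the cokernel of \<open>v \<mapsto> A v\<close>, as a quotient of the target space.\<close>

definition coker_dim :: "'a::field mat \<Rightarrow> nat" where
  "coker_dim A = vectorspace.dim class_ring
     (quotient_space (module_vec TYPE('a) (dim_row A))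
        {A *\<^sub>v v | v. v \<in> carrier_vec (dim_col A)})"

end

theory Submission
  imports Defs "Jordan_Normal_Form.Jordan_Normal_Form_Existence"
begin

text \<open>Each of \<open>P_mat\<close>, \<open>I_mat\<close>, \<open>R_mat\<close> has the form \<open>X \<otimes> alpha M + Y \<otimes> beta M\<close> with scalar
  matrices \<open>X\<close>, \<open>Y\<close>, so its rank is invariant under isomorphism and additive on direct sums. On
  indecomposables the ranks are explicit, and the second differences in the theorem turn out to be
  indicators of a single indecomposable; this gives the formulas for any decomposition of \<open>M\<close>, and
  with them its uniqueness.

  Existence is an induction on \<open>d1 + d2\<close>. If \<open>x * alpha M - beta M\<close> has a nonzero polynomial vector
  in its kernel, then one of minimal degree \<open>n - 1\<close> embeds \<open>ind_I n\<close> into \<open>M\<close>, and minimality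
  makes the linear system for a retraction \<open>M \<rightarrow> ind_I n\<close> solvable.
  Dually for the transposed matrices and \<open>ind_P n\<close>. If neither happens, the matrices are square and
  some \<open>l * alpha M - beta M\<close> is invertible, and the Jordan normal form finishes the proof.\<close>

subsection \<open>Block matrices and ranks\<close>

text \<open>Ranks are handled through factorizations \<open>A = X * Y\<close> with explicit
  one-sided inverses, so that invariance, transposition and additivity become matrix identities.
  Tensoring with a direct sum interleaves the blocks of the summands; additivity is therefore read
  off from injections and projections, not from a block diagonal form.

  A second difference in \<open>n\<close> isolates one indecomposable because the rank in question
  is linear in \<open>n\<close> on all indecomposables outside one family, and has a single kink,
  placed by the size of the summand, inside it.

  The retraction onto \<open>ind_I n\<close> comes from the alternative that a linear system is
  solvable or some functional kills its matrix but not its right-hand side. A solution would be a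
  shorter kernel vector; the functional is the retraction, and normalizing one entry suffices
  because endomorphisms of \<open>ind_I n\<close> are scalars.

  In the regular case, inverting \<open>l * alpha M - beta M\<close> leaves a pair
  \<open>(T, l * T - 1)\<close>. Jordan blocks of \<open>T\<close> with eigenvalue 0 belong to the
  point \<open>Infty\<close>, those with eigenvalue \<open>a\<close> nonzero to the point
  \<open>l - 1 / a\<close>.\<close>

lemma mult_mat_assoc:
  "dim_col A = dim_row B \<Longrightarrow> dim_col B = dim_row C \<Longrightarrow> A * B * C = A * (B * (C :: 'a :: semiring_0 mat))"
  by (rule assoc_mult_mat[of _ _ "dim_col A" _ "dim_col B" _ "dim_col C"]) auto

lemma append_cols_carrier [simp, intro]:
  "A \<in> carrier_mat r c1 \<Longrightarrow> B \<in> carrier_mat r c2 \<Longrightarrow> append_cols A B \<in> carrier_mat r (c1 + c2)"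
  by (auto simp: append_cols_def)

lemma index_append_cols:
  assumes "A \<in> carrier_mat r c1" "B \<in> carrier_mat r c2" "i < r" "j < c1 + c2"
  shows "append_cols A B $$ (i, j) = (if j < c1 then A $$ (i, j) else B $$ (i, j - c1))"
  using assms by (auto simp: append_cols_def)

lemma index_append_rows:
  assumes "A \<in> carrier_mat r1 c" "B \<in> carrier_mat r2 c" "i < r1 + r2" "j < c"
  shows "(A @\<^sub>r B) $$ (i, j) = (if i < r1 then A $$ (i, j) else B $$ (i - r1, j))"
  using assms by (auto simp: append_rows_def)

lemma transpose_append_cols:
  assumes "A \<in> carrier_mat r c1" "B \<in> carrier_mat r c2"
  shows "(append_cols A B)\<^sup>T = A\<^sup>T @\<^sub>r B\<^sup>T"
  unfolding append_cols_def append_rows_def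
  using assms by (subst transpose_four_block_mat[OF assms]) auto

lemma transpose_append_rows:
  assumes "A \<in> carrier_mat r1 c" "B \<in> carrier_mat r2 c"
  shows "(A @\<^sub>r B)\<^sup>T = append_cols A\<^sup>T B\<^sup>T"
  using transpose_append_cols[of "A\<^sup>T" c r1 "B\<^sup>T" r2] assms
  by (metis transpose_carrier_mat transpose_transpose)

lemma append_rows_mult:
  assumes "A \<in> carrier_mat r1 n" "B \<in> carrier_mat r2 n" "C \<in> carrier_mat n c"
  shows "(A @\<^sub>r B) * C = A * C @\<^sub>r B * (C :: 'a :: semiring_0 mat)"
proof (rule eq_matI)
  have AB: "A @\<^sub>r B \<in> carrier_mat (r1 + r2) n" using assms by simp
  fix i j assume "i < dim_row (A * C @\<^sub>r B * C)" "j < dim_col (A * C @\<^sub>r B * C)"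
  then have i: "i < r1 + r2" and j: "j < c" using assms by (auto simp: append_rows_def)
  show "((A @\<^sub>r B) * C) $$ (i, j) = (A * C @\<^sub>r B * C) $$ (i, j)"
    using assms i j AB carrier_matD[OF AB]
    by (auto simp: index_append_rows[of "A * C" r1 c "B * C" r2] scalar_prod_def
        index_append_rows[of A r1 n B r2])
qed (use assms in \<open>auto simp: append_rows_def\<close>)

lemma mult_append_cols:
  assumes "C \<in> carrier_mat r n" "A \<in> carrier_mat n c1" "B \<in> carrier_mat n c2"
  shows "C * append_cols A B = append_cols (C * A) (C * (B :: 'a :: semiring_0 mat))"
proof (rule eq_matI)
  have AB: "append_cols A B \<in> carrier_mat n (c1 + c2)" using assms by simp
  fix i j assume "i < dim_row (append_cols (C * A) (C * B))" "j < dim_col (append_cols (C * A) (C * B))"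
  then have i: "i < r" and j: "j < c1 + c2" using assms by (auto simp: append_cols_def)
  show "(C * append_cols A B) $$ (i, j) = append_cols (C * A) (C * B) $$ (i, j)"
    using assms i j AB carrier_matD[OF AB]
    by (auto simp: index_append_cols[of "C * A" r c1 "C * B" c2] scalar_prod_def
        index_append_cols[of A n c1 B c2])
qed (use assms in \<open>auto simp: append_cols_def\<close>)

lemma append_cols_mult_append_rows:
  assumes "A \<in> carrier_mat r n1" "B \<in> carrier_mat r n2" "C \<in> carrier_mat n1 c" "D \<in> carrier_mat n2 c"
  shows "append_cols A B * (C @\<^sub>r D) = A * C + B * (D :: 'a :: semiring_0 mat)"
proof (rule eq_matI)
  have AB: "append_cols A B \<in> carrier_mat r (n1 + n2)" and CD: "C @\<^sub>r D \<in> carrier_mat (n1 + n2) c"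
    using assms by auto
  fix i j assume "i < dim_row (A * C + B * D)" "j < dim_col (A * C + B * D)"
  then have i: "i < r" and j: "j < c" using assms by auto
  have "row (append_cols A B) i = row A i @\<^sub>v row B i"
    using i assms carrier_matD[OF AB] by (intro eq_vecI) (auto simp: index_append_cols[of A r n1 B n2])
  moreover have "col (C @\<^sub>r D) j = col C j @\<^sub>v col D j"
    using j assms carrier_matD[OF CD] by (intro eq_vecI) (auto simp: index_append_rows[of C n1 c D n2])
  ultimately show "(append_cols A B * (C @\<^sub>r D)) $$ (i, j) = (A * C + B * D) $$ (i, j)"
    using assms i j carrier_matD[OF AB] carrier_matD[OF CD]
    by (simp add: scalar_prod_append[of _ n1 _ n2])
qed (use assms in \<open>auto simp: append_cols_def append_rows_def\<close>)

lemma append_rows_mult_append_cols: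
  assumes "A \<in> carrier_mat r1 n" "B \<in> carrier_mat r2 n" "C \<in> carrier_mat n c1" "D \<in> carrier_mat n c2"
  shows "(A @\<^sub>r B) * append_cols C D =
    four_block_mat (A * C) (A * D) (B * C) (B * (D :: 'a :: semiring_0 mat))"
proof -
  have "(A @\<^sub>r B) * append_cols C D = append_cols (A * C @\<^sub>r B * C) (A * D @\<^sub>r B * D)"
    using assms by (subst mult_append_cols[of _ "r1 + r2" n]) (auto simp: append_rows_mult)
  also have "\<dots> = four_block_mat (A * C) (A * D) (B * C) (B * D)"
    using assms by (intro eq_matI)
      (auto simp: index_append_cols[of _ "r1 + r2" c1 _ c2] index_append_rows append_rows_def append_cols_def)
  finally show ?thesis .
qed

section \<open>Rank as the dimension of the image, and rank-nullity\<close>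

lemma linear_map_mult_mat_vec:
  assumes "(A :: 'a :: field mat) \<in> carrier_mat r c"
  shows "linear_map class_ring (module_vec TYPE('a) c) (module_vec TYPE('a) r) ((*\<^sub>v) A)"
proof -
  interpret V: vec_space "TYPE('a)" c .
  interpret W: vec_space "TYPE('a)" r .
  have "(*\<^sub>v) A \<in> LinearCombinations.module_hom class_ring (module_vec TYPE('a) c) (module_vec TYPE('a) r)"
    using assms unfolding LinearCombinations.module_hom_def
    by (auto simp: mult_add_distrib_mat_vec mult_mat_vec)
  then show ?thesis
    by (intro linear_map.intro mod_hom.intro mod_hom_axioms.intro V.vectorspace_axioms
        W.vectorspace_axioms V.module_axioms W.module_axioms)
qed

lemma mat_rank_eq_dim_image:
  assumes "(A :: 'a :: field mat) \<in> carrier_mat r c"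
  shows "mat_rank A = vectorspace.dim class_ring
    (module_vec TYPE('a) r\<lparr>carrier := (*\<^sub>v) A ` carrier_vec c\<rparr>)"
proof -
  interpret W: vec_space "TYPE('a)" r .
  have "W.span (set (cols A)) = (*\<^sub>v) A ` carrier_vec c"
    using W.col_space_eq[OF assms] assms unfolding W.col_space_def by auto
  then show ?thesis using assms by (simp add: mat_rank_def W.rank_def)
qed

lemma mat_rank_plus_kernel_dim:
  assumes "(A :: 'a :: field mat) \<in> carrier_mat r c"
  shows "mat_rank A + kernel_dim A = c"
proof -
  interpret L: linear_map class_ring "module_vec TYPE('a) c" "module_vec TYPE('a) r" "(*\<^sub>v) A"
    by (rule linear_map_mult_mat_vec[OF assms])
  interpret V: vec_space "TYPE('a)" c .
  have im: "L.im = (*\<^sub>v) A ` carrier_vec c" by (simp add: L.im_def)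
  have ker: "L.ker = mat_kernel A"
    using assms by (auto simp: L.ker_def mat_kernel_def module_vec_simps)
  show ?thesis
    using L.rank_nullity[OF V.fin_dim] mat_rank_eq_dim_image[OF assms] assms
    unfolding im ker kernel_dim_def V.dim_is_n by simp
qed

lemma kernel_dim_eq_0:
  assumes "(A :: 'a :: field mat) \<in> carrier_mat r c"
    and "\<And>v. v \<in> carrier_vec c \<Longrightarrow> A *\<^sub>v v = 0\<^sub>v r \<Longrightarrow> v = 0\<^sub>v c"
  shows "kernel_dim A = 0"
proof -
  \<comment> \<open>An injective matrix shares its kernel with the identity matrix, whose kernel
    dimension is known.\<close>
  have "mat_kernel A = mat_kernel (1\<^sub>m c)"
    using assms by (auto simp: mat_kernel_def)
  then show ?thesis
    using kernel_one_mat(1)[where ?'a = 'a, of c] assms(1) by (simp add: kernel_dim_def)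
qed

section \<open>Full rank factorizations and what they give\<close>

lemma append_cols_add:
  assumes "A \<in> carrier_mat r c1" "B \<in> carrier_mat r c2" "C \<in> carrier_mat r c1" "D \<in> carrier_mat r c2"
  shows "append_cols A B + append_cols C D = append_cols (A + C) (B + (D :: 'a :: monoid_add mat))"
  using assms
  by (intro eq_matI) (auto simp: append_cols_def)

lemma minus_zero_mat: "A \<in> carrier_mat r c \<Longrightarrow> A - 0\<^sub>m r c = (A :: 'a :: group_add mat)"
  by (intro eq_matI) auto

lemma zero_mat_mult_vec: "v \<in> carrier_vec c \<Longrightarrow> 0\<^sub>m r c *\<^sub>v v = (0\<^sub>v r :: 'a :: semiring_0 vec)"
  by (intro eq_vecI) (auto simp: row_def scalar_prod_def)

lemma one_block_mat:
  "four_block_mat (1\<^sub>m m) (0\<^sub>m m n) (0\<^sub>m n m) (1\<^sub>m n) = 1\<^sub>m (m + n)"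
  by simp

text \<open>The one-sided inverses are part of the data: with them, factorizations can be
  transposed, multiplied and put side by side by matrix algebra alone, without returning to
  subspaces.\<close>

definition rank_fact :: "'a::field mat \<Rightarrow> nat \<Rightarrow> bool" where
  "rank_fact A k \<longleftrightarrow> (\<exists>X X' Y Y'.
     X \<in> carrier_mat (dim_row A) k \<and> X' \<in> carrier_mat k (dim_row A) \<and>
     Y \<in> carrier_mat k (dim_col A) \<and> Y' \<in> carrier_mat (dim_col A) k \<and>
     A = X * Y \<and> X' * X = 1\<^sub>m k \<and> Y * Y' = 1\<^sub>m k)"

lemma rank_factI:
  assumes "X \<in> carrier_mat r k" "X' \<in> carrier_mat k r" "Y \<in> carrier_mat k c" "Y' \<in> carrier_mat c k"
    and "A = X * Y" "X' * X = 1\<^sub>m k" "Y * Y' = 1\<^sub>m k"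
  shows "rank_fact A k"
  unfolding rank_fact_def using assms by (intro exI[of _ X] exI[of _ X'] exI[of _ Y] exI[of _ Y']) auto

lemma rank_factE:
  assumes "rank_fact A k" "A \<in> carrier_mat r c"
  obtains X X' Y Y' where "X \<in> carrier_mat r k" "X' \<in> carrier_mat k r"
    "Y \<in> carrier_mat k c" "Y' \<in> carrier_mat c k"
    "A = X * Y" "X' * X = 1\<^sub>m k" "Y * Y' = 1\<^sub>m k"
  using assms unfolding rank_fact_def by auto

lemma left_inverse_imp_inj:
  assumes "(A :: 'a :: field mat) \<in> carrier_mat r c" "B \<in> carrier_mat c r" "B * A = 1\<^sub>m c"
    and "v \<in> carrier_vec c" "A *\<^sub>v v = 0\<^sub>v r"
  shows "v = 0\<^sub>v c"
proof -
  have "v = B * A *\<^sub>v v" using assms by simp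
  also have "\<dots> = B *\<^sub>v (A *\<^sub>v v)" using assms(1,2,4) by simp
  also have "\<dots> = 0\<^sub>v c" using assms(2,5) by auto
  finally show ?thesis .
qed

text \<open>The right inverse of \<open>Y\<close> makes the images of \<open>A\<close> and
  \<open>X\<close> equal, and the left inverse of \<open>X\<close> makes \<open>X\<close> injective,
  so rank-nullity gives \<open>k\<close>.\<close>

lemma rank_fact_imp_mat_rank:
  assumes "rank_fact A k"
  shows "mat_rank A = k"
proof -
  obtain r c where A: "A \<in> carrier_mat r c" by auto
  obtain X X' Y Y' where X: "X \<in> carrier_mat r k" "X' \<in> carrier_mat k r"
    and Y: "Y \<in> carrier_mat k c" "Y' \<in> carrier_mat c k"
    and eq: "A = X * Y" "X' * X = 1\<^sub>m k" "Y * Y' = 1\<^sub>m k"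
    using rank_factE[OF assms A] by metis
  have "X *\<^sub>v w \<in> (*\<^sub>v) A ` carrier_vec c" if w: "w \<in> carrier_vec k" for w
  proof
    have "X *\<^sub>v w = X *\<^sub>v ((Y * Y') *\<^sub>v w)" using w eq by simp
    also have "\<dots> = X *\<^sub>v (Y *\<^sub>v (Y' *\<^sub>v w))" using Y w by simp
    also have "\<dots> = A *\<^sub>v (Y' *\<^sub>v w)" unfolding eq using X Y w
      by (metis assoc_mult_mat_vec mult_mat_vec_carrier)
    finally show "X *\<^sub>v w = A *\<^sub>v (Y' *\<^sub>v w)" .
    show "Y' *\<^sub>v w \<in> carrier_vec c" using Y w by simp
  qed
  moreover have "A *\<^sub>v v \<in> (*\<^sub>v) X ` carrier_vec k" if v: "v \<in> carrier_vec c" for v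
    using X Y v by (auto simp: eq intro!: image_eqI[of _ _ "Y *\<^sub>v v"])
  ultimately have "(*\<^sub>v) A ` carrier_vec c = (*\<^sub>v) X ` carrier_vec k" by auto
  then have "mat_rank A = mat_rank X"
    using A X by (simp add: mat_rank_eq_dim_image)
  moreover have "kernel_dim X = 0"
    using X eq left_inverse_imp_inj by (intro kernel_dim_eq_0[of X r k]) auto
  ultimately show ?thesis
    using mat_rank_plus_kernel_dim[OF X(1)] by simp
qed

text \<open>\<open>E = 1 - X * X'\<close> is a projection whose kernel is the image of
  \<open>X\<close>. So \<open>a\<close> lies in that image exactly if \<open>E * a\<close> vanishes;
  otherwise a nonzero coordinate of \<open>E * a\<close> yields \<open>g\<close>.\<close>

lemma left_invertible_image_or_functional:
  assumes X: "(X :: 'a :: field mat) \<in> carrier_mat r k" "X' \<in> carrier_mat k r" "X' * X = 1\<^sub>m k"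
    and a: "a \<in> carrier_mat r 1"
  shows "(\<exists>y \<in> carrier_mat k 1. a = X * y) \<or>
    (\<exists>g \<in> carrier_mat 1 r. g * X = 0\<^sub>m 1 k \<and> g * a = 1\<^sub>m 1)"
proof -
  define E where "E = 1\<^sub>m r - X * X'"
  have E: "E \<in> carrier_mat r r" using X by (auto simp: E_def)
  have EX: "E * X = 0\<^sub>m r k"
    using X by (simp add: E_def minus_mult_distrib_mat[of _ r r])
  have Ea: "E * a = a - X * (X' * a)"
    using X a by (simp add: E_def minus_mult_distrib_mat[of _ r r])
  show ?thesis
  proof (cases "E * a = 0\<^sub>m r 1")
    case True
    have "a = a - X * (X' * a) + X * (X' * a)"
      using X a by (intro eq_matI) auto
    also have "\<dots> = X * (X' * a)" using True X a by (simp flip: Ea)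
    finally show ?thesis using X a by (intro disjI1 bexI[of _ "X' * a"]) auto
  next
    case False
    have "\<exists>i < r. (E * a) $$ (i, 0) \<noteq> 0"
    proof (rule ccontr)
      assume *: "\<not> ?thesis"
      have "E * a = 0\<^sub>m r 1"
        using E a * by (intro eq_matI) auto
      with False show False by simp
    qed
    then obtain i where i: "i < r" "(E * a) $$ (i, 0) \<noteq> 0" by blast
    \<comment> \<open>The row that reads off coordinate \<open>i\<close>, scaled to take the value 1
      on \<open>E * a\<close>.\<close>
    define e :: "'a mat" where "e = mat 1 r (\<lambda>(_, j). if j = i then inverse ((E * a) $$ (i, 0)) else 0)"
    have e: "e \<in> carrier_mat 1 r" by (simp add: e_def)
    have "e * E * X = 0\<^sub>m 1 k" using e E X EX by (simp add: right_mult_zero_mat[OF e])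
    moreover have "e * (E * a) = 1\<^sub>m 1"
    proof (rule eq_matI)
      fix p q assume "p < dim_row (1\<^sub>m 1 :: 'a mat)" "q < dim_col (1\<^sub>m 1 :: 'a mat)"
      then have pq: "p = 0" "q = 0" by auto
      have Ea: "E * a \<in> carrier_mat r 1" using E a by simp
      have "(e * (E * a)) $$ (0, 0) = row e 0 \<bullet> col (E * a) 0"
        using e Ea by (intro index_mult_mat(1)) auto
      also have "\<dots> = (\<Sum>j<r. (if j = i then inverse ((E * a) $$ (i, 0)) else 0) * (E * a) $$ (j, 0))"
        using e Ea carrier_matD[OF Ea] carrier_matD[OF E]
        by (auto simp: scalar_prod_def e_def atLeast0LessThan intro!: sum.cong)
      also have "\<dots> = (\<Sum>j<r. if j = i then 1 else 0)"
        by (rule sum.cong) (use i in auto)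
      also have "\<dots> = 1" using i by simp
      finally show "(e * (E * a)) $$ (p, q) = 1\<^sub>m 1 $$ (p, q)" by (simp add: pq)
    qed (use e E a in auto)
    ultimately show ?thesis
      using e E X a by (intro disjI2 bexI[of _ "e * E"]) auto
  qed
qed

text \<open>Induction on the number of columns. If the last column lies in the image of
  \<open>X\<close>, only \<open>Y\<close> gains a column; otherwise \<open>X\<close> gains it, and
  the functional \<open>g\<close> becomes a new row of the left inverse.\<close>

lemma rank_fact_exists: "\<exists>k. rank_fact (A :: 'a :: field mat) k"
proof -
  obtain r c where "A \<in> carrier_mat r c" by auto
  then show ?thesis
  proof (induction c arbitrary: A)
    case 0
    show ?case
      by (rule exI[of _ 0], rule rank_factI[of "0\<^sub>m r 0" r 0 "0\<^sub>m 0 r" "0\<^sub>m 0 0" 0 "0\<^sub>m 0 0"])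
        (use 0 in auto)
  next
    case (Suc c)
    define A' where "A' = mat r c (\<lambda>(i, j). A $$ (i, j))"
    define a where "a = mat r 1 (\<lambda>(i, _). A $$ (i, c))"
    have A': "A' \<in> carrier_mat r c" and a: "a \<in> carrier_mat r 1" by (auto simp: A'_def a_def)
    have A: "A = append_cols A' a"
    proof (rule eq_matI)
      fix i j assume "i < dim_row (append_cols A' a)" "j < dim_col (append_cols A' a)"
      then have ij: "i < r" "j < c + 1" by (auto simp: append_cols_def A'_def a_def)
      show "A $$ (i, j) = append_cols A' a $$ (i, j)"
        unfolding index_append_cols[OF A' a ij]
        using ij by (cases "j = c") (auto simp: A'_def a_def)
    qed (use Suc.prems in \<open>auto simp: append_cols_def A'_def a_def\<close>)
    obtain k X X' Y Y' where X: "X \<in> carrier_mat r k" "X' \<in> carrier_mat k r"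
      and Y: "Y \<in> carrier_mat k c" "Y' \<in> carrier_mat c k"
      and eq: "A' = X * Y" "X' * X = 1\<^sub>m k" "Y * Y' = 1\<^sub>m k"
      using Suc.IH[OF A'] rank_factE[OF _ A'] by metis
    from left_invertible_image_or_functional[OF X eq(2) a] show ?case
    proof (elim disjE bexE conjE)
      fix y assume y: "y \<in> carrier_mat k 1" "a = X * y"
      have "rank_fact A k"
      proof (rule rank_factI[of X r k X' "append_cols Y y" "c + 1" "Y' @\<^sub>r 0\<^sub>m 1 k"])
        show "A = X * append_cols Y y" using X Y y by (simp add: A eq mult_append_cols)
        show "append_cols Y y * (Y' @\<^sub>r 0\<^sub>m 1 k) = 1\<^sub>m k"
          using Y y eq by (simp add: append_cols_mult_append_rows[of _ k c _ 1])
      qed (use X Y y eq in \<open>auto simp del: One_nat_def\<close>)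
      then show ?thesis by blast
    next
      fix g assume g: "g \<in> carrier_mat 1 r" "g * X = 0\<^sub>m 1 k" "g * a = 1\<^sub>m 1"
      \<comment> \<open>Since \<open>g\<close> kills \<open>X\<close> and is 1 on \<open>a\<close>,
        subtracting \<open>X' * a * g\<close> makes the old left inverse vanish on \<open>a\<close>
        without changing its product with \<open>X\<close>.\<close>
      let ?X' = "(X' - X' * a * g) @\<^sub>r g"
      let ?Y = "append_cols Y (0\<^sub>m k 1) @\<^sub>r append_cols (0\<^sub>m 1 c) (1\<^sub>m 1)"
      let ?Y' = "append_cols (Y' @\<^sub>r 0\<^sub>m 1 k) (0\<^sub>m c 1 @\<^sub>r 1\<^sub>m 1)"
      have "rank_fact A (k + 1)"
      proof (rule rank_factI[of "append_cols X a" r "k + 1" ?X' ?Y "c + 1" ?Y'])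
        show "A = append_cols X a * ?Y"
          using X Y a
          by (simp add: A eq append_cols_mult_append_rows[of X r k a 1 _ "c + 1"]
              mult_append_cols[of X r k _ c _ 1] mult_append_cols[of a r 1 _ c _ 1]
              append_cols_add[of _ r c _ 1] right_mult_zero_mat[of _ r] del: One_nat_def)
        have "(X' - X' * a * g) * X = 1\<^sub>m k"
          using X a g eq by (simp add: minus_mult_distrib_mat[of _ k r] mult_mat_assoc minus_zero_mat)
        moreover have "(X' - X' * a * g) * a = 0\<^sub>m k 1"
          using X a g by (simp add: minus_mult_distrib_mat[of _ k r] mult_mat_assoc)
        ultimately show "?X' * append_cols X a = 1\<^sub>m (k + 1)"
          using X a g by (subst append_rows_mult_append_cols[of _ k r _ 1]) (auto simp: one_block_mat)
        show "?Y * ?Y' = 1\<^sub>m (k + 1)"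
          using Y eq by (subst append_rows_mult_append_cols[of _ k "c + 1" _ 1 _ k _ 1])
            (auto simp: one_block_mat append_cols_mult_append_rows[of Y k c _ 1 _ k] append_cols_mult_append_rows[of Y k c _ 1 _ 1]
              append_cols_mult_append_rows[of "0\<^sub>m 1 c" 1 c _ 1 _ k]
              append_cols_mult_append_rows[of "0\<^sub>m 1 c" 1 c _ 1 _ 1] right_mult_zero_mat[of Y k c]
              simp del: One_nat_def)
      qed (use X Y a g in \<open>auto simp del: One_nat_def
            intro!: carrier_append_rows minus_carrier_mat mult_carrier_mat\<close>)
      then show ?thesis by blast
    qed
  qed
qed

lemma rank_fact_iff: "rank_fact A k \<longleftrightarrow> mat_rank A = k"
  using rank_fact_exists rank_fact_imp_mat_rank by metis

lemma mat_rank_factorization: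
  assumes "(A :: 'a :: field mat) \<in> carrier_mat r c"
  obtains X X' Y Y' where "X \<in> carrier_mat r (mat_rank A)" "X' \<in> carrier_mat (mat_rank A) r"
    "Y \<in> carrier_mat (mat_rank A) c" "Y' \<in> carrier_mat c (mat_rank A)"
    "A = X * Y" "X' * X = 1\<^sub>m (mat_rank A)" "Y * Y' = 1\<^sub>m (mat_rank A)"
  using rank_factE[OF _ assms] rank_fact_iff by blast

lemma mat_rank_transpose: "mat_rank A\<^sup>T = mat_rank (A :: 'a :: field mat)"
proof -
  obtain r c where A: "A \<in> carrier_mat r c" by auto
  obtain X X' Y Y' where *: "X \<in> carrier_mat r (mat_rank A)" "X' \<in> carrier_mat (mat_rank A) r"
    "Y \<in> carrier_mat (mat_rank A) c" "Y' \<in> carrier_mat c (mat_rank A)"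
    "A = X * Y" "X' * X = 1\<^sub>m (mat_rank A)" "Y * Y' = 1\<^sub>m (mat_rank A)"
    using mat_rank_factorization[OF A] by metis
  have "rank_fact A\<^sup>T (mat_rank A)"
  proof (rule rank_factI[of "Y\<^sup>T" c _ "Y'\<^sup>T" "X\<^sup>T" r "X'\<^sup>T"])
    show "A\<^sup>T = Y\<^sup>T * X\<^sup>T" using *(1,3) by (subst *(5)) (rule transpose_mult)
    show "Y'\<^sup>T * Y\<^sup>T = 1\<^sub>m (mat_rank A)" by (metis * transpose_mult transpose_one)
    show "X\<^sup>T * X'\<^sup>T = 1\<^sub>m (mat_rank A)" by (metis * transpose_mult transpose_one)
  qed (use * in auto)
  then show ?thesis by (simp add: rank_fact_iff)
qed

lemma mat_rank_left_invertible:
  assumes "(A :: 'a :: field mat) \<in> carrier_mat r c" "B \<in> carrier_mat c r" "B * A = 1\<^sub>m c"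
  shows "mat_rank A = c"
  using assms by (subst rank_fact_iff[symmetric], intro rank_factI[of A r c B "1\<^sub>m c" c "1\<^sub>m c"]) auto

lemma mat_rank_right_invertible:
  assumes "(A :: 'a :: field mat) \<in> carrier_mat r c" "B \<in> carrier_mat c r" "A * B = 1\<^sub>m r"
  shows "mat_rank A = r"
  using assms by (subst rank_fact_iff[symmetric], intro rank_factI[of "1\<^sub>m r" r r "1\<^sub>m r" A c B]) auto

text \<open>At full column rank the factor \<open>Y\<close> is square, so its right inverse is
  two-sided and \<open>Y' * X'\<close> inverts \<open>A\<close> from the left.\<close>

lemma left_inverse_if_full_rank:
  assumes A: "(A :: 'a :: field mat) \<in> carrier_mat r c" and rk: "mat_rank A = c"
  obtains B where "B \<in> carrier_mat c r" "B * A = 1\<^sub>m c"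
proof -
  obtain X X' Y Y' where *: "X \<in> carrier_mat r c" "X' \<in> carrier_mat c r"
    "Y \<in> carrier_mat c c" "Y' \<in> carrier_mat c c"
    "A = X * Y" "X' * X = 1\<^sub>m c" "Y * Y' = 1\<^sub>m c"
    using mat_rank_factorization[OF A] unfolding rk by metis
  have "Y' * Y = 1\<^sub>m c" using *(3,4,7) mat_mult_left_right_inverse by blast
  then have "Y' * X' * A = 1\<^sub>m c" using *(1-4,6) by (simp add: *(5) mult_mat_assoc flip: mult_mat_assoc[of X' X Y])
  with that[of "Y' * X'"] * show ?thesis by auto
qed

text \<open>The one-sided inverses of \<open>U\<close> and \<open>V\<close> compose with those of a
  factorization of \<open>B\<close>. The factors may be rectangular, as happens in
  \<open>mat_rank_if_kernel\<close>.\<close>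

lemma mat_rank_equivalence:
  assumes B: "(B :: 'a :: field mat) \<in> carrier_mat r' c'"
    and U: "U \<in> carrier_mat r r'" "U' \<in> carrier_mat r' r" "U' * U = 1\<^sub>m r'"
    and V: "V \<in> carrier_mat c' c" "V' \<in> carrier_mat c c'" "V * V' = 1\<^sub>m c'"
  shows "mat_rank (U * B * V) = mat_rank B"
proof -
  obtain X X' Y Y' where *: "X \<in> carrier_mat r' (mat_rank B)" "X' \<in> carrier_mat (mat_rank B) r'"
    "Y \<in> carrier_mat (mat_rank B) c'" "Y' \<in> carrier_mat c' (mat_rank B)"
    "B = X * Y" "X' * X = 1\<^sub>m (mat_rank B)" "Y * Y' = 1\<^sub>m (mat_rank B)"
    using mat_rank_factorization[OF B] by metis
  have "rank_fact (U * B * V) (mat_rank B)"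
  proof (rule rank_factI[of "U * X" r _ "X' * U'" "Y * V" c "V' * Y'"])
    show "U * B * V = U * X * (Y * V)" using * U V by (subst *(5)) (simp add: mult_mat_assoc)
    have "X' * U' * (U * X) = X' * ((U' * U) * X)" using *(1,2) U(1,2) by (simp add: mult_mat_assoc)
    then show "X' * U' * (U * X) = 1\<^sub>m (mat_rank B)" using * U by simp
    have "Y * V * (V' * Y') = Y * ((V * V') * Y')" using *(3,4) V(1,2) by (simp add: mult_mat_assoc)
    then show "Y * V * (V' * Y') = 1\<^sub>m (mat_rank B)" using * V by simp
  qed (use * U V in auto)
  then show ?thesis by (simp add: rank_fact_iff)
qed

lemma mat_rank_left_mult:
  assumes "(B :: 'a :: field mat) \<in> carrier_mat r' c"
    and "U \<in> carrier_mat r r'" "U' \<in> carrier_mat r' r" "U' * U = 1\<^sub>m r'"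
  shows "mat_rank (U * B) = mat_rank B"
  using mat_rank_equivalence[OF assms, of "1\<^sub>m c" c "1\<^sub>m c"] assms by simp

lemma mat_rank_right_mult:
  assumes "(B :: 'a :: field mat) \<in> carrier_mat r c'"
    and "V \<in> carrier_mat c' c" "V' \<in> carrier_mat c c'" "V * V' = 1\<^sub>m c'"
  shows "mat_rank (B * V) = mat_rank B"
  using mat_rank_equivalence[of B r c' "1\<^sub>m r" r "1\<^sub>m r" V c V'] assms by simp

lemma mat_rank_uminus: "mat_rank (- A) = mat_rank (A :: 'a :: field mat)"
proof -
  have "mat_rank ((- 1\<^sub>m (dim_row A)) * A) = mat_rank A"
    by (rule mat_rank_left_mult[of _ "dim_row A" "dim_col A" _ _ "- 1\<^sub>m (dim_row A)"]) auto
  then show ?thesis by simp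
qed

text \<open>\<open>U1\<close>, \<open>U2\<close> are injections into, and \<open>V1\<close>,
  \<open>V2\<close> projections from, a biproduct. Factorizations of \<open>B1\<close> and
  \<open>B2\<close> placed side by side factor the sum, because the mixed terms in the inverses
  cancel.\<close>

lemma mat_rank_biproduct:
  assumes B: "(B1 :: 'a :: field mat) \<in> carrier_mat r1 c1" "B2 \<in> carrier_mat r2 c2"
    and U: "U1 \<in> carrier_mat r r1" "U2 \<in> carrier_mat r r2" "U1' \<in> carrier_mat r1 r" "U2' \<in> carrier_mat r2 r"
      "U1' * U1 = 1\<^sub>m r1" "U2' * U2 = 1\<^sub>m r2" "U1' * U2 = 0\<^sub>m r1 r2" "U2' * U1 = 0\<^sub>m r2 r1"
    and V: "V1 \<in> carrier_mat c1 c" "V2 \<in> carrier_mat c2 c" "V1' \<in> carrier_mat c c1" "V2' \<in> carrier_mat c c2"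
      "V1 * V1' = 1\<^sub>m c1" "V2 * V2' = 1\<^sub>m c2" "V1 * V2' = 0\<^sub>m c1 c2" "V2 * V1' = 0\<^sub>m c2 c1"
  shows "mat_rank (U1 * B1 * V1 + U2 * B2 * V2) = mat_rank B1 + mat_rank B2"
proof -
  define k1 k2 where "k1 = mat_rank B1" "k2 = mat_rank B2"
  obtain X1 X1' Y1 Y1' where 1: "X1 \<in> carrier_mat r1 k1" "X1' \<in> carrier_mat k1 r1"
    "Y1 \<in> carrier_mat k1 c1" "Y1' \<in> carrier_mat c1 k1"
    "B1 = X1 * Y1" "X1' * X1 = 1\<^sub>m k1" "Y1 * Y1' = 1\<^sub>m k1"
    unfolding k1_k2_def using mat_rank_factorization[OF B(1)] by metis
  obtain X2 X2' Y2 Y2' where 2: "X2 \<in> carrier_mat r2 k2" "X2' \<in> carrier_mat k2 r2"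
    "Y2 \<in> carrier_mat k2 c2" "Y2' \<in> carrier_mat c2 k2"
    "B2 = X2 * Y2" "X2' * X2 = 1\<^sub>m k2" "Y2 * Y2' = 1\<^sub>m k2"
    unfolding k1_k2_def using mat_rank_factorization[OF B(2)] by metis
  have cancel: "A * Z' * (Z * C) = A * (Z' * Z) * C"
    if "A \<in> carrier_mat n1 n2" "Z' \<in> carrier_mat n2 n3" "Z \<in> carrier_mat n3 n4" "C \<in> carrier_mat n4 n5"
    for A Z Z' C :: "'a mat" and n1 n2 n3 n4 n5
    using that by (simp add: mult_mat_assoc)
  have "rank_fact (U1 * B1 * V1 + U2 * B2 * V2) (k1 + k2)"
  proof (rule rank_factI[of "append_cols (U1 * X1) (U2 * X2)" r _ "X1' * U1' @\<^sub>r X2' * U2'"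
        "Y1 * V1 @\<^sub>r Y2 * V2" c "append_cols (V1' * Y1') (V2' * Y2')"])
    show "U1 * B1 * V1 + U2 * B2 * V2 = append_cols (U1 * X1) (U2 * X2) * (Y1 * V1 @\<^sub>r Y2 * V2)"
      using 1(1-4) 2(1-4) U V
      by (subst append_cols_mult_append_rows[of _ r k1 _ k2 _ c]) (auto simp: 1(5) 2(5) mult_mat_assoc)
    show "(X1' * U1' @\<^sub>r X2' * U2') * append_cols (U1 * X1) (U2 * X2) = 1\<^sub>m (k1 + k2)"
      using 1 2 U by (subst append_rows_mult_append_cols[of _ k1 r _ k2 _ k1 _ k2])
        (auto simp: one_block_mat right_mult_zero_mat left_mult_zero_mat
          cancel[of X1' k1 r1 U1' r U1 r1 X1] cancel[of X2' k2 r2 U2' r U2 r2 X2]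
          cancel[of X1' k1 r1 U1' r U2 r2 X2] cancel[of X2' k2 r2 U2' r U1 r1 X1])
    show "(Y1 * V1 @\<^sub>r Y2 * V2) * append_cols (V1' * Y1') (V2' * Y2') = 1\<^sub>m (k1 + k2)"
      using 1 2 V by (subst append_rows_mult_append_cols[of _ k1 c _ k2 _ k1 _ k2])
        (auto simp: one_block_mat right_mult_zero_mat left_mult_zero_mat
          cancel[of Y1 k1 c1 V1 c V1' c1 Y1'] cancel[of Y2 k2 c2 V2 c V2' c2 Y2']
          cancel[of Y1 k1 c1 V1 c V2' c2 Y2'] cancel[of Y2 k2 c2 V2 c V1' c1 Y1'])
  qed (use 1 2 U V in auto)
  then show ?thesis by (simp add: rank_fact_iff k1_k2_def)
qed

text \<open>The Fredholm alternative. \<open>A\<close> has the same image as its left invertible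
  factor \<open>X\<close>, to which the special case applies.\<close>

lemma image_or_functional:
  assumes A: "(A :: 'a :: field mat) \<in> carrier_mat r c" and b: "b \<in> carrier_mat r 1"
  shows "(\<exists>u \<in> carrier_mat c 1. b = A * u) \<or> (\<exists>g \<in> carrier_mat 1 r. g * A = 0\<^sub>m 1 c \<and> g * b = 1\<^sub>m 1)"
proof -
  define k where "k = mat_rank A"
  obtain X X' Y Y' where *: "X \<in> carrier_mat r k" "X' \<in> carrier_mat k r"
    "Y \<in> carrier_mat k c" "Y' \<in> carrier_mat c k" "A = X * Y" "X' * X = 1\<^sub>m k" "Y * Y' = 1\<^sub>m k"
    unfolding k_def using mat_rank_factorization[OF A] by metis
  from left_invertible_image_or_functional[OF *(1,2,6) b] show ?thesis
  proof (elim disjE bexE conjE)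
    fix y assume y: "y \<in> carrier_mat k 1" "b = X * y"
    have "b = X * ((Y * Y') * y)" using y * by simp
    also have "\<dots> = A * (Y' * y)" using y(1) *(1-4) by (simp add: *(5) mult_mat_assoc)
    finally show ?thesis using *(4) y(1) by (intro disjI1 bexI[of _ "Y' * y"]) auto
  next
    fix g assume g: "g \<in> carrier_mat 1 r" "g * X = 0\<^sub>m 1 k" "g * b = 1\<^sub>m 1"
    have "g * A = (g * X) * Y" using g(1) *(1-4) by (simp add: *(5) mult_mat_assoc)
    also have "\<dots> = 0\<^sub>m 1 c" using g *(3) by simp
    finally show ?thesis using g by blast
  qed
qed

text \<open>\<open>F * G\<close> is idempotent, and \<open>X\<close>, \<open>Y\<close> come from a
  full rank factorization of the complementary idempotent \<open>E\<close>. For an idempotent such a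
  factorization automatically satisfies \<open>Y * X = 1\<close>.\<close>

lemma complement_of_left_invertible:
  assumes F: "(F :: 'a :: field mat) \<in> carrier_mat d s" and G: "G \<in> carrier_mat s d" and GF: "G * F = 1\<^sub>m s"
  obtains X Y where "s \<le> d" "X \<in> carrier_mat d (d - s)" "Y \<in> carrier_mat (d - s) d"
    "F * G + X * Y = 1\<^sub>m d" "Y * X = 1\<^sub>m (d - s)" "G * X = 0\<^sub>m s (d - s)" "Y * F = 0\<^sub>m (d - s) s"
proof -
  define E where "E = 1\<^sub>m d - F * G"
  have E: "E \<in> carrier_mat d d" using F G by (auto simp: E_def)
  define k where "k = mat_rank E"
  obtain X X' Y Y' where *: "X \<in> carrier_mat d k" "X' \<in> carrier_mat k d"
    "Y \<in> carrier_mat k d" "Y' \<in> carrier_mat d k" "E = X * Y" "X' * X = 1\<^sub>m k" "Y * Y' = 1\<^sub>m k"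
    unfolding k_def using mat_rank_factorization[OF E] by metis
  have "F * G * F = F" using F G GF by (simp add: mult_mat_assoc)
  then have EF: "E * F = 0\<^sub>m d s" unfolding E_def
    using F G by (simp add: minus_mult_distrib_mat[of _ d d])
  have "G * (F * G) = G" using F G GF by (simp flip: mult_mat_assoc)
  then have GE: "G * E = 0\<^sub>m s d" unfolding E_def
    using F G by (subst mult_minus_distrib_mat[of _ s d _ d]) auto
  have "E * (F * G) = 0\<^sub>m d d" using EF E F G by (simp flip: mult_mat_assoc)
  then have EE: "E * E = E" using F G E
    by (subst (2) E_def) (subst mult_minus_distrib_mat[of _ d d _ d], auto simp: minus_zero_mat)
  \<comment> \<open>Padding with the identities \<open>X' * X\<close> and \<open>Y * Y'\<close>
    exhibits \<open>E * E\<close>, which collapses to \<open>E\<close>.\<close>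
  have "Y * X = (X' * X) * (Y * X) * (Y * Y')" using * by simp
  also have "\<dots> = X' * (E * E) * Y'" using *(1-4) by (simp add: *(5) mult_mat_assoc)
  also have "\<dots> = (X' * X) * (Y * Y')" using *(1-4) unfolding EE by (simp add: *(5) mult_mat_assoc)
  finally have YX: "Y * X = 1\<^sub>m k" using * by simp
  have "G * X = G * X * (Y * Y')" using * G by simp
  also have "\<dots> = G * E * Y'" using *(1-4) G by (simp add: *(5) mult_mat_assoc)
  finally have GX: "G * X = 0\<^sub>m s k" using GE *(4) by simp
  have "Y * F = (X' * X) * (Y * F)" using * F by simp
  also have "\<dots> = X' * (E * F)" using *(1-4) F by (simp add: *(5) mult_mat_assoc)
  finally have YF: "Y * F = 0\<^sub>m k s" using EF *(2) by simp
  have sum: "F * G + X * Y = 1\<^sub>m d"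
    unfolding *(5)[symmetric] E_def using F G by (intro eq_matI) auto
  \<comment> \<open>The matrix \<open>append_cols F X\<close> has a two-sided inverse, so its rank
    is both its number of rows \<open>d\<close> and its number of columns
    \<open>s + k\<close>.\<close>
  have "append_cols F X * (G @\<^sub>r Y) = 1\<^sub>m d"
    using F G *(1,3) sum by (simp add: append_cols_mult_append_rows[of F d s X k])
  moreover have "(G @\<^sub>r Y) * append_cols F X = 1\<^sub>m (s + k)"
    using F G *(1,3) GF GX YF YX by (simp add: append_rows_mult_append_cols[of G s d Y k])
  ultimately have "d = s + k"
    using mat_rank_left_invertible[of "append_cols F X" d "s + k" "G @\<^sub>r Y"]
      mat_rank_right_invertible[of "append_cols F X" d "s + k" "G @\<^sub>r Y"] F G *(1,3) by simp
  then show ?thesis using that[of X Y] *(1,3) sum YX GX YF by simp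
qed

text \<open>The columns of \<open>F\<close> form a basis of the kernel, with coordinate map
  \<open>G\<close>. On the complement spanned by \<open>X\<close> the matrix is injective, and
  \<open>A = A * X * Y\<close> has the rank of \<open>A * X\<close>.\<close>

lemma mat_rank_if_kernel:
  assumes A: "(A :: 'a :: field mat) \<in> carrier_mat r c"
    and F: "F \<in> carrier_mat c k" and G: "G \<in> carrier_mat k c" and GF: "G * F = 1\<^sub>m k"
    and AF: "A * F = 0\<^sub>m r k"
    and ker: "\<And>v. v \<in> carrier_vec c \<Longrightarrow> A *\<^sub>v v = 0\<^sub>v r \<Longrightarrow> F *\<^sub>v (G *\<^sub>v v) = v"
  shows "k \<le> c" "mat_rank A = c - k"
proof -
  obtain X Y where *: "k \<le> c" "X \<in> carrier_mat c (c - k)" "Y \<in> carrier_mat (c - k) c"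
    "F * G + X * Y = 1\<^sub>m c" "Y * X = 1\<^sub>m (c - k)" "G * X = 0\<^sub>m k (c - k)" "Y * F = 0\<^sub>m (c - k) k"
    using complement_of_left_invertible[OF F G GF] by blast
  show "k \<le> c" by fact
  have "A = A * (F * G + X * Y)" using * A by simp
  also have "\<dots> = A * F * G + A * X * Y"
    using A F G *(2,3) by (subst mult_add_distrib_mat[of _ r c _ c]) (auto simp: mult_mat_assoc)
  also have "\<dots> = A * X * Y" using A G *(2,3) AF by simp
  finally have "mat_rank A = mat_rank (A * X * Y)" by simp
  also have "\<dots> = mat_rank (A * X)"
    using A * by (intro mat_rank_right_mult[of _ r "c - k" _ c X]) auto
  also have "\<dots> = c - k"
  proof -
    have "kernel_dim (A * X) = 0"
    proof (rule kernel_dim_eq_0[of _ r "c - k"])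
      fix w assume w: "w \<in> carrier_vec (c - k)" "A * X *\<^sub>v w = 0\<^sub>v r"
      have "A *\<^sub>v (X *\<^sub>v w) = 0\<^sub>v r" using A *(2) w by simp
      then have "X *\<^sub>v w = F *\<^sub>v (G *\<^sub>v (X *\<^sub>v w))" using ker[of "X *\<^sub>v w"] *(2) w(1) by simp
      also have "\<dots> = F *\<^sub>v ((G * X) *\<^sub>v w)" using F G *(2) w(1) by simp
      also have "\<dots> = 0\<^sub>v c" using F w(1) *(6) by (auto simp: zero_mat_mult_vec)
      finally show "w = 0\<^sub>v (c - k)"
        using left_inverse_imp_inj[OF *(2,3,5) w(1)] by simp
    qed (use A * in auto)
    then show ?thesis using mat_rank_plus_kernel_dim[of "A * X" r "c - k"] A * by auto
  qed
  finally show "mat_rank A = c - k" .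
qed

subsection \<open>Kronecker products and pencils\<close>

text \<open>The Kronecker product, with the index convention of \<open>block_matrix\<close>: the
  first factor is the block pattern, the second the block.\<close>

definition tensor :: "'a::semiring_0 mat \<Rightarrow> 'a mat \<Rightarrow> 'a mat" where
  "tensor A B = mat (dim_row A * dim_row B) (dim_col A * dim_col B)
     (\<lambda>(i, j). A $$ (i div dim_row B, j div dim_col B) * B $$ (i mod dim_row B, j mod dim_col B))"

lemma tensor_carrier [simp, intro]:
  "A \<in> carrier_mat r c \<Longrightarrow> B \<in> carrier_mat r' c' \<Longrightarrow> tensor A B \<in> carrier_mat (r * r') (c * c')"
  by (auto simp: tensor_def)

lemma dim_tensor [simp]:
  "dim_row (tensor A B) = dim_row A * dim_row B" "dim_col (tensor A B) = dim_col A * dim_col B"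
  by (auto simp: tensor_def)

lemma mod_less_if_less_mult: "(i :: nat) < a * b \<Longrightarrow> i mod b < b"
  by (cases "b = 0") auto

lemma block_index_less: "(i :: nat) < a \<Longrightarrow> p < b \<Longrightarrow> i * b + p < a * b"
  by (metis add.commute add_less_cancel_right le_trans less_le_trans mult_Suc mult_le_mono1 nat_less_le not_less_eq_eq Suc_leI)

lemma block_index_exists:
  assumes "(k :: nat) < a * b"
  obtains i p where "i < a" "p < b" "k = i * b + p"
  using that[of "k div b" "k mod b"] assms less_mult_imp_div_less mod_less_if_less_mult by auto

lemma sum_blocks: "(\<Sum>k<n*m. f k) = (\<Sum>p<n. \<Sum>q<m. f (p * m + q :: nat) :: 'a :: comm_monoid_add)"
proof (induction n)
  case (Suc n)
  have "(\<Sum>k<Suc n * m. f k) = (\<Sum>k<n * m. f k) + (\<Sum>k\<in>{n * m..<n * m + m}. f k)"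
    by (simp add: lessThan_atLeast0 sum.atLeastLessThan_concat add.commute)
  also have "(\<Sum>k\<in>{n * m..<n * m + m}. f k) = (\<Sum>q<m. f (n * m + q))"
    using sum.shift_bounds_nat_ivl[of f 0 "n * m" m] by (simp add: lessThan_atLeast0 add.commute)
  finally show ?case using Suc by simp
qed auto

lemma index_tensor:
  assumes "A \<in> carrier_mat r c" "B \<in> carrier_mat r' c'" "i < r" "j < c" "p < r'" "q < c'"
  shows "tensor A B $$ (i * r' + p, j * c' + q) = A $$ (i, j) * B $$ (p, q)"
  using assms by (auto simp: tensor_def block_index_less)

lemma eq_mat_blocksI:
  assumes "A \<in> carrier_mat (r * r') (c * c')" "B \<in> carrier_mat (r * r') (c * c')"
    and "\<And>i p j q. i < r \<Longrightarrow> p < r' \<Longrightarrow> j < c \<Longrightarrow> q < c' \<Longrightarrow>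
      A $$ (i * r' + p, j * c' + q) = B $$ (i * r' + p, j * c' + q)"
  shows "A = B"
proof (rule eq_matI)
  fix k l assume "k < dim_row B" "l < dim_col B"
  then have k: "k < r * r'" and l: "l < c * c'" using assms(2) by auto
  from k l show "A $$ (k, l) = B $$ (k, l)"
    by (elim block_index_exists) (auto intro: assms(3))
qed (use assms in auto)

text \<open>The mixed product rule: commutativity of the scalars lets the double sum over inner
  indices factor.\<close>

lemma tensor_mult:
  assumes A: "A \<in> carrier_mat r n" "C \<in> carrier_mat n c" and B: "B \<in> carrier_mat r' n'" "D \<in> carrier_mat n' c'"
  shows "tensor A B * tensor C D = tensor (A * C) (B * (D :: 'a :: comm_semiring_0 mat))"
proof (rule eq_mat_blocksI[of _ r r' c c'])
  fix i p j q assume ij: "i < r" "p < r'" "j < c" "q < c'"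
  note less = block_index_less[OF ij(1,2)] block_index_less[OF ij(3,4)]
  have "(tensor A B * tensor C D) $$ (i * r' + p, j * c' + q) =
    (\<Sum>k<n*n'. tensor A B $$ (i * r' + p, k) * tensor C D $$ (k, j * c' + q))"
    using assms less by (auto simp: scalar_prod_def atLeast0LessThan intro!: sum.cong)
  also have "\<dots> = (\<Sum>k<n. \<Sum>l<n'. (A $$ (i, k) * B $$ (p, l)) * (C $$ (k, j) * D $$ (l, q)))"
    unfolding sum_blocks
    by (intro sum.cong) (use ij assms in \<open>auto simp: index_tensor[of _ r n _ r' n'] index_tensor[of _ n c _ n' c']\<close>)
  also have "\<dots> = (\<Sum>k<n. A $$ (i, k) * C $$ (k, j)) * (\<Sum>l<n'. B $$ (p, l) * D $$ (l, q))"
    by (simp add: sum_product mult_ac)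
  also have "\<dots> = tensor (A * C) (B * D) $$ (i * r' + p, j * c' + q)"
    using assms ij by (simp add: index_tensor[of _ r c _ r' c'] scalar_prod_def atLeast0LessThan)
  finally show "(tensor A B * tensor C D) $$ (i * r' + p, j * c' + q) =
    tensor (A * C) (B * D) $$ (i * r' + p, j * c' + q)" .
qed (use assms in \<open>auto intro!: mult_carrier_mat\<close>)

lemma transpose_tensor: "(tensor A B)\<^sup>T = tensor A\<^sup>T B\<^sup>T"
  by (rule eq_matI) (auto simp: tensor_def less_mult_imp_div_less mod_less_if_less_mult)

lemma tensor_one: "tensor (1\<^sub>m n) (1\<^sub>m m) = (1\<^sub>m (n * m) :: 'a :: semiring_1 mat)"
proof (rule eq_mat_blocksI[of _ n m n m])
  fix i p j q assume ij: "i < n" "p < m" "j < n" "q < m"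
  have "i * m + p = j * m + q \<longleftrightarrow> i = j \<and> p = q"
    using ij by (metis Euclidean_Rings.div_eq_0_iff add.right_neutral add_left_cancel div_mult_self3 less_nat_zero_code)
  then show "tensor (1\<^sub>m n) (1\<^sub>m m) $$ (i * m + p, j * m + q) =
      (1\<^sub>m (n * m) :: 'a mat) $$ (i * m + p, j * m + q)"
    using ij block_index_less[OF ij(1,2)] block_index_less[OF ij(3,4)]
    by (simp add: index_tensor[of _ n n _ m m])
qed auto

lemma tensor_add_right:
  "B \<in> carrier_mat r' c' \<Longrightarrow> B' \<in> carrier_mat r' c' \<Longrightarrow> tensor A (B + B') = tensor A B + tensor A B'"
  by (rule eq_matI) (auto simp: tensor_def less_mult_imp_div_less mod_less_if_less_mult distrib_left)

lemma tensor_zero_right: "tensor A (0\<^sub>m r' c') = 0\<^sub>m (dim_row A * r') (dim_col A * c')"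
  by (rule eq_matI) (auto simp: tensor_def less_mult_imp_div_less mod_less_if_less_mult)

section \<open>Pencils: their ranks under duality, isomorphism and direct sum\<close>

definition pencil :: "'a::field mat \<Rightarrow> 'a mat \<Rightarrow> 'a kron_rep \<Rightarrow> 'a mat" where
  "pencil X Y M = tensor X (alpha M) + tensor Y (beta M)"

lemma pencil_carrier [simp, intro]:
  "X \<in> carrier_mat r c \<Longrightarrow> Y \<in> carrier_mat r c \<Longrightarrow> M \<in> kron_reps d1 d2 \<Longrightarrow>
    pencil X Y M \<in> carrier_mat (r * d2) (c * d1)"
  by (auto simp: pencil_def kron_reps_def)

text \<open>Vector space duality, followed by exchanging the two vertices. It swaps
  \<open>ind_P m\<close> and \<open>ind_I m\<close>, so that rank computations and splittings for
  the former reduce to the latter.\<close>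

definition kron_dual :: "'a kron_rep \<Rightarrow> 'a kron_rep" where
  "kron_dual M = Rep (alpha M)\<^sup>T (beta M)\<^sup>T"

lemma kron_dual_in_kron_reps [simp]: "kron_dual M \<in> kron_reps d2 d1 \<longleftrightarrow> M \<in> kron_reps d1 d2"
  by (simp add: kron_dual_def kron_reps_def)

lemma kron_dual_kron_dual [simp]: "kron_dual (kron_dual M) = M"
  by (simp add: kron_dual_def)

lemma transpose_pencil:
  assumes "X \<in> carrier_mat r c" "Y \<in> carrier_mat r c" "M \<in> kron_reps d1 d2"
  shows "(pencil X Y M)\<^sup>T = pencil X\<^sup>T Y\<^sup>T (kron_dual M)"
  using assms unfolding pencil_def kron_dual_def kron_reps_def
  by (subst transpose_add[of _ "r * d2" "c * d1"]) (auto simp: transpose_tensor)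

lemma mat_rank_pencil_dual:
  assumes "X \<in> carrier_mat r c" "Y \<in> carrier_mat r c" "M \<in> kron_reps d1 d2"
  shows "mat_rank (pencil X\<^sup>T Y\<^sup>T (kron_dual M)) = mat_rank (pencil X Y M)"
  by (metis transpose_pencil[OF assms] mat_rank_transpose)

lemma invertible_matE:
  assumes "invertible_mat S" "S \<in> carrier_mat r c"
  obtains T where "T \<in> carrier_mat r r" "c = r" "S * T = 1\<^sub>m r" "T * S = (1\<^sub>m r :: 'a :: semiring_1 mat)"
proof -
  from assms obtain T where "c = r" "inverts_mat S T" "inverts_mat T S"
    by (auto simp: invertible_mat_def)
  then have *: "S * T = 1\<^sub>m r" "T * S = 1\<^sub>m (dim_row T)" using assms by (auto simp: inverts_mat_def)
  have "dim_col (S * T) = r" unfolding *(1) by simp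
  moreover have "dim_col (T * S) = dim_row T" unfolding *(2) by simp
  ultimately have "T \<in> carrier_mat r r" using assms \<open>c = r\<close> by auto
  then show ?thesis using that[of T] * \<open>c = r\<close> by auto
qed

lemma invertible_matI:
  "S \<in> carrier_mat r r \<Longrightarrow> T \<in> carrier_mat r r \<Longrightarrow> S * T = 1\<^sub>m r \<Longrightarrow> T * S = 1\<^sub>m r \<Longrightarrow>
    invertible_mat (S :: 'a :: semiring_1 mat)"
  by (auto simp: invertible_mat_def inverts_mat_def intro!: exI[of _ T])

lemma kron_isoE:
  assumes "kron_iso M N" "M \<in> kron_reps d1 d2" "N \<in> kron_reps e1 e2"
  obtains S1 T1 S2 T2 where
    "e1 = d1" "e2 = d2"
    "S1 \<in> carrier_mat d1 d1" "T1 \<in> carrier_mat d1 d1" "S1 * T1 = 1\<^sub>m d1" "T1 * S1 = 1\<^sub>m d1"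
    "S2 \<in> carrier_mat d2 d2" "T2 \<in> carrier_mat d2 d2" "S2 * T2 = 1\<^sub>m d2" "T2 * S2 = 1\<^sub>m d2"
    "S2 * alpha M = alpha N * S1" "S2 * beta M = beta N * S1"
proof -
  from assms obtain S1 S2 where
    S1: "S1 \<in> carrier_mat e1 d1" "invertible_mat S1" and S2: "S2 \<in> carrier_mat e2 d2" "invertible_mat S2"
    and eq: "S2 * alpha M = alpha N * S1" "S2 * beta M = beta N * S1"
    unfolding kron_iso_def kron_reps_def by auto
  obtain T1 where T1: "T1 \<in> carrier_mat e1 e1" "d1 = e1" "S1 * T1 = 1\<^sub>m e1" "T1 * S1 = 1\<^sub>m e1"
    using invertible_matE[OF S1(2,1)] by metis
  obtain T2 where T2: "T2 \<in> carrier_mat e2 e2" "d2 = e2" "S2 * T2 = 1\<^sub>m e2" "T2 * S2 = 1\<^sub>m e2"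
    using invertible_matE[OF S2(2,1)] by metis
  show ?thesis using that[of S1 T1 S2 T2] S1 S2 T1 T2 eq by simp
qed

lemma kron_isoI:
  assumes "M \<in> kron_reps d1 d2" "N \<in> kron_reps d1 d2"
    "S1 \<in> carrier_mat d1 d1" "T1 \<in> carrier_mat d1 d1" "S1 * T1 = 1\<^sub>m d1" "T1 * S1 = 1\<^sub>m d1"
    "S2 \<in> carrier_mat d2 d2" "T2 \<in> carrier_mat d2 d2" "S2 * T2 = 1\<^sub>m d2" "T2 * S2 = 1\<^sub>m d2"
    "S2 * alpha M = alpha N * S1" "S2 * beta M = beta N * S1"
  shows "kron_iso M N"
  unfolding kron_iso_def
  using assms invertible_matI[of S1 d1 T1] invertible_matI[of S2 d2 T2]
  by (intro exI[of _ S1] exI[of _ S2]) (auto simp: kron_reps_def)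

lemma mult_add_mult_mat:
  fixes P :: "'a :: semiring_0 mat"
  assumes "P \<in> carrier_mat r r'" "A \<in> carrier_mat r' c'" "B \<in> carrier_mat r' c'" "Q \<in> carrier_mat c' c"
  shows "P * (A + B) * Q = P * A * Q + P * B * Q"
  using assms by (simp add: mult_add_distrib_mat[of _ r r' _ c'] add_mult_distrib_mat[of _ r c' _ _ c])

lemma tensor_conjugate:
  assumes "X \<in> carrier_mat r c" "A \<in> carrier_mat d2 d1" "P \<in> carrier_mat e2 d2" "Q \<in> carrier_mat d1 e1"
  shows "tensor (1\<^sub>m r) P * tensor X A * tensor (1\<^sub>m c) Q = tensor X (P * A * (Q :: 'a :: comm_semiring_1 mat))"
  using assms by (simp add: tensor_mult[of _ r r _ c _ e2 d2 _ d1] tensor_mult[of _ r c _ c _ e2 d1 _ e1])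

lemma pencil_conjugate:
  assumes "X \<in> carrier_mat r c" "Y \<in> carrier_mat r c" "M \<in> kron_reps d1 d2"
    "P \<in> carrier_mat e2 d2" "Q \<in> carrier_mat d1 e1"
  shows "tensor (1\<^sub>m r) P * pencil X Y M * tensor (1\<^sub>m c) Q =
    pencil X Y (Rep (P * alpha M * Q) (P * beta M * Q))"
  unfolding pencil_def using assms
  by (subst mult_add_mult_mat[of _ "r * e2" "r * d2" _ "c * d1" _ _ "c * e1"])
    (auto simp: kron_reps_def tensor_conjugate[of _ r c _ d2 d1 _ e2 _ e1])

text \<open>A change of basis at the two vertices acts on all blocks alike, that is, by
  multiplication with invertible matrices \<open>tensor (1\<^sub>m r) S2\<close> and
  \<open>tensor (1\<^sub>m c) T1\<close>.\<close>

lemma mat_rank_pencil_iso: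
  assumes X: "X \<in> carrier_mat r c" "Y \<in> carrier_mat r c"
    and M: "M \<in> kron_reps d1 d2" and N: "N \<in> kron_reps e1 e2" and iso: "kron_iso M N"
  shows "mat_rank (pencil X Y M) = mat_rank (pencil X Y N)"
proof -
  obtain S1 T1 S2 T2 where *: "e1 = d1" "e2 = d2"
    "S1 \<in> carrier_mat d1 d1" "T1 \<in> carrier_mat d1 d1" "S1 * T1 = 1\<^sub>m d1" "T1 * S1 = 1\<^sub>m d1"
    "S2 \<in> carrier_mat d2 d2" "T2 \<in> carrier_mat d2 d2" "S2 * T2 = 1\<^sub>m d2" "T2 * S2 = 1\<^sub>m d2"
    "S2 * alpha M = alpha N * S1" "S2 * beta M = beta N * S1"
    using kron_isoE[OF iso M N] by metis
  have "S2 * alpha M * T1 = alpha N" "S2 * beta M * T1 = beta N"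
    using * N M by (auto simp: kron_reps_def assoc_mult_mat[of _ d2 d1 _ d1 _ d1])
  then have "pencil X Y N = tensor (1\<^sub>m r) S2 * pencil X Y M * tensor (1\<^sub>m c) T1"
    using pencil_conjugate[OF X M *(7,4)] by simp
  moreover have "mat_rank (tensor (1\<^sub>m r) S2 * pencil X Y M * tensor (1\<^sub>m c) T1) = mat_rank (pencil X Y M)"
    using X M *
    by (intro mat_rank_equivalence[of _ "r * d2" "c * d1" _ "r * d2" "tensor (1\<^sub>m r) T2" _ "c * d1" "tensor (1\<^sub>m c) S1"])
      (auto simp: tensor_mult[of _ r r _ r _ d2 d2 _ d2] tensor_mult[of _ c c _ c _ d1 d1 _ d1] tensor_one)
  ultimately show ?thesis by simp
qed

definition kron_sum :: "'a::zero kron_rep \<Rightarrow> 'a kron_rep \<Rightarrow> 'a kron_rep" where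
  "kron_sum M N =
     Rep (four_block_mat (alpha M) (0\<^sub>m (dim_row (alpha M)) (dim_col (alpha N)))
           (0\<^sub>m (dim_row (alpha N)) (dim_col (alpha M))) (alpha N))
         (four_block_mat (beta M) (0\<^sub>m (dim_row (beta M)) (dim_col (beta N)))
           (0\<^sub>m (dim_row (beta N)) (dim_col (beta M))) (beta N))"

lemma kron_sum_in_kron_reps [simp, intro]:
  "M \<in> kron_reps d1 d2 \<Longrightarrow> N \<in> kron_reps e1 e2 \<Longrightarrow> kron_sum M N \<in> kron_reps (d1 + e1) (d2 + e2)"
  by (auto simp: kron_sum_def kron_reps_def)

lemma kron_direct_sum_Nil: "kron_direct_sum [] = Rep (0\<^sub>m 0 0) (0\<^sub>m 0 0)"
  by (simp add: kron_direct_sum_def)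

lemma kron_direct_sum_Cons: "kron_direct_sum (L # Ls) = kron_sum L (kron_direct_sum Ls)"
  by (simp add: kron_direct_sum_def kron_sum_def Let_def)

text \<open>A sum over injections and projections keeps its shape under \<open>tensor X\<close>,
  whereas a block diagonal matrix does not stay block diagonal.\<close>

lemma diag_eq_biproduct:
  assumes A: "(A :: 'a :: field mat) \<in> carrier_mat d2 d1" and B: "B \<in> carrier_mat e2 e1"
  shows "four_block_mat A (0\<^sub>m d2 e1) (0\<^sub>m e2 d1) B =
    (1\<^sub>m d2 @\<^sub>r 0\<^sub>m e2 d2) * A * append_cols (1\<^sub>m d1) (0\<^sub>m d1 e1) +
    (0\<^sub>m d2 e2 @\<^sub>r 1\<^sub>m e2) * B * append_cols (0\<^sub>m e1 d1) (1\<^sub>m e1)"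
proof -
  have "(1\<^sub>m d2 @\<^sub>r 0\<^sub>m e2 d2) * A * append_cols (1\<^sub>m d1) (0\<^sub>m d1 e1) =
      four_block_mat A (0\<^sub>m d2 e1) (0\<^sub>m e2 d1) (0\<^sub>m e2 e1)"
    using A by (subst append_rows_mult[of _ d2 d2 _ e2 _ d1], auto)
      (subst append_rows_mult_append_cols[of _ d2 d1 _ e2 _ d1 _ e1], auto)
  moreover have "(0\<^sub>m d2 e2 @\<^sub>r 1\<^sub>m e2) * B * append_cols (0\<^sub>m e1 d1) (1\<^sub>m e1) =
      four_block_mat (0\<^sub>m d2 d1) (0\<^sub>m d2 e1) (0\<^sub>m e2 d1) B"
    using B by (subst append_rows_mult[of _ d2 e2 _ e2 _ e1], auto)
      (subst append_rows_mult_append_cols[of _ d2 e1 _ e2 _ d1 _ e1], auto)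
  ultimately show ?thesis
    using A B by (simp add: add_four_block_mat[of _ d2 d1 _ e1 _ e2])
qed

lemma sum_projections_injections:
  "append_cols (1\<^sub>m m) (0\<^sub>m m n) * (1\<^sub>m m @\<^sub>r 0\<^sub>m n m) = (1\<^sub>m m :: 'a :: semiring_1 mat)"
  "append_cols (0\<^sub>m n m) (1\<^sub>m n) * (0\<^sub>m m n @\<^sub>r 1\<^sub>m n) = (1\<^sub>m n :: 'a mat)"
  "append_cols (1\<^sub>m m) (0\<^sub>m m n) * (0\<^sub>m m n @\<^sub>r 1\<^sub>m n) = (0\<^sub>m m n :: 'a mat)"
  "append_cols (0\<^sub>m n m) (1\<^sub>m n) * (1\<^sub>m m @\<^sub>r 0\<^sub>m n m) = (0\<^sub>m n m :: 'a mat)"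
  by (subst append_cols_mult_append_rows[of _ m m _ n _ m], auto)
    (subst append_cols_mult_append_rows[of _ n m _ n _ n], auto,
     subst append_cols_mult_append_rows[of _ m m _ n _ n], auto,
     subst append_cols_mult_append_rows[of _ n m _ n _ m], auto)

text \<open>The biproduct identities stay valid after tensoring with an identity matrix. This brings
  the pencil into the shape of \<open>mat_rank_biproduct\<close> without permuting rows or
  columns.\<close>

lemma mat_rank_pencil_sum:
  assumes X: "X \<in> carrier_mat r c" "Y \<in> carrier_mat r c"
    and M: "M \<in> kron_reps d1 d2" and N: "N \<in> kron_reps e1 e2"
  shows "mat_rank (pencil X Y (kron_sum M N)) = mat_rank (pencil X Y M) + mat_rank (pencil X Y N)"
proof -
  define J1 J2 Q1 Q2 :: "'a mat" where "J1 = 1\<^sub>m d2 @\<^sub>r 0\<^sub>m e2 d2" and "J2 = 0\<^sub>m d2 e2 @\<^sub>r 1\<^sub>m e2"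
    and "Q1 = append_cols (1\<^sub>m d1) (0\<^sub>m d1 e1)" and "Q2 = append_cols (0\<^sub>m e1 d1) (1\<^sub>m e1)"
  define J1' J2' Q1' Q2' :: "'a mat" where
    "J1' = append_cols (1\<^sub>m d2) (0\<^sub>m d2 e2)" and "J2' = append_cols (0\<^sub>m e2 d2) (1\<^sub>m e2)"
    and "Q1' = 1\<^sub>m d1 @\<^sub>r 0\<^sub>m e1 d1" and "Q2' = 0\<^sub>m d1 e1 @\<^sub>r 1\<^sub>m e1"
  have J: "J1 \<in> carrier_mat (d2 + e2) d2" "J2 \<in> carrier_mat (d2 + e2) e2"
      "J1' \<in> carrier_mat d2 (d2 + e2)" "J2' \<in> carrier_mat e2 (d2 + e2)"
    and Q: "Q1 \<in> carrier_mat d1 (d1 + e1)" "Q2 \<in> carrier_mat e1 (d1 + e1)"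
      "Q1' \<in> carrier_mat (d1 + e1) d1" "Q2' \<in> carrier_mat (d1 + e1) e1"
    by (auto simp: J1_def J2_def Q1_def Q2_def J1'_def J2'_def Q1'_def Q2'_def)
  have JJ: "J1' * J1 = 1\<^sub>m d2" "J2' * J2 = 1\<^sub>m e2" "J1' * J2 = 0\<^sub>m d2 e2" "J2' * J1 = 0\<^sub>m e2 d2"
    unfolding J1_def J2_def J1'_def J2'_def
    by (rule sum_projections_injections)+
  have QQ: "Q1 * Q1' = 1\<^sub>m d1" "Q2 * Q2' = 1\<^sub>m e1" "Q1 * Q2' = 0\<^sub>m d1 e1" "Q2 * Q1' = 0\<^sub>m e1 d1"
    unfolding Q1_def Q2_def Q1'_def Q2'_def
    by (rule sum_projections_injections)+
  have ab: "alpha M \<in> carrier_mat d2 d1" "beta M \<in> carrier_mat d2 d1"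
    "alpha N \<in> carrier_mat e2 e1" "beta N \<in> carrier_mat e2 e1"
    using M N by (auto simp: kron_reps_def)
  have sum: "alpha (kron_sum M N) = J1 * alpha M * Q1 + J2 * alpha N * Q2"
    "beta (kron_sum M N) = J1 * beta M * Q1 + J2 * beta N * Q2"
    using ab by (auto simp: kron_sum_def J1_def J2_def Q1_def Q2_def diag_eq_biproduct)
  have t: "tensor Z (J1 * A * Q1 + J2 * B * Q2) = tensor Z (J1 * A * Q1) + tensor Z (J2 * B * Q2)"
    if "A \<in> carrier_mat d2 d1" "B \<in> carrier_mat e2 e1" for Z A B
    using J Q that by (intro tensor_add_right[of _ "d2 + e2" "d1 + e1"]) auto
  have "pencil X Y (kron_sum M N) =
      pencil X Y (Rep (J1 * alpha M * Q1) (J1 * beta M * Q1)) +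
      pencil X Y (Rep (J2 * alpha N * Q2) (J2 * beta N * Q2))"
  proof -
    have swap: "(A + B) + (C + D) = (A + C) + (B + D)"
      if "A \<in> carrier_mat m n" "B \<in> carrier_mat m n" "C \<in> carrier_mat m n" "D \<in> carrier_mat m n"
      for A B C D :: "'a mat" and m n
      using that by (intro eq_matI) auto
    have "tensor Z A \<in> carrier_mat (r * (d2 + e2)) (c * (d1 + e1))"
      if "Z \<in> carrier_mat r c" "A \<in> carrier_mat (d2 + e2) (d1 + e1)" for Z A :: "'a mat"
      using that by (rule tensor_carrier)
    then show ?thesis
      unfolding pencil_def sum t[OF ab(1,3)] t[OF ab(2,4)] kron_rep.sel
      using X J Q ab by (intro swap[of _ "r * (d2 + e2)" "c * (d1 + e1)"]) auto
  qed
  also have "\<dots> = tensor (1\<^sub>m r) J1 * pencil X Y M * tensor (1\<^sub>m c) Q1 +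
      tensor (1\<^sub>m r) J2 * pencil X Y N * tensor (1\<^sub>m c) Q2"
    using pencil_conjugate[OF X M J(1) Q(1)] pencil_conjugate[OF X N J(2) Q(2)] by simp
  also have "mat_rank \<dots> = mat_rank (pencil X Y M) + mat_rank (pencil X Y N)"
    using X M N J Q JJ QQ
    by (intro mat_rank_biproduct[of _ "r * d2" "c * d1" _ "r * e2" "c * e1" _ "r * (d2 + e2)" _
          "tensor (1\<^sub>m r) J1'" "tensor (1\<^sub>m r) J2'" _ "c * (d1 + e1)" _
          "tensor (1\<^sub>m c) Q1'" "tensor (1\<^sub>m c) Q2'"])
      (auto simp: tensor_mult[of _ r r _ r _ _ "d2 + e2"] tensor_mult[of _ c c _ c _ _ "d1 + e1"]
        tensor_one tensor_zero_right)
  finally show ?thesis .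
qed

lemma det_nonzero_inverse:
  assumes "(A :: 'a :: field mat) \<in> carrier_mat n n" "det A \<noteq> 0"
  obtains B where "B \<in> carrier_mat n n" "A * B = 1\<^sub>m n" "B * A = 1\<^sub>m n"
  using det_non_zero_imp_unit[OF assms, of "()"] that unfolding Units_def
  by (auto simp: ring_mat_def)

lemma det_nonzero_if_upper_triangular:
  assumes "(A :: 'a :: field mat) \<in> carrier_mat n n"
    and "\<And>i j. j < i \<Longrightarrow> i < n \<Longrightarrow> A $$ (i, j) = 0" "\<And>i. i < n \<Longrightarrow> A $$ (i, i) \<noteq> 0"
  shows "det A \<noteq> 0"
proof -
  have "det A = prod_list (diag_mat A)"
    using assms by (intro det_upper_triangular[of _ n]) (auto simp: upper_triangular_def)
  then show ?thesis using assms by (auto simp: prod_list_zero_iff diag_mat_def)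
qed

section \<open>\<open>P_mat\<close>, \<open>I_mat\<close> and \<open>R_mat\<close> as
  pencils\<close>

definition sub_diag :: "nat \<Rightarrow> nat \<Rightarrow> 'a::field mat" where
  "sub_diag r c = mat r c (\<lambda>(i, j). if i = j + 1 then 1 else 0)"

definition main_diag :: "nat \<Rightarrow> nat \<Rightarrow> 'a::field mat" where
  "main_diag r c = mat r c (\<lambda>(i, j). if i = j then 1 else 0)"

lemma sub_diag_carrier [simp, intro]: "sub_diag r c \<in> carrier_mat r c"
  by (simp add: sub_diag_def)

lemma main_diag_carrier [simp, intro]: "main_diag r c \<in> carrier_mat r c"
  by (simp add: main_diag_def)

lemma dim_diags [simp]:
  "dim_row (sub_diag r c) = r" "dim_col (sub_diag r c) = c"
  "dim_row (main_diag r c) = r" "dim_col (main_diag r c) = c"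
  by (simp_all add: sub_diag_def main_diag_def)

lemma block_matrix_carrier: "block_matrix d2 d1 r c B \<in> carrier_mat (r * d2) (c * d1)"
  by (simp add: block_matrix_def)

lemma index_block_matrix:
  "i < r \<Longrightarrow> j < c \<Longrightarrow> p < d2 \<Longrightarrow> q < d1 \<Longrightarrow>
    block_matrix d2 d1 r c B $$ (i * d2 + p, j * d1 + q) = B i j $$ (p, q)"
  by (auto simp: block_matrix_def block_index_less)

lemma index_pencil:
  assumes "X \<in> carrier_mat r c" "Y \<in> carrier_mat r c" "M \<in> kron_reps d1 d2"
    "i < r" "j < c" "p < d2" "q < d1"
  shows "pencil X Y M $$ (i * d2 + p, j * d1 + q) =
    X $$ (i, j) * alpha M $$ (p, q) + Y $$ (i, j) * beta M $$ (p, q)"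
  using assms block_index_less[of i r p d2] block_index_less[of j c q d1]
  by (auto simp: pencil_def kron_reps_def index_tensor[of _ r c _ d2 d1])

lemma kron_blocks_eq_pencil:
  assumes X: "X \<in> carrier_mat r c" "Y \<in> carrier_mat r c" and M: "M \<in> kron_reps d1 d2"
    and eq: "\<And>i j p q. i < r \<Longrightarrow> j < c \<Longrightarrow> p < d2 \<Longrightarrow> q < d1 \<Longrightarrow>
      B i j $$ (p, q) = X $$ (i, j) * alpha M $$ (p, q) + Y $$ (i, j) * beta M $$ (p, q)"
  shows "kron_blocks M r c B = pencil X Y M"
proof -
  have dim: "dim_row (alpha M) = d2" "dim_col (alpha M) = d1" using M by (auto simp: kron_reps_def)
  show ?thesis
    unfolding kron_blocks_def dim
  proof (rule eq_mat_blocksI[of _ r d2 c d1])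
    fix i p j q assume "i < r" "p < d2" "j < c" "q < d1"
    then show "block_matrix d2 d1 r c B $$ (i * d2 + p, j * d1 + q) =
        pencil X Y M $$ (i * d2 + p, j * d1 + q)"
      by (simp add: index_block_matrix index_pencil[OF X M] eq)
  qed (use block_matrix_carrier X M in auto)
qed

lemma I_mat_eq_pencil:
  assumes "M \<in> kron_reps d1 d2"
  shows "I_mat n M = pencil (sub_diag (n + 1) n) (main_diag (n + 1) n) M"
  unfolding I_mat_def using assms
  by (intro kron_blocks_eq_pencil) (auto simp: sub_diag_def main_diag_def kron_reps_def)

lemma P_mat_eq_pencil:
  assumes "M \<in> kron_reps d1 d2"
  shows "P_mat (Suc n) M = pencil (sub_diag (n + 1) n)\<^sup>T (main_diag (n + 1) n)\<^sup>T M"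
  unfolding P_mat_def using assms
  by (intro kron_blocks_eq_pencil) (auto simp: sub_diag_def main_diag_def kron_reps_def)

text \<open>The two matrices are transposes of each other. The index drops by one because
  \<open>P_mat n\<close> has \<open>n - 1\<close> block rows while \<open>I_mat n\<close> has
  \<open>n\<close> block columns.\<close>

lemma mat_rank_P_mat:
  assumes "M \<in> kron_reps d1 d2" "n \<ge> 1"
  shows "mat_rank (P_mat n M) = mat_rank (I_mat (n - 1) (kron_dual M))"
proof -
  obtain k where n: "n = Suc k" using assms(2) by (cases n) auto
  have "kron_dual M \<in> kron_reps d2 d1" using assms by simp
  from mat_rank_pencil_dual[OF sub_diag_carrier main_diag_carrier this, of "k + 1" k] show ?thesis
    using assms by (simp add: n P_mat_eq_pencil I_mat_eq_pencil[of _ d2 d1])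
qed

fun point_diag :: "'a::field proj_line \<Rightarrow> 'a kron_rep \<Rightarrow> 'a mat" where
  "point_diag (Pt l) M = l \<cdot>\<^sub>m alpha M - beta M"
| "point_diag Infty M = alpha M"

fun point_sub :: "'a::field proj_line \<Rightarrow> 'a kron_rep \<Rightarrow> 'a mat" where
  "point_sub (Pt l) M = alpha M"
| "point_sub Infty M = - beta M"

lemma point_diag_carrier [simp, intro]: "M \<in> kron_reps d1 d2 \<Longrightarrow> point_diag l M \<in> carrier_mat d2 d1"
  by (cases l) (auto simp: kron_reps_def)

lemma point_sub_carrier [simp, intro]: "M \<in> kron_reps d1 d2 \<Longrightarrow> point_sub l M \<in> carrier_mat d2 d1"
  by (cases l) (auto simp: kron_reps_def)

lemma point_diag_kron_dual:
  assumes "M \<in> kron_reps d1 d2"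
  shows "point_diag l (kron_dual M) = (point_diag l M)\<^sup>T"
  using assms by (cases l) (auto simp: kron_dual_def kron_reps_def intro!: eq_matI)

text \<open>The block patterns of \<open>alpha M\<close> and \<open>beta M\<close> in
  \<open>R_mat\<close>. At a finite point \<open>alpha M\<close> occurs both on and below the
  diagonal, hence the sum in the first component.\<close>

fun point_coeffs :: "nat \<Rightarrow> 'a::field proj_line \<Rightarrow> 'a mat \<times> 'a mat" where
  "point_coeffs n (Pt l) = (l \<cdot>\<^sub>m 1\<^sub>m n + sub_diag n n, - 1\<^sub>m n)"
| "point_coeffs n Infty = (1\<^sub>m n, - sub_diag n n)"

lemma point_coeffs_carrier:
  "fst (point_coeffs n l) \<in> carrier_mat n n" "snd (point_coeffs n l) \<in> carrier_mat n n"
  by (cases l; auto)+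

lemma R_mat_eq_pencil:
  assumes "M \<in> kron_reps d1 d2"
  shows "R_mat n l M = pencil (fst (point_coeffs n l)) (snd (point_coeffs n l)) M"
proof (cases l)
  case (Pt a)
  show ?thesis unfolding Pt R_mat.simps using assms
    by (intro kron_blocks_eq_pencil) (auto simp: sub_diag_def kron_reps_def)
next
  case Infty
  show ?thesis unfolding Infty R_mat.simps using assms
    by (intro kron_blocks_eq_pencil) (auto simp: sub_diag_def kron_reps_def)
qed

section \<open>Ranks of block bidiagonal matrices\<close>

definition bidiag :: "nat \<Rightarrow> 'a::field mat \<Rightarrow> 'a mat \<Rightarrow> 'a mat" where
  "bidiag n B A = tensor (1\<^sub>m n) B + tensor (sub_diag n n) A"

lemma bidiag_eq_pencil: "bidiag n B A = pencil (1\<^sub>m n) (sub_diag n n) (Rep B A)"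
  by (simp add: bidiag_def pencil_def)

lemma bidiag_carrier [simp, intro]:
  "B \<in> carrier_mat d2 d1 \<Longrightarrow> A \<in> carrier_mat d2 d1 \<Longrightarrow> bidiag n B A \<in> carrier_mat (n * d2) (n * d1)"
  unfolding bidiag_eq_pencil by (rule pencil_carrier) (auto simp: kron_reps_def)

text \<open>\<open>R_mat\<close> is needed in two forms: grouped by \<open>alpha M\<close> and
  \<open>beta M\<close> for invariance and additivity of the rank, and grouped by diagonals, as
  here, for its value on indecomposables.\<close>

lemma R_mat_eq_bidiag:
  assumes M: "M \<in> kron_reps d1 d2"
  shows "R_mat n l M = bidiag n (point_diag l M) (point_sub l M)"
proof -
  have ab: "alpha M \<in> carrier_mat d2 d1" "beta M \<in> carrier_mat d2 d1"
    using M by (auto simp: kron_reps_def)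
  have *: "Rep (point_diag l M) (point_sub l M) \<in> kron_reps d1 d2"
    using M by (simp add: kron_reps_def point_diag_carrier point_sub_carrier)
  show ?thesis
    unfolding R_mat_eq_pencil[OF M] bidiag_eq_pencil
  proof (rule eq_mat_blocksI[of _ n d2 n d1])
    fix i p j q assume ij: "i < n" "p < d2" "j < n" "q < d1"
    show "pencil (fst (point_coeffs n l)) (snd (point_coeffs n l)) M $$ (i * d2 + p, j * d1 + q) =
      pencil (1\<^sub>m n) (sub_diag n n) (Rep (point_diag l M) (point_sub l M)) $$ (i * d2 + p, j * d1 + q)"
      unfolding index_pencil[OF point_coeffs_carrier M ij(1,3,2,4)]
        index_pencil[OF one_carrier_mat sub_diag_carrier * ij(1,3,2,4)]
      using ij ab by (cases l) (auto simp: sub_diag_def)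
  qed (use M * point_coeffs_carrier in \<open>auto intro!: pencil_carrier\<close>)
qed

text \<open>Strict lower triangularity of \<open>N\<close> passes to \<open>tensor N C\<close>
  whatever \<open>C\<close> is, so the matrix is unitriangular. The transpose appears because the
  determinant criterion is stated for upper triangular matrices.\<close>

lemma unipotent_tensor_inverse:
  assumes N: "N \<in> carrier_mat n n" "\<And>i j. i \<le> j \<Longrightarrow> j < n \<Longrightarrow> N $$ (i, j) = 0"
    and C: "(C :: 'a :: field mat) \<in> carrier_mat m m"
  obtains D where "D \<in> carrier_mat (n * m) (n * m)" "D * (1\<^sub>m (n * m) + tensor N C) = 1\<^sub>m (n * m)"
    "(1\<^sub>m (n * m) + tensor N C) * D = 1\<^sub>m (n * m)"
proof -
  let ?U = "1\<^sub>m (n * m) + tensor N C"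
  have U: "?U \<in> carrier_mat (n * m) (n * m)" using N C by auto
  have upper: "tensor N C $$ (k, l) = 0" if "k \<le> l" "l < n * m" for k l
  proof -
    have "k div m \<le> l div m" "l div m < n"
      using that by (auto simp: div_le_mono less_mult_imp_div_less)
    then have "N $$ (k div m, l div m) = 0" by (rule N(2))
    then show ?thesis using that N C by (auto simp: tensor_def)
  qed
  have "det ?U\<^sup>T \<noteq> 0"
  proof (rule det_nonzero_if_upper_triangular[of _ "n * m"])
    show "?U\<^sup>T $$ (i, j) = 0" if "j < i" "i < n * m" for i j
      using that N C upper[of j i] by auto
    show "?U\<^sup>T $$ (i, i) \<noteq> 0" if "i < n * m" for i
      using that N C upper[of i i] by auto
  qed (use U in auto)
  then have "det ?U \<noteq> 0" using det_transpose[OF U] by simp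
  with det_nonzero_inverse[OF U] show ?thesis using that by metis
qed

text \<open>Multiplying every block row by \<open>B'\<close> turns the diagonal blocks into
  identities and leaves a unipotent matrix. The subdiagonal block \<open>A\<close> is
  arbitrary.\<close>

lemma bidiag_left_inverse:
  assumes B: "B \<in> carrier_mat d2 d1" "B' \<in> carrier_mat d1 d2" "B' * B = 1\<^sub>m d1"
    and A: "A \<in> carrier_mat d2 d1"
  obtains D where "D \<in> carrier_mat (n * d1) (n * d2)" "D * bidiag n B A = 1\<^sub>m (n * d1)"
proof -
  obtain D where D: "D \<in> carrier_mat (n * d1) (n * d1)"
    "D * (1\<^sub>m (n * d1) + tensor (sub_diag n n) (B' * A)) = 1\<^sub>m (n * d1)"
    using unipotent_tensor_inverse[of "sub_diag n n" n "B' * A" d1] A B by (auto simp: sub_diag_def)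
  have "tensor (1\<^sub>m n) B' * bidiag n B A = 1\<^sub>m (n * d1) + tensor (sub_diag n n) (B' * A)"
    unfolding bidiag_def using A B
    by (subst mult_add_distrib_mat[of _ "n * d1" "n * d2" _ "n * d1"])
      (auto simp: tensor_mult[of _ n n _ n _ d1 d2 _ d1] tensor_one)
  then have "D * tensor (1\<^sub>m n) B' * bidiag n B A = 1\<^sub>m (n * d1)"
    using D A B by (subst assoc_mult_mat[of _ "n * d1" "n * d1" _ "n * d2" _ "n * d1"]) auto
  with that[of "D * tensor (1\<^sub>m n) B'"] show ?thesis using D B by auto
qed

lemma mat_rank_bidiag_left:
  assumes "B \<in> carrier_mat d2 d1" "mat_rank B = d1" "A \<in> carrier_mat d2 d1"
  shows "mat_rank (bidiag n B A) = n * d1"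
proof -
  obtain B' where "B' \<in> carrier_mat d1 d2" "B' * B = 1\<^sub>m d1"
    using left_inverse_if_full_rank assms by metis
  then obtain D where "D \<in> carrier_mat (n * d1) (n * d2)" "D * bidiag n B A = 1\<^sub>m (n * d1)"
    using bidiag_left_inverse assms by metis
  then show ?thesis using mat_rank_left_invertible[of "bidiag n B A"] assms by auto
qed

lemma mat_rank_bidiag_right:
  assumes B: "B \<in> carrier_mat d2 d1" "mat_rank B = d2" and A: "A \<in> carrier_mat d2 d1"
  shows "mat_rank (bidiag n B A) = n * d2"
proof -
  obtain B' where "B' \<in> carrier_mat d2 d1" "B' * B\<^sup>T = 1\<^sub>m d2"
    using left_inverse_if_full_rank[of "B\<^sup>T" d1 d2] B mat_rank_transpose[of B] by auto
  then have B': "B'\<^sup>T \<in> carrier_mat d1 d2" "B * B'\<^sup>T = 1\<^sub>m d2"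
    using B transpose_mult[of B' d2 d1 "B\<^sup>T" d2] by auto
  obtain D where D: "D \<in> carrier_mat (n * d2) (n * d2)"
    "(1\<^sub>m (n * d2) + tensor (sub_diag n n) (A * B'\<^sup>T)) * D = 1\<^sub>m (n * d2)"
    using unipotent_tensor_inverse[of "sub_diag n n" n "A * B'\<^sup>T" d2] A B' by (auto simp: sub_diag_def)
  have "bidiag n B A * tensor (1\<^sub>m n) B'\<^sup>T = 1\<^sub>m (n * d2) + tensor (sub_diag n n) (A * B'\<^sup>T)"
    unfolding bidiag_def using A B B'
    by (subst add_mult_distrib_mat[of _ "n * d2" "n * d1" _ _ "n * d2"])
      (auto simp: tensor_mult[of _ n n _ n _ d2 d1 _ d2] tensor_one)
  then have "bidiag n B A * (tensor (1\<^sub>m n) B'\<^sup>T * D) = 1\<^sub>m (n * d2)"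
    using D A B B' by (subst assoc_mult_mat[of _ "n * d2" "n * d1" _ "n * d2" _ "n * d2", symmetric]) auto
  then show ?thesis
    using D A B B' by (intro mat_rank_right_invertible[of _ "n * d2" "n * d1" "tensor (1\<^sub>m n) B'\<^sup>T * D"]) auto
qed

lemma pencil_mult_vec:
  assumes "X \<in> carrier_mat r c" "Y \<in> carrier_mat r c" "M \<in> kron_reps d1 d2"
    "v \<in> carrier_vec (c * d1)" "i < r" "p < d2"
  shows "(pencil X Y M *\<^sub>v v) $ (i * d2 + p) =
    (\<Sum>j<c. \<Sum>q<d1. (X $$ (i, j) * alpha M $$ (p, q) + Y $$ (i, j) * beta M $$ (p, q)) * v $ (j * d1 + q))"
proof -
  have "(pencil X Y M *\<^sub>v v) $ (i * d2 + p) =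
      (\<Sum>k<c*d1. pencil X Y M $$ (i * d2 + p, k) * v $ k)"
    using assms(4-6) block_index_less[of i r p d2] carrier_matD[OF pencil_carrier[OF assms(1-3)]]
    by (auto simp: scalar_prod_def atLeast0LessThan intro!: sum.cong)
  also have "\<dots> = (\<Sum>j<c. \<Sum>q<d1. (X $$ (i, j) * alpha M $$ (p, q) + Y $$ (i, j) * beta M $$ (p, q)) * v $ (j * d1 + q))"
    unfolding sum_blocks using assms by (intro sum.cong refl) (simp add: index_pencil)
  finally show ?thesis .
qed

subsection \<open>Ranks of the block matrices of indecomposables\<close>

lemma ind_P_in_kron_reps [simp, intro]: "m \<ge> 1 \<Longrightarrow> ind_P m \<in> kron_reps (m - 1) m"
  using carrier_append_rows[of "1\<^sub>m (m - 1)" "m - 1" "m - 1" "0\<^sub>m 1 (m - 1)" 1]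
    carrier_append_rows[of "0\<^sub>m 1 (m - 1)" 1 "m - 1" "1\<^sub>m (m - 1)" "m - 1"]
  by (auto simp: ind_P_def kron_reps_def)

lemma kron_dual_ind_P: "kron_dual (ind_P m) = ind_I m"
  by (simp add: kron_dual_def ind_P_def ind_I_def transpose_append_rows[of _ "m - 1" "m - 1" _ 1]
      transpose_append_rows[of _ 1 "m - 1" _ "m - 1"] del: One_nat_def)

lemma kron_dual_ind_I: "kron_dual (ind_I m) = ind_P m"
  using kron_dual_kron_dual[of "ind_P m"] by (simp add: kron_dual_ind_P)

lemma ind_I_in_kron_reps [simp, intro]: "m \<ge> 1 \<Longrightarrow> ind_I m \<in> kron_reps m (m - 1)"
  by (metis ind_P_in_kron_reps kron_dual_in_kron_reps kron_dual_ind_P)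

lemma ind_R_in_kron_reps [simp, intro]: "ind_R m l \<in> kron_reps m m"
  by (cases l) (auto simp: kron_reps_def)

lemma index_ind_I:
  assumes "p < m - 1" "q < m"
  shows "alpha (ind_I m) $$ (p, q) = (if q = p then 1 else 0)"
    "beta (ind_I m) $$ (p, q) = (if q = Suc p then 1 else 0)"
  using assms
  by (auto simp: ind_I_def index_append_cols[of "1\<^sub>m (m - 1)" "m - 1" "m - 1" "0\<^sub>m (m - 1) 1" 1]
      index_append_cols[of "0\<^sub>m (m - 1) 1" "m - 1" 1 "1\<^sub>m (m - 1)" "m - 1"] simp del: One_nat_def)

lemma full_column_rank_if_mult:
  assumes A: "(A :: 'a :: field mat) \<in> carrier_mat r c" and L: "L \<in> carrier_mat s r" and "mat_rank (L * A) = c"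
  shows "mat_rank A = c"
proof -
  obtain D where D: "D \<in> carrier_mat c s" "D * (L * A) = 1\<^sub>m c"
    using left_inverse_if_full_rank[of "L * A" s c] assms by auto
  then have "D * L * A = 1\<^sub>m c" using A L by simp
  then show ?thesis using mat_rank_left_invertible[OF A, of "D * L"] D L by auto
qed

text \<open>Left multiplication by \<open>main_diag n (n + 1)\<close> deletes the last row, and by
  the transpose of \<open>sub_diag (n + 1) n\<close> the first row.\<close>

lemma shift_products:
  "main_diag n (n + 1) * sub_diag (n + 1) n = (sub_diag n n :: 'a :: field mat)"
  "main_diag n (n + 1) * main_diag (n + 1) n = (1\<^sub>m n :: 'a mat)"
  "(sub_diag (n + 1) n)\<^sup>T * sub_diag (n + 1) n = (1\<^sub>m n :: 'a mat)"
  "(sub_diag (n + 1) n)\<^sup>T * main_diag (n + 1) n = ((sub_diag n n)\<^sup>T :: 'a mat)"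
  by (rule eq_matI; auto simp: scalar_prod_def sub_diag_def main_diag_def if_distrib[of "\<lambda>x. x * _"] cong: if_cong)+

text \<open>Deleting the last block row of \<open>I_mat\<close> leaves a lower bidiagonal matrix
  with \<open>beta M\<close> on the diagonal; deleting the first leaves an upper bidiagonal one with
  \<open>alpha M\<close> there. Either way an injective diagonal block gives full column
  rank.\<close>

lemma mat_rank_I_mat_full:
  assumes M: "M \<in> kron_reps d1 d2" and inj: "mat_rank (alpha M) = d1 \<or> mat_rank (beta M) = d1"
  shows "mat_rank (I_mat n M) = n * d1"
proof -
  have ab: "alpha M \<in> carrier_mat d2 d1" "beta M \<in> carrier_mat d2 d1"
    using M by (auto simp: kron_reps_def)
  have I: "I_mat n M \<in> carrier_mat ((n + 1) * d2) (n * d1)"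
    unfolding I_mat_eq_pencil[OF M] using M by (intro pencil_carrier) auto
  have prod: "tensor L (1\<^sub>m d2) * I_mat n M =
      tensor (L * sub_diag (n + 1) n) (alpha M) + tensor (L * main_diag (n + 1) n) (beta M)"
    if "L \<in> carrier_mat n (n + 1)" for L
    unfolding I_mat_eq_pencil[OF M] pencil_def using ab that
    by (subst mult_add_distrib_mat[of _ "n * d2" "(n + 1) * d2" _ "n * d1"])
      (auto simp: tensor_mult[of _ n "n + 1" _ n _ d2 d2 _ d1] simp del: mult_Suc)
  show ?thesis
  proof (cases "mat_rank (beta M) = d1")
    case True
    have "tensor (main_diag n (n + 1)) (1\<^sub>m d2) * I_mat n M = bidiag n (beta M) (alpha M)"
      unfolding bidiag_def prod[OF main_diag_carrier] shift_products using ab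
      by (intro comm_add_mat[of _ "n * d2" "n * d1"]) auto
    then show ?thesis
      using mat_rank_bidiag_left[OF ab(2) True ab(1)]
      by (intro full_column_rank_if_mult[OF I, of "tensor (main_diag n (n + 1)) (1\<^sub>m d2)" "n * d2"])
        (auto simp del: mult_Suc)
  next
    case False
    with inj have rk: "mat_rank (alpha M)\<^sup>T = d1" by (simp add: mat_rank_transpose)
    have "tensor (sub_diag (n + 1) n)\<^sup>T (1\<^sub>m d2) * I_mat n M = (bidiag n (alpha M)\<^sup>T (beta M)\<^sup>T)\<^sup>T"
      unfolding bidiag_def using ab
      by (subst prod, simp, subst transpose_add[of _ "n * d1" "n * d2"])
        (auto simp: shift_products[unfolded Suc_eq_plus1[symmetric]] transpose_tensor)
    then have "mat_rank (tensor (sub_diag (n + 1) n)\<^sup>T (1\<^sub>m d2) * I_mat n M) = n * d1"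
      using mat_rank_bidiag_right[of "(alpha M)\<^sup>T" d1 d2 "(beta M)\<^sup>T" n] rk ab
      by (simp add: mat_rank_transpose)
    then show ?thesis
      by (intro full_column_rank_if_mult[OF I, of "tensor (sub_diag (n + 1) n)\<^sup>T (1\<^sub>m d2)" "n * d2"])
        (auto simp del: mult_Suc)
  qed
qed

lemma sum_sum_delta:
  "(\<Sum>j<(n::nat). \<Sum>q<(m::nat). (if j = a \<and> q = b then f j q else 0)) =
    (if a < n \<and> b < m then f a b else (0 :: 'a :: comm_monoid_add))"
proof -
  have "(\<Sum>j<n. \<Sum>q<m. (if j = a \<and> q = b then f j q else 0)) =
      (\<Sum>j<n. if j = a then (if b < m then f a b else 0) else 0)"
    by (intro sum.cong refl) auto
  then show ?thesis by simp
qed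

lemma I_mat_ind_I_mult_vec:
  assumes m: "m \<ge> 1" and v: "v \<in> carrier_vec (n * m)" and i: "i < n + 1" "p < m - 1"
  shows "(I_mat n (ind_I m) *\<^sub>v v) $ (i * (m - 1) + p) =
    (if i \<ge> 1 then v $ ((i - 1) * m + p) else 0) + (if i < n then v $ (i * m + Suc p) else 0)"
proof -
  have "(I_mat n (ind_I m) *\<^sub>v v) $ (i * (m - 1) + p) =
    (\<Sum>j<n. \<Sum>q<m. (sub_diag (n + 1) n $$ (i, j) * alpha (ind_I m) $$ (p, q) +
      main_diag (n + 1) n $$ (i, j) * beta (ind_I m) $$ (p, q)) * v $ (j * m + q))"
    unfolding I_mat_eq_pencil[OF ind_I_in_kron_reps[OF m]]
    by (rule pencil_mult_vec[OF _ _ ind_I_in_kron_reps[OF m] v i]) auto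
  also have "\<dots> = (\<Sum>j<n. \<Sum>q<m. (if j = i - 1 \<and> q = p then (if i \<ge> 1 then v $ (j * m + q) else 0) else 0) +
      (if j = i \<and> q = Suc p then v $ (j * m + q) else 0))"
    using i by (intro sum.cong refl) (auto simp: index_ind_I sub_diag_def main_diag_def)
  also have "\<dots> = (if i \<ge> 1 then v $ ((i - 1) * m + p) else 0) + (if i < n then v $ (i * m + Suc p) else 0)"
    using i unfolding sum.distrib sum_sum_delta by auto
  finally show ?thesis .
qed

text \<open>Up to signs the kernel is the space of homomorphisms from \<open>ind_I n\<close> to
  \<open>ind_I m\<close>. Its dimension is \<open>n + 1 - m\<close>, and 0 for
  \<open>m > n + 1\<close>, in agreement with truncated subtraction.\<close>

lemma mat_rank_I_mat_ind_I:
  assumes m: "m \<ge> 1"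
  shows "mat_rank (I_mat n (ind_I m)) = n * m - (n + 1 - m)"
proof -
  define k where "k = n + 1 - m"
  \<comment> \<open>A kernel vector satisfies \<open>x (i + 1) (p + 1) = - x i p\<close>, so its entries \<open>x s 0\<close> determine it;
    they can be chosen freely for \<open>s < k\<close> and vanish otherwise.\<close>
  define x where "x v i p = v $ (i * m + p)" for v :: "'a vec" and i p
  have A: "I_mat n (ind_I m) \<in> carrier_mat ((n + 1) * (m - 1)) (n * m)"
    unfolding I_mat_eq_pencil[OF ind_I_in_kron_reps[OF m]]
    by (rule pencil_carrier[OF _ _ ind_I_in_kron_reps[OF m]]) auto
  define F :: "'a mat" where "F = mat (n * m) k (\<lambda>(a, s). if a div m = s + a mod m then (- 1) ^ (a mod m) else 0)"
  define G :: "'a mat" where "G = mat k (n * m) (\<lambda>(s, a). if a = s * m then 1 else 0)"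
  have F: "F \<in> carrier_mat (n * m) k" and G: "G \<in> carrier_mat k (n * m)" by (auto simp: F_def G_def)
  have sm: "s * m < n * m" if "s < k" for s
    using that m by (auto simp: k_def)
  have Fidx: "F $$ (i * m + p, s) = (if i = s + p then (- 1) ^ p else 0)" if "i < n" "p < m" "s < k" for i p s
    using that block_index_less[of i n p m] by (auto simp: F_def)
  have eqs: "(if i \<ge> 1 then x v (i - 1) p else 0) + (if i < n then x v i (Suc p) else 0) = 0"
    if "v \<in> carrier_vec (n * m)" "I_mat n (ind_I m) *\<^sub>v v = 0\<^sub>v ((n + 1) * (m - 1))" "i < n + 1" "p < m - 1" for v i p
    using I_mat_ind_I_mult_vec[OF m that(1,3,4)] block_index_less[OF that(3,4)] unfolding that(2) x_def by simp
  have GF: "G * F = 1\<^sub>m k"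
  proof (rule eq_matI)
    fix s t assume "s < dim_row (1\<^sub>m k :: 'a mat)" "t < dim_col (1\<^sub>m k :: 'a mat)"
    then have st: "s < k" "t < k" by auto
    have "(G * F) $$ (s, t) = (\<Sum>a<n*m. if a = s * m then F $$ (a, t) else 0)"
      using st F G by (auto simp: scalar_prod_def atLeast0LessThan G_def
          if_distrib[of "\<lambda>x. x * _"] cong: if_cong)
    also have "\<dots> = F $$ (s * m, t)" using sm[OF st(1)] by simp
    also have "\<dots> = (if s = t then 1 else 0)"
      using Fidx[of s 0 t] st sm[OF st(1)] m by simp
    finally show "(G * F) $$ (s, t) = 1\<^sub>m k $$ (s, t)" using st by simp
  qed (use F G in auto)
  have AF: "I_mat n (ind_I m) * F = 0\<^sub>m ((n + 1) * (m - 1)) k"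
  proof (rule eq_matI)
    fix a s assume "a < dim_row (0\<^sub>m ((n + 1) * (m - 1)) k :: 'a mat)" "s < dim_col (0\<^sub>m ((n + 1) * (m - 1)) k :: 'a mat)"
    then have a: "a < (n + 1) * (m - 1)" and s: "s < k" by auto
    obtain i p where ip: "i < n + 1" "p < m - 1" "a = i * (m - 1) + p" by (rule block_index_exists[OF a])
    have c: "col F s \<in> carrier_vec (n * m)" using F by (intro carrier_vecI) simp
    have ent: "col F s $ (j * m + q) = (if j = s + q then (- 1) ^ q else 0)" if "j < n" "q < m" for j q
      using that s F Fidx[OF that s] block_index_less[OF that] by auto
    have "(I_mat n (ind_I m) * F) $$ (a, s) = (I_mat n (ind_I m) *\<^sub>v col F s) $ a"
      using a s by (simp only: index_mult_mat(1) index_mult_mat_vec carrier_matD[OF A] carrier_matD[OF F])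
    also have "\<dots> = 0"
      unfolding ip(3) I_mat_ind_I_mult_vec[OF m c ip(1,2)] using ip s m ent[of i "Suc p"]
      by (auto simp: ent k_def)
    finally show "(I_mat n (ind_I m) * F) $$ (a, s) = 0\<^sub>m ((n + 1) * (m - 1)) k $$ (a, s)"
      using a s by simp
  qed (use A F in auto)
  have ker: "F *\<^sub>v (G *\<^sub>v v) = v"
    if v: "v \<in> carrier_vec (n * m)" and Av: "I_mat n (ind_I m) *\<^sub>v v = 0\<^sub>v ((n + 1) * (m - 1))" for v
  proof (rule eq_vecI)
    note E = eqs[OF v Av]
    \<comment> \<open>Following the recursion back along a diagonal ends either at an entry
      \<open>x s 0\<close> or, for \<open>i < p\<close>, in block 0, where the first block row
      forces the value 0.\<close>
    have c1: "x v i p = (- 1) ^ p * x v (i - p) 0" if "p \<le> i" "i < n" "p < m" for i p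
      using that
    proof (induction p arbitrary: i)
      case (Suc p)
      then show ?case using E[of i p] by (auto simp: add_eq_0_iff)
    qed auto
    have c2: "x v i p = 0" if "i < p" "i < n" "p < m" for i p
      using that
    proof (induction i arbitrary: p)
      case 0
      then show ?case using E[of 0 "p - 1"] by auto
    next
      case (Suc i)
      then show ?case using E[of "Suc i" "p - 1"] by auto
    qed
    \<comment> \<open>Such a diagonal meets the last block \<open>n - 1\<close> at an index below
      \<open>m - 1\<close>, where the last block row of \<open>I_mat\<close> forces the value
      0.\<close>
    have c3: "x v s 0 = 0" if "s < n" "k \<le> s" for s
    proof -
      have "x v (n - 1) (n - 1 - s) = 0" using E[of n "n - 1 - s"] that m by (auto simp: k_def)
      moreover have "x v (n - 1) (n - 1 - s) = (- 1) ^ (n - 1 - s) * x v s 0"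
        using c1[of "n - 1 - s" "n - 1"] that m by (auto simp: k_def)
      ultimately show ?thesis by simp
    qed
    fix a assume "a < dim_vec v"
    then have a: "a < n * m" using v by auto
    obtain i p where ip: "i < n" "p < m" "a = i * m + p" by (rule block_index_exists[OF a])
    have Gv: "(G *\<^sub>v v) $ s = x v s 0" if "s < k" for s
    proof -
      have "(G *\<^sub>v v) $ s = (\<Sum>a<n*m. if a = s * m then v $ a else 0)"
        using that v G by (auto simp: scalar_prod_def atLeast0LessThan G_def
            if_distrib[of "\<lambda>x. x * _"] cong: if_cong)
      then show ?thesis using sm[OF that] by (simp add: x_def)
    qed
    have "(F *\<^sub>v (G *\<^sub>v v)) $ a = (\<Sum>s<k. F $$ (a, s) * (G *\<^sub>v v) $ s)"
      using a F G v by (auto simp: scalar_prod_def atLeast0LessThan intro!: sum.cong)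
    also have "\<dots> = (\<Sum>s<k. if s = i - p then (if p \<le> i then (- 1) ^ p * x v s 0 else 0) else 0)"
      unfolding ip(3) by (intro sum.cong refl) (use ip in \<open>auto simp: Fidx Gv\<close>)
    also have "\<dots> = x v i p" using c1[of p i] c2[of i p] c3[of "i - p"] ip by auto
    finally show "(F *\<^sub>v (G *\<^sub>v v)) $ a = v $ a" by (simp add: ip(3) x_def)
  qed (use F v in auto)
  show ?thesis using mat_rank_if_kernel(2)[OF A F G GF AF ker] by (simp add: k_def)
qed

text \<open>The nilpotent Jordan block of size \<open>m\<close>. Up to sign it is the diagonal block
  of \<open>R_mat\<close> at the point of \<open>ind_R m l\<close> itself.\<close>

definition super_diag :: "nat \<Rightarrow> 'a::field mat" where
  "super_diag m = (sub_diag m m)\<^sup>T"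

lemma bidiag_super_diag_mult_vec:
  assumes v: "(v :: 'a :: field vec) \<in> carrier_vec (n * m)" and i: "i < n" "p < m"
  shows "(bidiag n (- super_diag m) (1\<^sub>m m) *\<^sub>v v) $ (i * m + p) =
    (if i \<ge> 1 then v $ ((i - 1) * m + p) else 0) - (if Suc p < m then v $ (i * m + Suc p) else 0)"
proof -
  have M: "Rep (- super_diag m) (1\<^sub>m m) \<in> kron_reps m m"
    by (auto simp: kron_reps_def super_diag_def)
  have "(bidiag n (- super_diag m) (1\<^sub>m m) *\<^sub>v v) $ (i * m + p) =
    (\<Sum>j<n. \<Sum>q<m. (1\<^sub>m n $$ (i, j) * (- super_diag m) $$ (p, q) +
      sub_diag n n $$ (i, j) * 1\<^sub>m m $$ (p, q)) * v $ (j * m + q))"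
    unfolding bidiag_eq_pencil using pencil_mult_vec[OF one_carrier_mat sub_diag_carrier M v i] by simp
  also have "\<dots> = (\<Sum>j<n. \<Sum>q<m. (if j = i - 1 \<and> q = p then (if i \<ge> 1 then v $ (j * m + q) else 0) else 0) -
      (if j = i \<and> q = Suc p then v $ (j * m + q) else 0))"
    using i by (intro sum.cong refl) (auto simp: super_diag_def sub_diag_def)
  also have "\<dots> = (if i \<ge> 1 then v $ ((i - 1) * m + p) else 0) - (if Suc p < m then v $ (i * m + Suc p) else 0)"
    using i unfolding sum_subtractf sum_sum_delta by auto
  finally show ?thesis .
qed

text \<open>The kernel is isomorphic to the kernel of the \<open>n\<close>-th power of a nilpotent
  Jordan block of size \<open>m\<close>, which has dimension \<open>min n m\<close>.\<close>

lemma mat_rank_bidiag_super_diag: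
  "mat_rank (bidiag n (- super_diag m) (1\<^sub>m m :: 'a :: field mat)) = n * m - min n m"
proof -
  let ?A = "bidiag n (- super_diag m) (1\<^sub>m m) :: 'a mat"
  define k where "k = min n m"
  \<comment> \<open>The blocks of a kernel vector are \<open>N^(n - 1 - i) w\<close> with \<open>N = super_diag m\<close> and \<open>N^n w = 0\<close>.\<close>
  define x where "x v i p = v $ (i * m + p)" for v :: "'a vec" and i p
  have A: "?A \<in> carrier_mat (n * m) (n * m)"
    by (rule bidiag_carrier) (auto simp: super_diag_def)
  define F :: "'a mat" where "F = mat (n * m) k (\<lambda>(a, s). if a mod m + (n - 1 - a div m) = s then 1 else 0)"
  define G :: "'a mat" where "G = mat k (n * m) (\<lambda>(s, a). if a = (n - 1) * m + s then 1 else 0)"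
  have F: "F \<in> carrier_mat (n * m) k" and G: "G \<in> carrier_mat k (n * m)" by (auto simp: F_def G_def)
  have sm: "(n - 1) * m + s < n * m" if "s < k" for s
    using block_index_less[of "n - 1" n s m] that by (auto simp: k_def)
  have Fidx: "F $$ (i * m + p, s) = (if p + (n - 1 - i) = s then 1 else 0)" if "i < n" "p < m" "s < k" for i p s
    using that block_index_less[of i n p m] by (auto simp: F_def)
  have eqs: "(if i \<ge> 1 then x v (i - 1) p else 0) = (if Suc p < m then x v i (Suc p) else 0)"
    if "v \<in> carrier_vec (n * m)" "?A *\<^sub>v v = 0\<^sub>v (n * m)" "i < n" "p < m" for v i p
    using bidiag_super_diag_mult_vec[OF that(1,3,4)] block_index_less[OF that(3,4)] unfolding that(2) x_def by simp
  have GF: "G * F = 1\<^sub>m k"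
  proof (rule eq_matI)
    fix s t assume "s < dim_row (1\<^sub>m k :: 'a mat)" "t < dim_col (1\<^sub>m k :: 'a mat)"
    then have st: "s < k" "t < k" by auto
    have "(G * F) $$ (s, t) = (\<Sum>a<n*m. if a = (n - 1) * m + s then F $$ (a, t) else 0)"
      using st F G by (auto simp: scalar_prod_def atLeast0LessThan G_def
          if_distrib[of "\<lambda>x. x * _"] cong: if_cong)
    also have "\<dots> = F $$ ((n - 1) * m + s, t)" using sm[OF st(1)] by simp
    also have "\<dots> = (if s = t then 1 else 0)"
      using Fidx[of "n - 1" s t] st by (simp add: k_def)
    finally show "(G * F) $$ (s, t) = 1\<^sub>m k $$ (s, t)" using st by simp
  qed (use F G in auto)
  have AF: "?A * F = 0\<^sub>m (n * m) k"
  proof (rule eq_matI)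
    fix a s assume "a < dim_row (0\<^sub>m (n * m) k :: 'a mat)" "s < dim_col (0\<^sub>m (n * m) k :: 'a mat)"
    then have a: "a < n * m" and s: "s < k" by auto
    obtain i p where ip: "i < n" "p < m" "a = i * m + p" by (rule block_index_exists[OF a])
    have c: "col F s \<in> carrier_vec (n * m)" using F by (intro carrier_vecI) simp
    have ent: "col F s $ (j * m + q) = (if q + (n - 1 - j) = s then 1 else 0)" if "j < n" "q < m" for j q
      using that s F Fidx[OF that s] block_index_less[OF that] by auto
    have "(?A * F) $$ (a, s) = (?A *\<^sub>v col F s) $ a"
      using a s by (simp only: index_mult_mat(1) index_mult_mat_vec carrier_matD[OF A] carrier_matD[OF F])
    also have "\<dots> = 0"
      unfolding ip(3) bidiag_super_diag_mult_vec[OF c ip(1,2)] using ip s ent[of i "Suc p"]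
      by (auto simp: ent k_def)
    finally show "(?A * F) $$ (a, s) = 0\<^sub>m (n * m) k $$ (a, s)"
      using a s by simp
  qed (use A F in auto)
  have ker: "F *\<^sub>v (G *\<^sub>v v) = v"
    if v: "v \<in> carrier_vec (n * m)" and Av: "?A *\<^sub>v v = 0\<^sub>v (n * m)" for v
  proof (rule eq_vecI)
    note E = eqs[OF v Av]
    have c1: "x v (n - 1 - t) p = (if p + t < m then x v (n - 1) (p + t) else 0)" if "t \<le> n - 1" "n > 0" "p < m" for t p
      using that
    proof (induction t arbitrary: p)
      case (Suc t)
      have *: "n - 1 - t \<ge> 1" "n - 1 - t - 1 = n - 1 - Suc t" using Suc.prems by auto
      have "x v (n - 1 - Suc t) p = (if Suc p < m then x v (n - 1 - t) (Suc p) else 0)"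
        using E[of "n - 1 - t" p, unfolded *(2)] * Suc.prems by auto
      also have "\<dots> = (if p + Suc t < m then x v (n - 1) (p + Suc t) else 0)"
        using Suc.IH[of "Suc p"] Suc.prems by auto
      finally show ?case .
    qed auto
    \<comment> \<open>Such an entry of the last block moves back to an entry of block 0 with
      positive index, which the first block row kills.\<close>
    have c2: "x v (n - 1) s = 0" if "s < m" "n \<le> s" "n > 0" for s
    proof -
      have "Suc (s - n) < m" using that by auto
      then show ?thesis
        using c1[of "n - 1" "s - (n - 1)"] E[of 0 "s - n"] that by (auto simp: Suc_diff_le)
    qed
    fix a assume "a < dim_vec v"
    then have a: "a < n * m" using v by auto
    obtain i p where ip: "i < n" "p < m" "a = i * m + p" by (rule block_index_exists[OF a])
    have Gv: "(G *\<^sub>v v) $ s = x v (n - 1) s" if "s < k" for s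
    proof -
      have "(G *\<^sub>v v) $ s = (\<Sum>a<n*m. if a = (n - 1) * m + s then v $ a else 0)"
        using that v G by (auto simp: scalar_prod_def atLeast0LessThan G_def
            if_distrib[of "\<lambda>x. x * _"] cong: if_cong)
      then show ?thesis using sm[OF that] by (simp add: x_def)
    qed
    have "(F *\<^sub>v (G *\<^sub>v v)) $ a = (\<Sum>s<k. F $$ (a, s) * (G *\<^sub>v v) $ s)"
      using a F G v by (auto simp: scalar_prod_def atLeast0LessThan intro!: sum.cong)
    also have "\<dots> = (\<Sum>s<k. if s = p + (n - 1 - i) then x v (n - 1) s else 0)"
      unfolding ip(3) by (intro sum.cong refl) (use ip in \<open>auto simp: Fidx Gv\<close>)
    also have "\<dots> = x v i p"
      using c1[of "n - 1 - i" p] c2[of "p + (n - 1 - i)"] ip by (auto simp: k_def)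
    finally show "(F *\<^sub>v (G *\<^sub>v v)) $ a = v $ a" by (simp add: ip(3) x_def)
  qed (use F v in auto)
  show ?thesis using mat_rank_if_kernel(2)[OF A F G GF AF ker] by (simp add: k_def)
qed

(* The simplifier rewrites m - 1 to m - Suc 0, where the original rules no longer match. *)
lemmas [simp, intro] = ind_P_in_kron_reps[unfolded One_nat_def] ind_I_in_kron_reps[unfolded One_nat_def]

lemma dims_ind:
  "m \<ge> 1 \<Longrightarrow> dim_col (alpha (ind_P m :: 'a :: field kron_rep)) = m - 1"
  "m \<ge> 1 \<Longrightarrow> dim_row (alpha (ind_P m :: 'a kron_rep)) = m"
  "m \<ge> 1 \<Longrightarrow> dim_col (alpha (ind_I m :: 'a kron_rep)) = m"
  "m \<ge> 1 \<Longrightarrow> dim_row (alpha (ind_I m :: 'a kron_rep)) = m - 1"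
  "dim_col (alpha (ind_R m l :: 'a kron_rep)) = m"
  "dim_row (alpha (ind_R m l :: 'a kron_rep)) = m"
  using ind_P_in_kron_reps[of m] ind_I_in_kron_reps[of m] ind_R_in_kron_reps[of m l]
  by (auto simp: kron_reps_def)

lemma index_jordan_block:
  "i < n \<Longrightarrow> j < n \<Longrightarrow> jordan_block n l $$ (i, j) = (if i = j then l else if Suc i = j then 1 else 0)"
  by (auto simp: jordan_block_def)

text \<open>The difference of the two dimensions separates the three families and the dimensions
  give the size; the top left entries of the two matrices recover the point \<open>l\<close>.
  Multiplicities are counted by equality in a list, so these distinctions are needed.\<close>

lemma ind_eq_iff:
  assumes "m \<ge> 1" "n \<ge> 1"
  shows "(ind_P m :: 'a :: field kron_rep) = ind_P n \<longleftrightarrow> m = n"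
    "(ind_I m :: 'a kron_rep) = ind_I n \<longleftrightarrow> m = n"
    "(ind_R m l :: 'a kron_rep) = ind_R n l' \<longleftrightarrow> m = n \<and> l = l'"
    "(ind_P m :: 'a kron_rep) \<noteq> ind_I n" "(ind_I m :: 'a kron_rep) \<noteq> ind_P n"
    "(ind_P m :: 'a kron_rep) \<noteq> ind_R n l" "(ind_R n l :: 'a kron_rep) \<noteq> ind_P m"
    "(ind_I m :: 'a kron_rep) \<noteq> ind_R n l" "(ind_R n l :: 'a kron_rep) \<noteq> ind_I m"
proof -
  note d = dims_ind[where ?'a = 'a, of m] dims_ind[where ?'a = 'a, of n]
  show "(ind_P m :: 'a :: field kron_rep) = ind_P n \<longleftrightarrow> m = n"
    "(ind_I m :: 'a kron_rep) = ind_I n \<longleftrightarrow> m = n"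
    using d assms by metis+
  have neq: "L \<noteq> L'"
    if "dim_col (alpha L) \<noteq> dim_col (alpha L') \<or> dim_row (alpha L) \<noteq> dim_row (alpha L')" for L L' :: "'a kron_rep"
    using that by auto
  show "(ind_P m :: 'a kron_rep) \<noteq> ind_I n" "(ind_I m :: 'a kron_rep) \<noteq> ind_P n"
    "(ind_P m :: 'a kron_rep) \<noteq> ind_R n l" "(ind_R n l :: 'a kron_rep) \<noteq> ind_P m"
    "(ind_I m :: 'a kron_rep) \<noteq> ind_R n l" "(ind_R n l :: 'a kron_rep) \<noteq> ind_I m"
    using assms by (intro neq; simp add: d; arith)+
  show "(ind_R m l :: 'a kron_rep) = ind_R n l' \<longleftrightarrow> m = n \<and> l = l'"
  proof
    assume eq: "(ind_R m l :: 'a kron_rep) = ind_R n l'"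
    then have "m = n" using d by metis
    moreover have "alpha (ind_R n l) $$ (0, 0) = alpha (ind_R n l') $$ (0, 0)"
      "beta (ind_R n l) $$ (0, 0) = beta (ind_R n l') $$ (0, 0)"
      using eq \<open>m = n\<close> by auto
    then have "l = l'" using assms by (cases l; cases l') (auto simp: index_jordan_block)
    ultimately show "m = n \<and> l = l'" by simp
  qed simp
qed

text \<open>At a finite point the first row is deleted, which leaves a triangular matrix with
  diagonal \<open>-1\<close> even for eigenvalue 0; at infinity the last row is deleted, which
  leaves the identity. The matrices of \<open>ind_I m\<close> perform these deletions.\<close>

lemma mat_rank_point_diag_ind_P:
  fixes l :: "'a :: field proj_line"
  assumes m: "m \<ge> 1"
  shows "mat_rank (point_diag l (ind_P m)) = m - 1"
proof -
  have P: "(ind_P m :: 'a kron_rep) \<in> kron_reps (m - 1) m" and I: "(ind_I m :: 'a kron_rep) \<in> kron_reps m (m - 1)" using m by auto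
  have ab: "alpha (ind_P m :: 'a kron_rep) \<in> carrier_mat m (m - 1)" "beta (ind_P m :: 'a kron_rep) \<in> carrier_mat m (m - 1)"
      "alpha (ind_I m :: 'a kron_rep) \<in> carrier_mat (m - 1) m" "beta (ind_I m :: 'a kron_rep) \<in> carrier_mat (m - 1) m"
    using P I by (auto simp: kron_reps_def)
  have eq: "(ind_P m :: 'a kron_rep) = kron_dual (ind_I m :: 'a kron_rep)" by (simp add: kron_dual_ind_I)
  have idx: "alpha (ind_P m :: 'a kron_rep) $$ (p, q) = (if p = q then 1 else 0)"
    "beta (ind_P m :: 'a kron_rep) $$ (p, q) = (if p = Suc q then 1 else 0)" if "p < m" "q < m - 1" for p q
    using that carrier_matD[OF ab(3)] carrier_matD[OF ab(4)] unfolding eq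
    by (simp_all add: kron_dual_def index_ind_I)
  have row: "row (alpha (ind_I m :: 'a kron_rep)) p = vec m (\<lambda>k. if k = p then 1 else 0)"
    "row (beta (ind_I m :: 'a kron_rep)) p = vec m (\<lambda>k. if k = Suc p then 1 else 0)" if "p < m - 1" for p
    using that ab by (auto simp: index_ind_I intro!: eq_vecI)
  define L :: "'a mat" where "L = (case l of Pt a \<Rightarrow> beta (ind_I m) | Infty \<Rightarrow> alpha (ind_I m))"
  have L: "L \<in> carrier_mat (m - 1) m" using ab by (auto simp: L_def split: proj_line.splits)
  have D: "point_diag l (ind_P m) \<in> carrier_mat m (m - 1)" using P by simp
  have LD: "(L * point_diag l (ind_P m)) $$ (p, q) =
    (case l of Pt a \<Rightarrow> a * (if Suc p = q then 1 else 0) - (if p = q then 1 else 0) | Infty \<Rightarrow> if p = q then 1 else 0)"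
    if "p < m - 1" "q < m - 1" for p q
  proof -
    have "(L * point_diag l (ind_P m)) $$ (p, q) =
      (\<Sum>k<m. (if k = (case l of Pt a \<Rightarrow> Suc p | Infty \<Rightarrow> p) then point_diag l (ind_P m) $$ (k, q) else 0))"
      using that ab L D carrier_matD[OF D] carrier_matD[OF L] row[OF that(1)]
      by (cases l) (auto simp: scalar_prod_def atLeast0LessThan L_def if_distrib[of "\<lambda>x. x * _"] cong: if_cong)
    also have "\<dots> = point_diag l (ind_P m) $$ ((case l of Pt a \<Rightarrow> Suc p | Infty \<Rightarrow> p), q)"
      using that by (cases l) auto
    also have "\<dots> = (case l of Pt a \<Rightarrow> a * (if Suc p = q then 1 else 0) - (if p = q then 1 else 0)
        | Infty \<Rightarrow> if p = q then 1 else 0)"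
      using that ab by (cases l) (auto simp: idx)
    finally show ?thesis .
  qed
  have "det (L * point_diag l (ind_P m)) \<noteq> 0"
    by (rule det_nonzero_if_upper_triangular[of _ "m - 1"])
      (use L D LD in \<open>auto split: proj_line.splits\<close>)
  then obtain B where "B \<in> carrier_mat (m - 1) (m - 1)" "B * (L * point_diag l (ind_P m)) = 1\<^sub>m (m - 1)"
    using det_nonzero_inverse[of "L * point_diag l (ind_P m)" "m - 1"] L D by auto
  then have "mat_rank (L * point_diag l (ind_P m)) = m - 1"
    using L D by (intro mat_rank_left_invertible[of _ "m - 1" "m - 1" B]) auto
  then show ?thesis by (rule full_column_rank_if_mult[OF D L])
qed

lemma mat_rank_point_diag_ind_I:
  assumes m: "m \<ge> 1"
  shows "mat_rank (point_diag l (ind_I m)) = m - 1"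
  using mat_rank_point_diag_ind_P[OF m, of l] point_diag_kron_dual[OF ind_I_in_kron_reps[OF m], of l]
  by (simp add: kron_dual_ind_I mat_rank_transpose)

text \<open>Away from its own point the block is upper triangular with diagonal
  \<open>l - l'\<close> for two finite points, and \<open>-1\<close> or \<open>1\<close> if one of
  them is infinite.\<close>

lemma mat_rank_point_diag_ind_R:
  assumes "l \<noteq> l'"
  shows "mat_rank (point_diag l (ind_R m l')) = m"
proof -
  have D: "point_diag l (ind_R m l') \<in> carrier_mat m m" by auto
  have "det (point_diag l (ind_R m l')) \<noteq> 0"
    using assms by (intro det_nonzero_if_upper_triangular[OF D])
      (cases l; cases l'; auto simp: index_jordan_block)+
  then show ?thesis
    using det_nonzero_inverse[OF D] mat_rank_left_invertible[OF D] by metis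
qed

lemma mat_rank_one [simp]: "mat_rank (1\<^sub>m m :: 'a :: field mat) = m"
  by (rule mat_rank_left_invertible[of _ m m "1\<^sub>m m"]) auto

lemma mat_rank_I_mat_ind:
  assumes "m \<ge> 1"
  shows "mat_rank (I_mat n (ind_P m)) = n * (m - 1)"
    "mat_rank (I_mat n (ind_R m l)) = n * m"
    "mat_rank (I_mat n (kron_dual (ind_R m l))) = n * m"
proof -
  show "mat_rank (I_mat n (ind_P m)) = n * (m - 1)"
    by (rule mat_rank_I_mat_full[OF ind_P_in_kron_reps[OF assms]])
      (simp add: mat_rank_point_diag_ind_P[OF assms, of Infty, simplified])
  show "mat_rank (I_mat n (ind_R m l)) = n * m"
    by (rule mat_rank_I_mat_full[OF ind_R_in_kron_reps]) (cases l; simp)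
  have "kron_dual (ind_R m l) \<in> kron_reps m m" by simp
  then show "mat_rank (I_mat n (kron_dual (ind_R m l))) = n * m"
    by (rule mat_rank_I_mat_full) (cases l; simp add: kron_dual_def)
qed

text \<open>The convention that \<open>p_rank 1 M\<close> is 0 agrees with the rank of a matrix
  without rows, so the case \<open>n = 1\<close> needs no separate treatment afterwards.\<close>

lemma p_rank_eq:
  assumes "M \<in> kron_reps d1 d2" "n \<ge> 1"
  shows "p_rank n M = mat_rank (P_mat n M)"
proof (cases "n = 1")
  case True
  have "P_mat 1 M \<in> carrier_mat 0 d1"
    using assms by (auto simp: P_mat_def kron_blocks_def block_matrix_def kron_reps_def)
  then have "mat_rank (P_mat 1 M) = 0"
    using mat_rank_plus_kernel_dim[of "(P_mat 1 M)\<^sup>T" d1 0] by (simp add: mat_rank_transpose)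
  then show ?thesis using True by (simp add: p_rank_def)
qed (use assms in \<open>simp add: p_rank_def\<close>)

lemma i_rank_eq:
  assumes "M \<in> kron_reps d1 d2"
  shows "i_rank n M = mat_rank (I_mat n M)"
proof (cases "n = 0")
  case True
  have "I_mat 0 M \<in> carrier_mat d2 0"
    using assms by (auto simp: I_mat_def kron_blocks_def block_matrix_def kron_reps_def)
  then have "mat_rank (I_mat 0 M) = 0"
    using mat_rank_plus_kernel_dim[of "I_mat 0 M" d2 0] by simp
  then show ?thesis using True by (simp add: i_rank_def)
qed (simp add: i_rank_def)

lemma p_rank_ind:
  assumes "m \<ge> 1" "n \<ge> 1"
  shows "p_rank n (ind_P m) = (n - 1) * m - (n - m)"
    "p_rank n (ind_I m) = (n - 1) * (m - 1)"
    "p_rank n (ind_R m l) = (n - 1) * m"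
  using assms mat_rank_I_mat_ind_I[OF assms(1), of "n - 1"]
  by (simp_all add: p_rank_eq[OF ind_P_in_kron_reps] p_rank_eq[OF ind_I_in_kron_reps]
      p_rank_eq[OF ind_R_in_kron_reps] mat_rank_P_mat[OF ind_P_in_kron_reps]
      mat_rank_P_mat[OF ind_I_in_kron_reps] mat_rank_P_mat[OF ind_R_in_kron_reps]
      kron_dual_ind_P kron_dual_ind_I mat_rank_I_mat_ind)

lemma i_rank_ind:
  assumes "m \<ge> 1"
  shows "i_rank n (ind_P m) = n * (m - 1)"
    "i_rank n (ind_I m) = n * m - (n + 1 - m)"
    "i_rank n (ind_R m l) = n * m"
  using assms
  by (simp_all add: i_rank_eq[OF ind_P_in_kron_reps] i_rank_eq[OF ind_I_in_kron_reps]
      i_rank_eq[OF ind_R_in_kron_reps] mat_rank_I_mat_ind mat_rank_I_mat_ind_I)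

lemma r_rank_ind:
  fixes l :: "'a :: field proj_line"
  assumes m: "m \<ge> 1"
  shows "r_rank n l (ind_P m) = n * (m - 1)"
    "r_rank n l (ind_I m) = n * (m - 1)"
    "r_rank n l (ind_R m l') = (if l = l' then n * m - min n m else n * m)"
proof -
  show "r_rank n l (ind_P m) = n * (m - 1)"
    unfolding r_rank_def R_mat_eq_bidiag[OF ind_P_in_kron_reps[OF m]]
    using m mat_rank_point_diag_ind_P[OF m] by (intro mat_rank_bidiag_left[of _ m]) auto
  show "r_rank n l (ind_I m) = n * (m - 1)"
    unfolding r_rank_def R_mat_eq_bidiag[OF ind_I_in_kron_reps[OF m]]
    using m mat_rank_point_diag_ind_I[OF m] by (intro mat_rank_bidiag_right[of _ _ m]) auto
  show "r_rank n l (ind_R m l') = (if l = l' then n * m - min n m else n * m)"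
  proof (cases "l = l'")
    case False
    then show ?thesis
      unfolding r_rank_def R_mat_eq_bidiag[OF ind_R_in_kron_reps]
      using mat_rank_bidiag_left[of "point_diag l (ind_R m l')" m m "point_sub l (ind_R m l')" n]
        mat_rank_point_diag_ind_R[of l l' m] by auto
  next
    case True
    show ?thesis
    proof (cases l)
      case (Pt a)
      have "point_diag l (ind_R m l) = - super_diag m"
        unfolding Pt by (intro eq_matI) (auto simp: index_jordan_block super_diag_def sub_diag_def)
      moreover have "point_sub l (ind_R m l) = 1\<^sub>m m" unfolding Pt by simp
      ultimately show ?thesis
        using True mat_rank_bidiag_super_diag[of n m]
        by (simp add: r_rank_def R_mat_eq_bidiag[OF ind_R_in_kron_reps] del: R_mat.simps)
    next
      case Infty
      have "point_diag l (ind_R m l) = super_diag m"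
        unfolding Infty by (intro eq_matI) (auto simp: index_jordan_block super_diag_def sub_diag_def)
      \<comment> \<open>At infinity both blocks have the opposite sign from the finite case, and a
        global sign does not affect the rank.\<close>
      moreover have "bidiag n (super_diag m) (- 1\<^sub>m m :: 'a mat) = - bidiag n (- super_diag m) (1\<^sub>m m)"
        unfolding bidiag_def
        by (intro eq_matI) (auto simp: tensor_def less_mult_imp_div_less mod_less_if_less_mult super_diag_def)
      moreover have "point_sub l (ind_R m l) = - 1\<^sub>m m" unfolding Infty by simp
      ultimately show ?thesis
        using True mat_rank_bidiag_super_diag[of n m]
        by (simp add: r_rank_def R_mat_eq_bidiag[OF ind_R_in_kron_reps] mat_rank_uminus del: R_mat.simps)
    qed
  qed
qed

section \<open>Second differences of the ranks\<close>

lemma indecs_cases: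
  assumes "L \<in> indecs"
  obtains m where "m \<ge> 1" "L = ind_P m" | m where "m \<ge> 1" "L = ind_I m"
    | m l where "m \<ge> 1" "L = ind_R m l"
  using assms unfolding indecs_def by blast

lemma indecs_in_kron_reps:
  "L \<in> indecs \<Longrightarrow> L \<in> kron_reps (dim_col (alpha L)) (dim_row (alpha L))"
  by (elim indecs_cases) (auto simp: dims_ind)

text \<open>The outer subtraction is never truncated and the inner one becomes a maximum; in this
  form second differences can be computed over the integers.\<close>

lemma int_rank_ind_I:
  assumes "m \<ge> 1"
  shows "int (n * m - (n + 1 - m)) = int n * int m - max 0 (int n + 1 - int m)"
proof -
  have "n + 1 - m \<le> n" using assms by simp
  also have "n \<le> n * m" using assms by simp
  finally have "n + 1 - m \<le> n * m" .
  then show ?thesis by (auto simp: of_nat_diff)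
qed

text \<open>Integer valued, so that it is a linear expression in ranks and dimensions and inherits
  their additivity. The same holds for \<open>I_formula\<close> and
  \<open>R_formula\<close>.\<close>

definition P_formula :: "nat \<Rightarrow> 'a::field kron_rep \<Rightarrow> int" where
  "P_formula n M = (if n \<ge> 2 then 2 * int (p_rank n M) - int (p_rank (n - 1) M) - int (p_rank (n + 1) M)
     else int (dim_row (alpha M)) - int (p_rank 2 M))"

definition I_formula :: "nat \<Rightarrow> 'a::field kron_rep \<Rightarrow> int" where
  "I_formula n M = (if n \<ge> 2 then 2 * int (i_rank (n - 1) M) - int (i_rank n M) - int (i_rank (n - 2) M)
     else int (dim_col (alpha M)) - int (i_rank 1 M))"

definition R_formula :: "nat \<Rightarrow> 'a proj_line \<Rightarrow> 'a::field kron_rep \<Rightarrow> int" where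
  "R_formula n l M = (if n \<ge> 2 then int (r_rank (n - 1) l M) + int (r_rank (n + 1) l M) - 2 * int (r_rank n l M)
     else int (r_rank 2 l M) - 2 * int (r_rank 1 l M))"

text \<open>On \<open>ind_P m\<close> the rank falls short of a linear function of \<open>k\<close>
  by \<open>max 0 (k - m)\<close>, so its second difference is concentrated at \<open>k = m\<close>;
  on the other families it is linear. For \<open>n = 1\<close> the term \<open>d2\<close> is minus
  the linear continuation of the rank to \<open>k = 0\<close>.\<close>

lemma P_formula_indec:
  fixes L :: "'a :: field kron_rep"
  assumes L: "L \<in> indecs" and n: "n \<ge> 1"
  shows "P_formula n L = of_bool (L = ind_P n)"
proof -
  \<comment> \<open>Writing \<open>n\<close> as \<open>k + 2\<close> removes the truncated
    differences \<open>n - 1\<close> and \<open>n - 2\<close>.\<close>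
  have n': "n = 1 \<or> (\<exists>k. n = k + 2)" using n by presburger
  from L show ?thesis
  proof (cases rule: indecs_cases)
    case (1 m)
    have p: "int (p_rank k (ind_P m :: 'a kron_rep)) = (int k - 1) * int m - max 0 (int k - int m)" if "k \<ge> 1" for k
      using int_rank_ind_I[OF 1(1), of "k - 1"] that 1 by (simp add: p_rank_ind)
    show ?thesis
      using n' 1 by (auto simp: P_formula_def p dims_ind ind_eq_iff algebra_simps max_def)
  next
    case (2 m)
    have p: "int (p_rank k (ind_I m :: 'a kron_rep)) = (int k - 1) * (int m - 1)" if "k \<ge> 1" for k
      using that 2 by (simp add: p_rank_ind)
    show ?thesis
      using n' 2 by (auto simp: P_formula_def p dims_ind ind_eq_iff algebra_simps)
  next
    case (3 m l)
    have p: "int (p_rank k (ind_R m l :: 'a kron_rep)) = (int k - 1) * int m" if "k \<ge> 1" for k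
      using that 3 by (simp add: p_rank_ind)
    show ?thesis
      using n' 3 by (auto simp: P_formula_def p dims_ind ind_eq_iff algebra_simps)
  qed
qed

text \<open>On \<open>ind_I m\<close> the kink is at \<open>k = m - 1\<close>, which is why the
  second difference is centred at \<open>n - 1\<close>. For \<open>n = 1\<close> the term
  \<open>d1\<close> is minus the linear continuation of the rank to \<open>k = -1\<close>.\<close>

lemma I_formula_indec:
  fixes L :: "'a :: field kron_rep"
  assumes L: "L \<in> indecs" and n: "n \<ge> 1"
  shows "I_formula n L = of_bool (L = ind_I n)"
proof -
  have n': "n = 1 \<or> (\<exists>k. n = k + 2)" using n by presburger
  from L show ?thesis
  proof (cases rule: indecs_cases)
    case (1 m)
    have p: "int (i_rank k (ind_P m :: 'a kron_rep)) = int k * (int m - 1)" for k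
      using 1 by (simp add: i_rank_ind)
    show ?thesis
      using n' 1 by (auto simp: I_formula_def p dims_ind ind_eq_iff algebra_simps)
  next
    case (2 m)
    have p: "int (i_rank k (ind_I m :: 'a kron_rep)) = int k * int m - max 0 (int k + 1 - int m)" for k
      using int_rank_ind_I[OF 2(1), of k] 2 by (simp add: i_rank_ind)
    show ?thesis
      using n' 2 by (auto simp: I_formula_def p dims_ind ind_eq_iff algebra_simps max_def)
  next
    case (3 m l)
    have p: "int (i_rank k (ind_R m l :: 'a kron_rep)) = int k * int m" for k
      using 3 by (simp add: i_rank_ind)
    show ?thesis
      using n' 3 by (auto simp: I_formula_def p dims_ind ind_eq_iff algebra_simps)
  qed
qed

text \<open>The kink is that of \<open>min k m\<close> at \<open>k = m\<close>, present only when
  the two points coincide. It enters the rank with a minus sign, hence the opposite sign of the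
  second difference; for \<open>n = 1\<close> it is the same difference with rank 0 at
  \<open>k = 0\<close>.\<close>

lemma R_formula_indec:
  fixes L :: "'a :: field kron_rep"
  assumes L: "L \<in> indecs" and n: "n \<ge> 1"
  shows "R_formula n l L = of_bool (L = ind_R n l)"
proof -
  have n': "n = 1 \<or> (\<exists>k. n = k + 2)" using n by presburger
  from L show ?thesis
  proof (cases rule: indecs_cases)
    case (1 m)
    have p: "int (r_rank k l (ind_P m :: 'a kron_rep)) = int k * (int m - 1)" for k
      using 1 by (simp add: r_rank_ind)
    show ?thesis
      using n' 1 by (auto simp: R_formula_def p dims_ind ind_eq_iff algebra_simps)
  next
    case (2 m)
    have p: "int (r_rank k l (ind_I m :: 'a kron_rep)) = int k * (int m - 1)" for k
      using 2 by (simp add: r_rank_ind)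
    show ?thesis
      using n' 2 by (auto simp: R_formula_def p dims_ind ind_eq_iff algebra_simps)
  next
    case (3 m l')
    have le: "min k m \<le> k * m" for k using 3(1) by (cases "k = 0") (auto simp: min_def)
    have p: "int (r_rank k l (ind_R m l' :: 'a kron_rep)) = int k * int m - (if l = l' then min (int k) (int m) else 0)" for k
      using 3 le[of k] by (auto simp: r_rank_ind of_nat_diff)
    show ?thesis
      using n' 3 by (auto simp: R_formula_def p dims_ind ind_eq_iff algebra_simps min_def)
  qed
qed

subsection \<open>Uniqueness and splitting\<close>

lemma kron_direct_sum_Nil_in_kron_reps: "kron_direct_sum [] \<in> kron_reps 0 0"
  by (simp add: kron_direct_sum_Nil kron_reps_def)

lemma kron_direct_sum_in_kron_reps:
  assumes "set Ls \<subseteq> indecs"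
  shows "kron_direct_sum Ls \<in> kron_reps (\<Sum>L\<leftarrow>Ls. dim_col (alpha L)) (\<Sum>L\<leftarrow>Ls. dim_row (alpha L))"
  using assms
proof (induction Ls)
  case (Cons L Ls)
  then show ?case using indecs_in_kron_reps[of L] by (simp add: kron_direct_sum_Cons)
qed (simp add: kron_direct_sum_Nil_in_kron_reps)

lemma mat_rank_pencil_direct_sum:
  assumes X: "X \<in> carrier_mat r c" "Y \<in> carrier_mat r c" and Ls: "set Ls \<subseteq> indecs"
  shows "mat_rank (pencil X Y (kron_direct_sum Ls)) = (\<Sum>L\<leftarrow>Ls. mat_rank (pencil X Y L))"
  using Ls
proof (induction Ls)
  case Nil
  have "pencil X Y (kron_direct_sum []) \<in> carrier_mat (r * 0) (c * 0)"
    using X kron_direct_sum_Nil_in_kron_reps by (rule pencil_carrier)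
  from mat_rank_plus_kernel_dim[OF this] show ?case by simp
next
  case (Cons L Ls)
  then show ?case
    using mat_rank_pencil_sum[OF X indecs_in_kron_reps kron_direct_sum_in_kron_reps, of L Ls]
    by (simp add: kron_direct_sum_Cons)
qed

lemma mat_rank_pencil_decomposition:
  assumes "X \<in> carrier_mat r c" "Y \<in> carrier_mat r c" "M \<in> kron_reps d1 d2"
    and "set Ls \<subseteq> indecs" "kron_iso M (kron_direct_sum Ls)"
  shows "mat_rank (pencil X Y M) = (\<Sum>L\<leftarrow>Ls. mat_rank (pencil X Y L))"
  using mat_rank_pencil_iso[OF assms(1-3) kron_direct_sum_in_kron_reps[OF assms(4)] assms(5)]
    mat_rank_pencil_direct_sum[OF assms(1,2,4)] by simp

context
  fixes M :: "'a :: field kron_rep" and d1 d2 :: nat and Ls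
  assumes M: "M \<in> kron_reps d1 d2" and Ls: "set Ls \<subseteq> indecs" and iso: "kron_iso M (kron_direct_sum Ls)"
begin

lemma dims_decomposition:
  "d1 = (\<Sum>L\<leftarrow>Ls. dim_col (alpha L))" "d2 = (\<Sum>L\<leftarrow>Ls. dim_row (alpha L))"
  using kron_isoE[OF iso M kron_direct_sum_in_kron_reps[OF Ls]] by metis+

lemma p_rank_decomposition: "p_rank n M = (\<Sum>L\<leftarrow>Ls. p_rank n L)"
proof (cases n)
  case (Suc k)
  have "p_rank n M = mat_rank (pencil (sub_diag (k + 1) k)\<^sup>T (main_diag (k + 1) k)\<^sup>T M)"
    using p_rank_eq[OF M, of n] P_mat_eq_pencil[OF M, of k] by (simp add: Suc)
  also have "\<dots> = (\<Sum>L\<leftarrow>Ls. mat_rank (pencil (sub_diag (k + 1) k)\<^sup>T (main_diag (k + 1) k)\<^sup>T L))"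
    by (rule mat_rank_pencil_decomposition[OF _ _ M Ls iso]) auto
  also have "\<dots> = (\<Sum>L\<leftarrow>Ls. p_rank n L)"
  proof (intro arg_cong[of _ _ sum_list] map_cong refl)
    fix L :: "'a kron_rep" assume "L \<in> set Ls"
    then have L: "L \<in> kron_reps (dim_col (alpha L)) (dim_row (alpha L))"
      using Ls indecs_in_kron_reps by blast
    show "mat_rank (pencil (sub_diag (k + 1) k)\<^sup>T (main_diag (k + 1) k)\<^sup>T L) = p_rank n L"
      using p_rank_eq[OF L, of n] P_mat_eq_pencil[OF L, of k] by (simp add: Suc)
  qed
  finally show ?thesis .
qed (simp add: p_rank_def)

lemma i_rank_decomposition: "i_rank n M = (\<Sum>L\<leftarrow>Ls. i_rank n L)"
proof -
  have "i_rank n M = mat_rank (pencil (sub_diag (n + 1) n) (main_diag (n + 1) n) M)"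
    using i_rank_eq[OF M, of n] I_mat_eq_pencil[OF M, of n] by simp
  also have "\<dots> = (\<Sum>L\<leftarrow>Ls. mat_rank (pencil (sub_diag (n + 1) n) (main_diag (n + 1) n) L))"
    by (rule mat_rank_pencil_decomposition[OF _ _ M Ls iso]) auto
  also have "\<dots> = (\<Sum>L\<leftarrow>Ls. i_rank n L)"
  proof (intro arg_cong[of _ _ sum_list] map_cong refl)
    fix L :: "'a kron_rep" assume "L \<in> set Ls"
    then have L: "L \<in> kron_reps (dim_col (alpha L)) (dim_row (alpha L))"
      using Ls indecs_in_kron_reps by blast
    show "mat_rank (pencil (sub_diag (n + 1) n) (main_diag (n + 1) n) L) = i_rank n L"
      using i_rank_eq[OF L, of n] I_mat_eq_pencil[OF L, of n] by simp
  qed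
  finally show ?thesis .
qed

lemma r_rank_decomposition: "r_rank n l M = (\<Sum>L\<leftarrow>Ls. r_rank n l L)"
proof -
  have "r_rank n l M = mat_rank (pencil (fst (point_coeffs n l)) (snd (point_coeffs n l)) M)"
    by (simp only: r_rank_def R_mat_eq_pencil[OF M])
  also have "\<dots> = (\<Sum>L\<leftarrow>Ls. mat_rank (pencil (fst (point_coeffs n l)) (snd (point_coeffs n l)) L))"
    by (rule mat_rank_pencil_decomposition[OF point_coeffs_carrier M Ls iso])
  also have "\<dots> = (\<Sum>L\<leftarrow>Ls. r_rank n l L)"
  proof (intro arg_cong[of _ _ sum_list] map_cong refl)
    fix L :: "'a kron_rep" assume "L \<in> set Ls"
    then have L: "L \<in> kron_reps (dim_col (alpha L)) (dim_row (alpha L))"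
      using Ls indecs_in_kron_reps by blast
    show "mat_rank (pencil (fst (point_coeffs n l)) (snd (point_coeffs n l)) L) = r_rank n l L"
      by (simp only: r_rank_def R_mat_eq_pencil[OF L])
  qed
  finally show ?thesis .
qed

lemma formulas_decomposition:
  "P_formula n M = (\<Sum>L\<leftarrow>Ls. P_formula n L)"
  "I_formula n M = (\<Sum>L\<leftarrow>Ls. I_formula n L)"
  "R_formula n l M = (\<Sum>L\<leftarrow>Ls. R_formula n l L)"
proof -
  have dims: "dim_col (alpha M) = d1" "dim_row (alpha M) = d2"
    using M by (auto simp: kron_reps_def)
  have int_sum: "int (\<Sum>L\<leftarrow>Ls. f L) = (\<Sum>L\<leftarrow>Ls. int (f L))" for f :: "'a kron_rep \<Rightarrow> nat" and Ls
    by (induction Ls) auto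
  note collect = int_sum sum_list_addf sum_list_subtractf sum_list_const_mult
  show "P_formula n M = (\<Sum>L\<leftarrow>Ls. P_formula n L)"
    unfolding P_formula_def p_rank_decomposition dims dims_decomposition(2)
    by (simp add: collect)
  show "I_formula n M = (\<Sum>L\<leftarrow>Ls. I_formula n L)"
    unfolding I_formula_def i_rank_decomposition dims dims_decomposition(1)
    by (simp add: collect)
  show "R_formula n l M = (\<Sum>L\<leftarrow>Ls. R_formula n l L)"
    unfolding R_formula_def r_rank_decomposition
    by (simp add: collect)
qed

text \<open>By additivity each member of \<open>Ls\<close> contributes its indicator, so the sum
  over the list is a count.\<close>

lemma count_list_formulas:
  assumes "n \<ge> 1"
  shows "int (count_list Ls (ind_P n)) = P_formula n M"
    "int (count_list Ls (ind_I n)) = I_formula n M"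
    "int (count_list Ls (ind_R n l)) = R_formula n l M"
proof -
  have count: "int (count_list Ks X) = (\<Sum>L\<leftarrow>Ks. f L)"
    if "set Ks \<subseteq> indecs" "\<And>L. L \<in> indecs \<Longrightarrow> f L = of_bool (L = X)" for Ks f and X :: "'a kron_rep"
    using that by (induction Ks) auto
  show "int (count_list Ls (ind_P n)) = P_formula n M"
    "int (count_list Ls (ind_I n)) = I_formula n M"
    "int (count_list Ls (ind_R n l)) = R_formula n l M"
    unfolding formulas_decomposition using Ls assms
    by (auto intro!: count P_formula_indec I_formula_indec R_formula_indec)
qed

end

lemma is_decomposition_formulas:
  assumes M: "M \<in> kron_reps d1 d2" and d: "is_decomposition M d" and n: "n \<ge> 1"
  shows "int (d (ind_P n)) = P_formula n M" "int (d (ind_I n)) = I_formula n M"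
    "int (d (ind_R n l)) = R_formula n l M"
  using d count_list_formulas[OF M _ _ n] unfolding is_decomposition_def by auto

text \<open>The formulas express every multiplicity through ranks of \<open>M\<close>, without
  reference to the decomposition; off \<open>indecs\<close> both functions vanish.\<close>

lemma is_decomposition_unique:
  assumes M: "M \<in> kron_reps d1 d2" and d: "is_decomposition M d" and d': "is_decomposition M d'"
  shows "d = d'"
proof
  fix L
  show "d L = d' L"
  proof (cases "L \<in> indecs")
    case True
    then show ?thesis
      by (cases rule: indecs_cases)
        (metis is_decomposition_formulas[OF M d] is_decomposition_formulas[OF M d'] of_nat_eq_iff)+
  next
    case False
    then show ?thesis
      using d d' unfolding is_decomposition_def by (metis count_list_0_iff subsetD)
  qed
qed

text \<open>Existence is a hypothesis here; together with uniqueness it makes the definite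
  description in \<open>kron_mult\<close> denote an actual decomposition.\<close>

lemma kron_mult_formulas:
  assumes M: "M \<in> kron_reps d1 d2" and ex: "\<exists>d. is_decomposition M d" and n: "n \<ge> 1"
  shows "int (kron_mult M (ind_P n)) = P_formula n M" "int (kron_mult M (ind_I n)) = I_formula n M"
    "int (kron_mult M (ind_R n l)) = R_formula n l M"
proof -
  have "is_decomposition M (kron_mult M)"
    unfolding kron_mult_def using ex is_decomposition_unique[OF M] by (metis theI')
  from is_decomposition_formulas[OF M this n] show
    "int (kron_mult M (ind_P n)) = P_formula n M" "int (kron_mult M (ind_I n)) = I_formula n M"
    "int (kron_mult M (ind_R n l)) = R_formula n l M" by simp_all
qed

section \<open>Isomorphisms, direct sums and retracts\<close>

lemma kron_iso_refl:
  assumes "(M :: 'a :: field kron_rep) \<in> kron_reps d1 d2"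
  shows "kron_iso M M"
  by (rule kron_isoI[OF assms assms, of "1\<^sub>m d1" "1\<^sub>m d1" "1\<^sub>m d2" "1\<^sub>m d2"])
    (use assms in \<open>auto simp: kron_reps_def\<close>)

lemma kron_iso_trans:
  assumes M: "(M :: 'a :: field kron_rep) \<in> kron_reps d1 d2" and N: "N \<in> kron_reps d1 d2" and K: "K \<in> kron_reps d1 d2"
    and iso: "kron_iso M N" "kron_iso N K"
  shows "kron_iso M K"
proof -
  obtain S1 T1 S2 T2 where 1:
    "S1 \<in> carrier_mat d1 d1" "T1 \<in> carrier_mat d1 d1" "S1 * T1 = 1\<^sub>m d1" "T1 * S1 = 1\<^sub>m d1"
    "S2 \<in> carrier_mat d2 d2" "T2 \<in> carrier_mat d2 d2" "S2 * T2 = 1\<^sub>m d2" "T2 * S2 = 1\<^sub>m d2"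
    "S2 * alpha M = alpha N * S1" "S2 * beta M = beta N * S1"
    using kron_isoE[OF iso(1) M N] by metis
  obtain S1' T1' S2' T2' where 2:
    "S1' \<in> carrier_mat d1 d1" "T1' \<in> carrier_mat d1 d1" "S1' * T1' = 1\<^sub>m d1" "T1' * S1' = 1\<^sub>m d1"
    "S2' \<in> carrier_mat d2 d2" "T2' \<in> carrier_mat d2 d2" "S2' * T2' = 1\<^sub>m d2" "T2' * S2' = 1\<^sub>m d2"
    "S2' * alpha N = alpha K * S1'" "S2' * beta N = beta K * S1'"
    using kron_isoE[OF iso(2) N K] by metis
  have inv: "A * B * (B' * A') = 1\<^sub>m d"
    if "A \<in> carrier_mat d d" "B \<in> carrier_mat d d" "A' \<in> carrier_mat d d" "B' \<in> carrier_mat d d"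
      "A * A' = 1\<^sub>m d" "B * B' = 1\<^sub>m d" for A B A' B' :: "'a mat" and d
  proof -
    have "A * B * (B' * A') = A * ((B * B') * A')" using that(1-4) by (simp add: mult_mat_assoc)
    then show ?thesis using that by simp
  qed
  have eq: "S2' * S2 * A = C * (S1' * S1)"
    if "A \<in> carrier_mat d2 d1" "B \<in> carrier_mat d2 d1" "C \<in> carrier_mat d2 d1"
      "S2 * A = B * S1" "S2' * B = C * S1'" for A B C
  proof -
    have "S2' * S2 * A = S2' * (B * S1)" using that 1(5) 2(5) by (simp add: mult_mat_assoc)
    also have "\<dots> = C * S1' * S1" using that 1(1) 2(5) by (simp flip: mult_mat_assoc)
    finally show ?thesis using that(3) 1(1) 2(1) by (simp add: mult_mat_assoc)
  qed
  have ab: "alpha M \<in> carrier_mat d2 d1" "beta M \<in> carrier_mat d2 d1" "alpha N \<in> carrier_mat d2 d1"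
    "beta N \<in> carrier_mat d2 d1" "alpha K \<in> carrier_mat d2 d1" "beta K \<in> carrier_mat d2 d1"
    using M N K by (auto simp: kron_reps_def)
  show ?thesis
    by (rule kron_isoI[OF M K, of "S1' * S1" "T1 * T1'" "S2' * S2" "T2 * T2'"])
      (use 1 2 in \<open>auto intro!: inv eq[OF ab(1,3,5)] eq[OF ab(2,4,6)]\<close>)
qed

text \<open>Hides the sizes of the zero blocks, so that products are governed by carrier conditions
  on the diagonal blocks only.\<close>

definition diag_mat2 :: "'a::zero mat \<Rightarrow> 'a mat \<Rightarrow> 'a mat" where
  "diag_mat2 A B = four_block_mat A (0\<^sub>m (dim_row A) (dim_col B)) (0\<^sub>m (dim_row B) (dim_col A)) B"

lemma diag_mat2_carrier [simp, intro]:
  "A \<in> carrier_mat r c \<Longrightarrow> B \<in> carrier_mat r' c' \<Longrightarrow> diag_mat2 A B \<in> carrier_mat (r + r') (c + c')"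
  by (auto simp: diag_mat2_def)

lemma diag_mat2_mult:
  assumes "(A :: 'a :: semiring_0 mat) \<in> carrier_mat r n" "B \<in> carrier_mat r' n'" "C \<in> carrier_mat n c" "D \<in> carrier_mat n' c'"
  shows "diag_mat2 A B * diag_mat2 C D = diag_mat2 (A * C) (B * D)"
  unfolding diag_mat2_def using assms
  by (subst mult_four_block_mat[of _ r n _ n' _ r' _ _ c _ c']) auto

lemma diag_mat2_one: "diag_mat2 (1\<^sub>m m) (1\<^sub>m n) = 1\<^sub>m (m + n)"
  by (simp add: diag_mat2_def)

lemma diag_mat2_mult_append_rows:
  assumes "(A :: 'a :: semiring_0 mat) \<in> carrier_mat r n" "B \<in> carrier_mat r' n'" "C \<in> carrier_mat n c" "D \<in> carrier_mat n' c"
  shows "diag_mat2 A B * (C @\<^sub>r D) = A * C @\<^sub>r B * D"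
  unfolding diag_mat2_def append_rows_def using assms
  by (subst mult_four_block_mat[of _ r n _ n' _ r' _ _ c _ 0]) auto

lemma kron_sum_sel:
  assumes "M \<in> kron_reps d1 d2" "N \<in> kron_reps e1 e2"
  shows "alpha (kron_sum M N) = diag_mat2 (alpha M) (alpha N)" "beta (kron_sum M N) = diag_mat2 (beta M) (beta N)"
  using assms by (auto simp: kron_sum_def diag_mat2_def)

lemma kron_sum_cong:
  assumes M: "(M :: 'a :: field kron_rep) \<in> kron_reps d1 d2" "M' \<in> kron_reps d1 d2"
    and N: "N \<in> kron_reps e1 e2" "N' \<in> kron_reps e1 e2"
    and iso: "kron_iso M M'" "kron_iso N N'"
  shows "kron_iso (kron_sum M N) (kron_sum M' N')"
proof -
  obtain S1 T1 S2 T2 where 1: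
    "S1 \<in> carrier_mat d1 d1" "T1 \<in> carrier_mat d1 d1" "S1 * T1 = 1\<^sub>m d1" "T1 * S1 = 1\<^sub>m d1"
    "S2 \<in> carrier_mat d2 d2" "T2 \<in> carrier_mat d2 d2" "S2 * T2 = 1\<^sub>m d2" "T2 * S2 = 1\<^sub>m d2"
    "S2 * alpha M = alpha M' * S1" "S2 * beta M = beta M' * S1"
    using kron_isoE[OF iso(1) M] by metis
  obtain S1' T1' S2' T2' where 2:
    "S1' \<in> carrier_mat e1 e1" "T1' \<in> carrier_mat e1 e1" "S1' * T1' = 1\<^sub>m e1" "T1' * S1' = 1\<^sub>m e1"
    "S2' \<in> carrier_mat e2 e2" "T2' \<in> carrier_mat e2 e2" "S2' * T2' = 1\<^sub>m e2" "T2' * S2' = 1\<^sub>m e2"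
    "S2' * alpha N = alpha N' * S1'" "S2' * beta N = beta N' * S1'"
    using kron_isoE[OF iso(2) N] by metis
  have ab: "alpha M \<in> carrier_mat d2 d1" "beta M \<in> carrier_mat d2 d1" "alpha N \<in> carrier_mat e2 e1"
    "beta N \<in> carrier_mat e2 e1" "alpha M' \<in> carrier_mat d2 d1" "beta M' \<in> carrier_mat d2 d1"
    "alpha N' \<in> carrier_mat e2 e1" "beta N' \<in> carrier_mat e2 e1"
    using M N by (auto simp: kron_reps_def)
  show ?thesis
    by (rule kron_isoI[of _ "d1 + e1" "d2 + e2" _ "diag_mat2 S1 S1'" "diag_mat2 T1 T1'" "diag_mat2 S2 S2'" "diag_mat2 T2 T2'"])
      (use M N 1 2 ab in \<open>auto simp: kron_sum_sel[of _ d1 d2 _ e1 e2] diag_mat2_one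
        diag_mat2_mult[of _ d2 d2 _ e2 e2] diag_mat2_mult[of _ d2 d1 _ e2 e1] diag_mat2_mult[of _ d1 d1 _ e1 e1]\<close>)
qed

definition decomposable :: "'a::field kron_rep \<Rightarrow> bool" where
  "decomposable M \<longleftrightarrow> (\<exists>Ls. set Ls \<subseteq> indecs \<and> kron_iso M (kron_direct_sum Ls))"

lemma decomposable_imp_is_decomposition: "decomposable M \<Longrightarrow> \<exists>d. is_decomposition M d"
  unfolding decomposable_def is_decomposition_def by blast

lemma decomposableE:
  assumes "decomposable M" "M \<in> kron_reps d1 d2"
  obtains Ls where "set Ls \<subseteq> indecs" "kron_iso M (kron_direct_sum Ls)" "kron_direct_sum Ls \<in> kron_reps d1 d2"
  using assms kron_isoE[OF _ assms(2) kron_direct_sum_in_kron_reps]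
    kron_direct_sum_in_kron_reps unfolding decomposable_def by metis

lemma decomposable_kron_iso:
  assumes "M \<in> kron_reps d1 d2" "N \<in> kron_reps d1 d2" "kron_iso M N" "decomposable N"
  shows "decomposable M"
  using decomposableE[OF assms(4,2)] kron_iso_trans[OF assms(1,2) _ assms(3)]
  unfolding decomposable_def by metis

lemma kron_direct_sum_append:
  "kron_direct_sum (Ls @ Ks) = kron_sum (kron_direct_sum Ls) (kron_direct_sum Ks)"
  by (simp add: kron_direct_sum_def kron_sum_def diag_block_mat_append Let_def)

lemma decomposable_kron_sum:
  assumes M: "M \<in> kron_reps d1 d2" "decomposable M" and N: "N \<in> kron_reps e1 e2" "decomposable N"
  shows "decomposable (kron_sum M N)"
proof -
  obtain Ls where 1: "set Ls \<subseteq> indecs" "kron_iso M (kron_direct_sum Ls)" "kron_direct_sum Ls \<in> kron_reps d1 d2"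
    using decomposableE[OF M(2,1)] by metis
  obtain Ks where 2: "set Ks \<subseteq> indecs" "kron_iso N (kron_direct_sum Ks)" "kron_direct_sum Ks \<in> kron_reps e1 e2"
    using decomposableE[OF N(2,1)] by metis
  show ?thesis
    unfolding decomposable_def using 1 2 kron_sum_cong[OF M(1) 1(3) N(1) 2(3) 1(2) 2(2)]
    by (intro exI[of _ "Ls @ Ks"]) (simp add: kron_direct_sum_append)
qed

lemma decomposable_indec: "L \<in> indecs \<Longrightarrow> decomposable L"
  unfolding decomposable_def using indecs_in_kron_reps[of L] kron_iso_refl
  by (intro exI[of _ "[L]"]) (simp add: kron_direct_sum_def del: diag_block_mat.simps)

text \<open>Used for lists whose members need not belong to \<open>indecs\<close>, such as the
  Jordan block pencils of the regular case.\<close>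

lemma decomposable_kron_direct_sum:
  assumes "\<And>L. L \<in> set Ls \<Longrightarrow> decomposable L" "\<And>L. L \<in> set Ls \<Longrightarrow> \<exists>d1 d2. L \<in> kron_reps d1 d2"
  shows "decomposable (kron_direct_sum Ls) \<and> (\<exists>d1 d2. kron_direct_sum Ls \<in> kron_reps d1 d2)"
  using assms
proof (induction Ls)
  case Nil
  have "kron_iso (kron_direct_sum []) (kron_direct_sum [] :: 'a kron_rep)"
    by (rule kron_iso_refl[OF kron_direct_sum_Nil_in_kron_reps])
  then have "decomposable (kron_direct_sum [] :: 'a kron_rep)"
    unfolding decomposable_def by (intro exI[of _ "[]"]) simp
  then show ?case using kron_direct_sum_Nil_in_kron_reps by blast
next
  case (Cons L Ls)
  obtain d1 d2 where L: "L \<in> kron_reps d1 d2" using Cons.prems(2)[of L] by auto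
  obtain e1 e2 where *: "kron_direct_sum Ls \<in> kron_reps e1 e2" "decomposable (kron_direct_sum Ls)"
    using Cons.IH Cons.prems by auto
  show ?case
    unfolding kron_direct_sum_Cons
    using decomposable_kron_sum[OF L Cons.prems(1) *] kron_sum_in_kron_reps[OF L *(1)] by auto
qed

text \<open>\<open>F1\<close>, \<open>F2\<close> form a homomorphism from \<open>S\<close> to
  \<open>M\<close> and \<open>G1\<close>, \<open>G2\<close> one back, with composite the identity of
  \<open>S\<close>. Both maps are recorded, so the notion is stable under transposition.\<close>

definition retract :: "'a::field kron_rep \<Rightarrow> 'a kron_rep \<Rightarrow> bool" where
  "retract S M \<longleftrightarrow> (\<exists>F1 F2 G1 G2.
     F1 \<in> carrier_mat (dim_col (alpha M)) (dim_col (alpha S)) \<and> F2 \<in> carrier_mat (dim_row (alpha M)) (dim_row (alpha S)) \<and>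
     G1 \<in> carrier_mat (dim_col (alpha S)) (dim_col (alpha M)) \<and> G2 \<in> carrier_mat (dim_row (alpha S)) (dim_row (alpha M)) \<and>
     alpha M * F1 = F2 * alpha S \<and> beta M * F1 = F2 * beta S \<and>
     G2 * alpha M = alpha S * G1 \<and> G2 * beta M = beta S * G1 \<and>
     G1 * F1 = 1\<^sub>m (dim_col (alpha S)) \<and> G2 * F2 = 1\<^sub>m (dim_row (alpha S)))"

text \<open>Transposition exchanges the inclusion with the retraction, and the two vertices.\<close>

lemma retract_kron_dual:
  assumes S: "S \<in> kron_reps s1 s2" and M: "M \<in> kron_reps d1 d2" and r: "retract S M"
  shows "retract (kron_dual S) (kron_dual M)"
proof -
  from r S M obtain F1 F2 G1 G2 where *: "F1 \<in> carrier_mat d1 s1" "F2 \<in> carrier_mat d2 s2"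
      "G1 \<in> carrier_mat s1 d1" "G2 \<in> carrier_mat s2 d2"
      "alpha M * F1 = F2 * alpha S" "beta M * F1 = F2 * beta S"
      "G2 * alpha M = alpha S * G1" "G2 * beta M = beta S * G1" "G1 * F1 = 1\<^sub>m s1" "G2 * F2 = 1\<^sub>m s2"
    unfolding retract_def kron_reps_def by auto
  have ab: "alpha M \<in> carrier_mat d2 d1" "beta M \<in> carrier_mat d2 d1"
    "alpha S \<in> carrier_mat s2 s1" "beta S \<in> carrier_mat s2 s1"
    using M S by (auto simp: kron_reps_def)
  have tr: "B\<^sup>T * A\<^sup>T = D\<^sup>T * C\<^sup>T"
    if "A * B = C * D" "A \<in> carrier_mat n m" "B \<in> carrier_mat m k" "C \<in> carrier_mat n m'" "D \<in> carrier_mat m' k"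
    for A B C D :: "'a mat" and n m k m'
    using that by (metis transpose_mult)
  have tr1: "B\<^sup>T * A\<^sup>T = 1\<^sub>m n"
    if "A * B = 1\<^sub>m n" "A \<in> carrier_mat n m" "B \<in> carrier_mat m n" for A B :: "'a mat" and n m
    using that by (metis transpose_mult transpose_one)
  have "dim_col (alpha (kron_dual S)) = s2" "dim_row (alpha (kron_dual S)) = s1"
    "dim_col (alpha (kron_dual M)) = d2" "dim_row (alpha (kron_dual M)) = d1"
    using ab by (auto simp: kron_dual_def)
  then show ?thesis
    unfolding retract_def using *(1-4)
    by (intro exI[of _ "G2\<^sup>T"] exI[of _ "G1\<^sup>T"] exI[of _ "F2\<^sup>T"] exI[of _ "F1\<^sup>T"])
      (auto simp: kron_dual_def tr[OF *(7) *(4) ab(1) ab(3) *(3)] tr[OF *(8) *(4) ab(2) ab(4) *(3)]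
        tr[OF *(5)[symmetric] *(2) ab(3) ab(1) *(1)] tr[OF *(6)[symmetric] *(2) ab(4) ab(2) *(1)]
        tr1[OF *(9) *(3,1)] tr1[OF *(10) *(4,2)])
qed

text \<open>The images of \<open>X1\<close> and \<open>X2\<close> are the kernels of
  \<open>G1\<close> and \<open>G2\<close>, so they form a subrepresentation because
  \<open>G1\<close>, \<open>G2\<close> is a homomorphism. It is complementary to the image of
  \<open>S\<close>.\<close>

lemma retract_splits:
  assumes S: "S \<in> kron_reps s1 s2" and M: "M \<in> kron_reps d1 d2" and r: "retract S M"
  obtains N where "s1 \<le> d1" "s2 \<le> d2" "N \<in> kron_reps (d1 - s1) (d2 - s2)" "kron_iso M (kron_sum S N)"
proof -
  from r S M obtain F1 F2 G1 G2 where *: "F1 \<in> carrier_mat d1 s1" "F2 \<in> carrier_mat d2 s2"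
      "G1 \<in> carrier_mat s1 d1" "G2 \<in> carrier_mat s2 d2"
      "alpha M * F1 = F2 * alpha S" "beta M * F1 = F2 * beta S"
      "G2 * alpha M = alpha S * G1" "G2 * beta M = beta S * G1" "G1 * F1 = 1\<^sub>m s1" "G2 * F2 = 1\<^sub>m s2"
    unfolding retract_def kron_reps_def by auto
  obtain X1 Y1 where 1: "s1 \<le> d1" "X1 \<in> carrier_mat d1 (d1 - s1)" "Y1 \<in> carrier_mat (d1 - s1) d1"
    "F1 * G1 + X1 * Y1 = 1\<^sub>m d1" "Y1 * X1 = 1\<^sub>m (d1 - s1)" "G1 * X1 = 0\<^sub>m s1 (d1 - s1)" "Y1 * F1 = 0\<^sub>m (d1 - s1) s1"
    using complement_of_left_invertible[OF *(1,3,9)] by metis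
  obtain X2 Y2 where 2: "s2 \<le> d2" "X2 \<in> carrier_mat d2 (d2 - s2)" "Y2 \<in> carrier_mat (d2 - s2) d2"
    "F2 * G2 + X2 * Y2 = 1\<^sub>m d2" "Y2 * X2 = 1\<^sub>m (d2 - s2)" "G2 * X2 = 0\<^sub>m s2 (d2 - s2)" "Y2 * F2 = 0\<^sub>m (d2 - s2) s2"
    using complement_of_left_invertible[OF *(2,4,10)] by metis
  define N where "N = Rep (Y2 * alpha M * X1) (Y2 * beta M * X1)"
  have N: "N \<in> kron_reps (d1 - s1) (d2 - s2)"
    using M 1 2 by (auto simp: N_def kron_reps_def)
  have ab: "alpha M \<in> carrier_mat d2 d1" "beta M \<in> carrier_mat d2 d1"
    "alpha S \<in> carrier_mat s2 s1" "beta S \<in> carrier_mat s2 s1"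
    using M S by (auto simp: kron_reps_def)
  have intertwine: "(G2 @\<^sub>r Y2) * A = diag_mat2 B (Y2 * A * X1) * (G1 @\<^sub>r Y1)"
    if A: "A \<in> carrier_mat d2 d1" and B: "B \<in> carrier_mat s2 s1" and AF: "A * F1 = F2 * B" and GA: "G2 * A = B * G1" for A B
  proof -
    \<comment> \<open>The \<open>F1\<close> summand dies because \<open>A\<close> maps the image of
      \<open>F1\<close> into that of \<open>F2\<close>, which \<open>Y2\<close> kills.\<close>
    have "Y2 * A = Y2 * A * (F1 * G1 + X1 * Y1)" using A 1 2 by simp
    also have "\<dots> = Y2 * (A * F1) * G1 + Y2 * A * X1 * Y1"
      using A *(1,3) 1(2,3) 2(3) by (subst mult_add_distrib_mat[of _ "d2 - s2" d1 _ d1]) (auto simp: mult_mat_assoc)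
    also have "Y2 * (A * F1) * G1 = (Y2 * F2) * B * G1" unfolding AF
      using A B *(1-3) 2(3) by (simp add: mult_mat_assoc)
    also have "\<dots> + Y2 * A * X1 * Y1 = Y2 * A * X1 * Y1"
    proof -
      have "Y2 * A * X1 * Y1 \<in> carrier_mat (d2 - s2) d1" using A 1(2,3) 2(3) by auto
      then show ?thesis using 2(7) B *(3) by (simp del: assoc_mult_mat)
    qed
    finally have eq: "Y2 * A = Y2 * A * X1 * Y1" .
    have "(G2 @\<^sub>r Y2) * A = B * G1 @\<^sub>r Y2 * A * X1 * Y1"
      using append_rows_mult[OF *(4) 2(3) A] by (simp only: GA flip: eq)
    also have "\<dots> = diag_mat2 B (Y2 * A * X1) * (G1 @\<^sub>r Y1)"
      using A 1(2) 2(3) by (intro diag_mat2_mult_append_rows[OF B _ *(3) 1(3), symmetric]) auto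
    finally show ?thesis .
  qed
  have "kron_iso M (kron_sum S N)"
  proof (rule kron_isoI[OF M, of _ "G1 @\<^sub>r Y1" "append_cols F1 X1" "G2 @\<^sub>r Y2" "append_cols F2 X2"])
    show "kron_sum S N \<in> kron_reps d1 d2"
      using kron_sum_in_kron_reps[OF S N] 1(1) 2(1) by simp
    show "(G1 @\<^sub>r Y1) * append_cols F1 X1 = 1\<^sub>m d1"
      using * 1 by (simp add: append_rows_mult_append_cols[of _ s1 d1 _ "d1 - s1"])
    show "append_cols F1 X1 * (G1 @\<^sub>r Y1) = 1\<^sub>m d1"
      using * 1 by (simp add: append_cols_mult_append_rows[of _ d1 s1 _ "d1 - s1"])
    show "(G2 @\<^sub>r Y2) * append_cols F2 X2 = 1\<^sub>m d2"
      using * 2 by (simp add: append_rows_mult_append_cols[of _ s2 d2 _ "d2 - s2"])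
    show "append_cols F2 X2 * (G2 @\<^sub>r Y2) = 1\<^sub>m d2"
      using * 2 by (simp add: append_cols_mult_append_rows[of _ d2 s2 _ "d2 - s2"])
    show "(G2 @\<^sub>r Y2) * alpha M = alpha (kron_sum S N) * (G1 @\<^sub>r Y1)"
      using intertwine[OF ab(1,3) *(5,7)] by (simp add: kron_sum_sel[OF S N]) (simp add: N_def)
    show "(G2 @\<^sub>r Y2) * beta M = beta (kron_sum S N) * (G1 @\<^sub>r Y1)"
      using intertwine[OF ab(2,4) *(6,8)] by (simp add: kron_sum_sel[OF S N]) (simp add: N_def)
  next
    show "G1 @\<^sub>r Y1 \<in> carrier_mat d1 d1" "G2 @\<^sub>r Y2 \<in> carrier_mat d2 d2"
      using carrier_append_rows[OF *(3) 1(3)] carrier_append_rows[OF *(4) 2(3)] 1(1) 2(1) by auto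
    show "append_cols F1 X1 \<in> carrier_mat d1 d1" "append_cols F2 X2 \<in> carrier_mat d2 d2"
      using append_cols_carrier[OF *(1) 1(2)] append_cols_carrier[OF *(2) 2(2)] 1(1) 2(1) by auto
  qed
  with that 1(1) 2(1) N show ?thesis by blast
qed

subsection \<open>Existence of the decomposition\<close>

lemma ind_I_mult_left:
  assumes B: "(B :: 'a :: field mat) \<in> carrier_mat m c" and pq: "p < m - 1" "q < c"
  shows "(alpha (ind_I m) * B) $$ (p, q) = B $$ (p, q)" "(beta (ind_I m) * B) $$ (p, q) = B $$ (Suc p, q)"
proof -
  have m: "m \<ge> 1" using pq by simp
  have I: "alpha (ind_I m :: 'a kron_rep) \<in> carrier_mat (m - 1) m" "beta (ind_I m :: 'a kron_rep) \<in> carrier_mat (m - 1) m"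
    using ind_I_in_kron_reps[OF m] by (auto simp: kron_reps_def)
  show "(alpha (ind_I m) * B) $$ (p, q) = B $$ (p, q)" "(beta (ind_I m) * B) $$ (p, q) = B $$ (Suc p, q)"
    using I B pq carrier_matD[OF I(1)] carrier_matD[OF I(2)]
    by (auto simp: scalar_prod_def index_ind_I if_distrib[of "\<lambda>x. x * _"] cong: if_cong)
qed

lemma ind_I_mult_right:
  assumes m: "m \<ge> 1" and B: "(B :: 'a :: field mat) \<in> carrier_mat r (m - 1)" and pq: "p < r" "q < m"
  shows "(B * alpha (ind_I m)) $$ (p, q) = (if q < m - 1 then B $$ (p, q) else 0)"
    "(B * beta (ind_I m)) $$ (p, q) = (if q \<ge> 1 then B $$ (p, q - 1) else 0)"
proof -
  have I: "alpha (ind_I m :: 'a kron_rep) \<in> carrier_mat (m - 1) m" "beta (ind_I m :: 'a kron_rep) \<in> carrier_mat (m - 1) m"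
    using ind_I_in_kron_reps[OF m] by (auto simp: kron_reps_def)
  have "(B * alpha (ind_I m)) $$ (p, q) = (\<Sum>k<m-1. if k = q then B $$ (p, k) else 0)"
    using I B pq carrier_matD[OF I(1)] carrier_matD[OF B]
    by (auto simp: scalar_prod_def atLeast0LessThan index_ind_I if_distrib[of "\<lambda>x. _ * x"] cong: if_cong)
  then show "(B * alpha (ind_I m)) $$ (p, q) = (if q < m - 1 then B $$ (p, q) else 0)" by simp
  show "(B * beta (ind_I m)) $$ (p, q) = (if q \<ge> 1 then B $$ (p, q - 1) else 0)"
    using I B pq carrier_matD[OF I(2)] carrier_matD[OF B]
    by (cases q) (auto simp: scalar_prod_def atLeast0LessThan index_ind_I if_distrib[of "\<lambda>x. _ * x"] cong: if_cong)
qed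

text \<open>The two equations make \<open>T\<close> constant along diagonals; \<open>beta\<close>
  also makes its first column vanish below the top entry and \<open>alpha\<close> its last column
  above the bottom entry. So \<open>T\<close> is scalar, and one entry determines it.\<close>

lemma ind_I_endomorphism:
  assumes n: "n \<ge> 1" and T: "(T :: 'a :: field mat) \<in> carrier_mat n n" and U: "U \<in> carrier_mat (n - 1) (n - 1)"
    and eq: "alpha (ind_I n) * T = U * alpha (ind_I n)" "beta (ind_I n) * T = U * beta (ind_I n)"
    and T0: "T $$ (0, 0) = 1"
  shows "T = 1\<^sub>m n" "U = 1\<^sub>m (n - 1)"
proof -
  have a: "T $$ (i, j) = (if j < n - 1 then U $$ (i, j) else 0)" if "i < n - 1" "j < n" for i j
    using ind_I_mult_left(1)[OF T that] ind_I_mult_right(1)[OF n U that] eq(1) by simp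
  have b: "T $$ (Suc i, j) = (if j \<ge> 1 then U $$ (i, j - 1) else 0)" if "i < n - 1" "j < n" for i j
    using ind_I_mult_left(2)[OF T that] ind_I_mult_right(2)[OF n U that] eq(2) by simp
  have shift: "T $$ (Suc i, Suc j) = T $$ (i, j)" if "Suc i < n" "Suc j < n" for i j
    using a[of i j] b[of i "Suc j"] that by simp
  have low: "T $$ (i, j) = (if i = j then 1 else 0)" if "j \<le> i" "i < n" for i j
    using that
  proof (induction j arbitrary: i)
    case 0
    then show ?case using b[of "i - 1" 0] T0 by (cases i) auto
  next
    case (Suc j)
    then show ?case using shift[of "i - 1" j] Suc.IH[of "i - 1"] by (cases i) auto
  qed
  have up: "T $$ (i, j) = 0" if "i < j" "j < n" for i j
    using that
  proof (induction "n - 1 - j" arbitrary: i j)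
    case 0
    then show ?case using a[of i j] by auto
  next
    case (Suc k)
    then show ?case using shift[of i j] Suc.hyps(1)[of "Suc j" "Suc i"] by auto
  qed
  show "T = 1\<^sub>m n"
  proof (rule eq_matI)
    fix i j assume "i < dim_row (1\<^sub>m n :: 'a mat)" "j < dim_col (1\<^sub>m n :: 'a mat)"
    then show "T $$ (i, j) = 1\<^sub>m n $$ (i, j)"
      using low[of j i] up[of i j] by (cases "j \<le> i") auto
  qed (use T in auto)
  show "U = 1\<^sub>m (n - 1)"
  proof (rule eq_matI)
    fix i j assume ij: "i < dim_row (1\<^sub>m (n - 1) :: 'a mat)" "j < dim_col (1\<^sub>m (n - 1) :: 'a mat)"
    then show "U $$ (i, j) = 1\<^sub>m (n - 1) $$ (i, j)"
      using a[of i j] low[of j i] up[of i j] by (cases "j \<le> i") auto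
  qed (use U in auto)
qed

text \<open>A nonzero chain is a nonzero polynomial vector \<open>v = \<Sum>i. v i * x^i\<close> with
  \<open>(x * alpha M - beta M) v = 0\<close>.\<close>

definition kernel_chain :: "'a::field kron_rep \<Rightarrow> nat \<Rightarrow> (nat \<Rightarrow> 'a vec) \<Rightarrow> bool" where
  "kernel_chain M n v \<longleftrightarrow>
     (\<forall>i. v i \<in> carrier_vec (dim_col (alpha M))) \<and>
     beta M *\<^sub>v v 0 = 0\<^sub>v (dim_row (alpha M)) \<and> (\<forall>i. alpha M *\<^sub>v v i = beta M *\<^sub>v v (Suc i)) \<and>
     (\<forall>i\<ge>n. v i = 0\<^sub>v (dim_col (alpha M)))"

lemma mult_mat_zero_vec: "A \<in> carrier_mat r c \<Longrightarrow> A *\<^sub>v 0\<^sub>v c = (0\<^sub>v r :: 'a :: semiring_0 vec)"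
  by (intro eq_vecI) (auto simp: scalar_prod_def)

text \<open>The vectors of the chain define the inclusion. By \<open>ind_I_endomorphism\<close> any
  homomorphism back whose composite has top left entry 1 is a retraction, and the only obstruction
  to one is a shorter chain starting with \<open>v 0\<close>.\<close>

lemma retract_ind_I_if_kernel_chain:
  fixes M :: "'a :: field kron_rep"
  assumes M: "M \<in> kron_reps d1 d2" and chain: "kernel_chain M n v" and nz: "v j \<noteq> 0\<^sub>v d1"
    and min: "\<And>m w i. kernel_chain M m w \<Longrightarrow> w i \<noteq> 0\<^sub>v d1 \<Longrightarrow> n \<le> m"
  shows "n \<ge> 1" "retract (ind_I n) M"
proof -
  have ab: "alpha M \<in> carrier_mat d2 d1" "beta M \<in> carrier_mat d2 d1" using M by (auto simp: kron_reps_def)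
  then have dims: "dim_col (alpha M) = d1" "dim_row (alpha M) = d2" by auto
  have v: "v i \<in> carrier_vec d1" and b0: "beta M *\<^sub>v v 0 = 0\<^sub>v d2"
    and vS: "alpha M *\<^sub>v v i = beta M *\<^sub>v v (Suc i)" and vz: "i \<ge> n \<Longrightarrow> v i = 0\<^sub>v d1" for i
    using chain unfolding kernel_chain_def dims by auto
  show n: "n \<ge> 1" using vz[of j] nz by (cases n) auto
  have a_last: "alpha M *\<^sub>v v (n - 1) = 0\<^sub>v d2"
    using vS[of "n - 1"] vz[of n] n ab by (simp add: mult_mat_zero_vec)
  \<comment> \<open>Otherwise dividing the polynomial vector by \<open>x\<close>, that is, shifting
    the chain, would contradict minimality.\<close>
  have v0: "v 0 \<noteq> 0\<^sub>v d1"
  proof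
    assume v0: "v 0 = 0\<^sub>v d1"
    have "kernel_chain M (n - 1) (\<lambda>i. v (Suc i))"
      unfolding kernel_chain_def dims using v vS vS[of 0, symmetric] vz v0 ab n
      by (auto simp: mult_mat_zero_vec)
    moreover have "v (Suc (j - 1)) \<noteq> 0\<^sub>v d1" using nz v0 by (cases j) auto
    ultimately show False using min[of "n - 1" "\<lambda>i. v (Suc i)" "j - 1"] n by simp
  qed
  \<comment> \<open>The basis of \<open>ind_I n\<close> at the first vertex goes to the vectors
    \<open>v i\<close>, and the basis at the second vertex to their images under
    \<open>alpha M\<close>.\<close>
  define F1 where "F1 = mat d1 n (\<lambda>(p, i). v i $ p)"
  define F2 where "F2 = mat d2 (n - 1) (\<lambda>(p, i). (alpha M *\<^sub>v v i) $ p)"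
  have F: "F1 \<in> carrier_mat d1 n" "F2 \<in> carrier_mat d2 (n - 1)" by (auto simp: F1_def F2_def)
  have colF: "col F1 i = v i" if "i < n" for i
    using that v[of i] by (auto simp: F1_def)
  have I: "alpha (ind_I n :: 'a kron_rep) \<in> carrier_mat (n - 1) n" "beta (ind_I n :: 'a kron_rep) \<in> carrier_mat (n - 1) n"
    using ind_I_in_kron_reps[OF n] by (auto simp: kron_reps_def)
  have aF: "alpha M * F1 = F2 * alpha (ind_I n)"
  proof (rule eq_matI)
    fix p i assume "p < dim_row (F2 * alpha (ind_I n))" "i < dim_col (F2 * alpha (ind_I n))"
    then have pi: "p < d2" "i < n" using F I by auto
    have "(alpha M * F1) $$ (p, i) = (alpha M *\<^sub>v v i) $ p" using pi ab F colF by auto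
    also have "\<dots> = (F2 * alpha (ind_I n)) $$ (p, i)"
      unfolding ind_I_mult_right(1)[OF n F(2) pi] using pi a_last n
      by (cases "i = n - 1") (auto simp: F2_def)
    finally show "(alpha M * F1) $$ (p, i) = (F2 * alpha (ind_I n)) $$ (p, i)" .
  qed (use ab F I in auto)
  have bF: "beta M * F1 = F2 * beta (ind_I n)"
  proof (rule eq_matI)
    fix p i assume "p < dim_row (F2 * beta (ind_I n))" "i < dim_col (F2 * beta (ind_I n))"
    then have pi: "p < d2" "i < n" using F I by auto
    have "(beta M * F1) $$ (p, i) = (beta M *\<^sub>v v i) $ p" using pi ab F colF by auto
    also have "\<dots> = (F2 * beta (ind_I n)) $$ (p, i)"
      unfolding ind_I_mult_right(2)[OF n F(2) pi] using pi b0 n vS[of "i - 1"]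
      by (cases i) (auto simp: F2_def)
    finally show "(beta M * F1) $$ (p, i) = (F2 * beta (ind_I n)) $$ (p, i)" .
  qed (use ab F I in auto)
  have "\<exists>G1 G2. G1 \<in> carrier_mat n d1 \<and> G2 \<in> carrier_mat (n - 1) d2 \<and> (G1 * F1) $$ (0, 0) = 1 \<and>
    G2 * alpha M = alpha (ind_I n) * G1 \<and> G2 * beta M = beta (ind_I n) * G1"
  proof (cases "n = 1")
    case True
    \<comment> \<open>\<open>ind_I 1\<close> is zero at the second vertex, so any functional with
      value 1 on \<open>v 0\<close> is a homomorphism as required. It comes from the alternative
      applied to the matrix without columns.\<close>
    have "F1 \<noteq> 0\<^sub>m d1 0 * u" if "u \<in> carrier_mat 0 1" for u
    proof
      assume "F1 = 0\<^sub>m d1 0 * u"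
      then have "F1 = 0\<^sub>m d1 1" using that by simp
      then have "v 0 = 0\<^sub>v d1" using colF[of 0] n True by (simp add: col_zero)
      with v0 show False by simp
    qed
    then obtain g where g: "g \<in> carrier_mat 1 d1" "g * F1 = 1\<^sub>m 1"
      using image_or_functional[of "0\<^sub>m d1 0" d1 0 F1] F True by auto
    then show ?thesis using True ab I
      by (intro exI[of _ g] exI[of _ "0\<^sub>m 0 d2"]) (auto intro!: eq_matI)
  next
    case False
    define k where "k = n - 2"
    have nk: "n - 1 = k + 1" "n = k + 2" using n False by (auto simp: k_def)
    \<comment> \<open>With right-hand side \<open>b\<close>, the block equations are
      \<open>beta u_0 = alpha v_0\<close>, then \<open>beta u_i = alpha u_(i-1)\<close>, and finally
      \<open>alpha u_(k-1) = 0\<close>; for \<open>k = 0\<close> only \<open>alpha v_0 = 0\<close>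
      remains.\<close>
    define X Y :: "'a mat" where "X = - sub_diag (k + 1) k" and "Y = main_diag (k + 1) k"
    have XY: "X \<in> carrier_mat (k + 1) k" "Y \<in> carrier_mat (k + 1) k" by (auto simp: X_def Y_def)
    define A where "A = pencil X Y M"
    have A: "A \<in> carrier_mat ((k + 1) * d2) (k * d1)" unfolding A_def using XY M by (rule pencil_carrier)
    define b where "b = mat ((k + 1) * d2) 1 (\<lambda>(a, _). if a < d2 then (alpha M *\<^sub>v v 0) $ a else 0)"
    have b: "b \<in> carrier_mat ((k + 1) * d2) 1" by (simp add: b_def)
    have b_idx: "b $$ (i * d2 + p, 0) = (if i = 0 then (alpha M *\<^sub>v v 0) $ p else 0)" if "i < k + 1" "p < d2" for i p
    proof -
      have "i * d2 + p < d2 \<longleftrightarrow> i = 0" using that by (cases i) auto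
      then show ?thesis using that block_index_less[OF that] by (auto simp: b_def)
    qed
    \<comment> \<open>A solution of \<open>A u = b\<close> would give the kernel chain \<open>v 0, u 0, u 1, \<dots>\<close> of length \<open>n - 1\<close>.\<close>
    have "b \<noteq> A * u" if u: "u \<in> carrier_mat (k * d1) 1" for u
    proof
      assume bu: "b = A * u"
      define w where "w j = vec d1 (\<lambda>q. u $$ (j * d1 + q, 0))" for j
      define w' where "w' i = (case i of 0 \<Rightarrow> v 0 | Suc i \<Rightarrow> if i < k then w i else 0\<^sub>v d1)" for i
      have w: "w j \<in> carrier_vec d1" for j by (simp add: w_def)
      have row: "(if i = 0 then (alpha M *\<^sub>v v 0) $ p else 0) =
        (if i < k then (beta M *\<^sub>v w i) $ p else 0) - (if i \<ge> 1 then (alpha M *\<^sub>v w (i - 1)) $ p else 0)"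
        if ip: "i < k + 1" "p < d2" for i p
      proof -
        have cu: "col u 0 \<in> carrier_vec (k * d1)" using u by (intro carrier_vecI) simp
        have cu_idx: "col u 0 $ (j * d1 + q) = w j $ q" if "j < k" "q < d1" for j q
          using that u block_index_less[OF that] by (auto simp: w_def)
        have "(if i = 0 then (alpha M *\<^sub>v v 0) $ p else 0) = (A *\<^sub>v col u 0) $ (i * d2 + p)"
          using b_idx[OF ip] block_index_less[OF ip] A u unfolding bu by (auto simp del: mult_Suc)
        also have "\<dots> = (\<Sum>j<k. \<Sum>q<d1. (X $$ (i, j) * alpha M $$ (p, q) + Y $$ (i, j) * beta M $$ (p, q)) * w j $ q)"
          unfolding A_def pencil_mult_vec[OF XY M cu ip] by (intro sum.cong refl) (simp add: cu_idx)
        also have "\<dots> = (\<Sum>j<k. X $$ (i, j) * (alpha M *\<^sub>v w j) $ p + Y $$ (i, j) * (beta M *\<^sub>v w j) $ p)"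
        proof -
          have mv: "(Z *\<^sub>v w j) $ p = (\<Sum>q<d1. Z $$ (p, q) * w j $ q)" if "Z \<in> carrier_mat d2 d1" for Z j
            using that ip carrier_vecD[OF w] by (auto simp: scalar_prod_def atLeast0LessThan intro!: sum.cong)
          show ?thesis
            by (simp add: mv[OF ab(1)] mv[OF ab(2)] sum_distrib_left sum.distrib algebra_simps)
        qed
        also have "\<dots> = (\<Sum>j<k. (if j = i then (beta M *\<^sub>v w j) $ p else 0) -
            (if j = i - 1 then if i \<ge> 1 then (alpha M *\<^sub>v w j) $ p else 0 else 0))"
          using ip by (intro sum.cong refl) (auto simp: X_def Y_def sub_diag_def main_diag_def)
        also have "\<dots> = (if i < k then (beta M *\<^sub>v w i) $ p else 0) - (if i \<ge> 1 then (alpha M *\<^sub>v w (i - 1)) $ p else 0)"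
          using ip by (auto simp: sum_subtractf)
        finally show ?thesis .
      qed
      have "kernel_chain M (k + 1) w'"
        unfolding kernel_chain_def dims
      proof (intro conjI allI impI)
        show "w' i \<in> carrier_vec d1" for i using v w by (auto simp: w'_def split: nat.splits)
        show "beta M *\<^sub>v w' 0 = 0\<^sub>v d2" using b0 by (simp add: w'_def)
        show "w' i = 0\<^sub>v d1" if "k + 1 \<le> i" for i using that by (auto simp: w'_def split: nat.splits)
        show "alpha M *\<^sub>v w' i = beta M *\<^sub>v w' (Suc i)" for i
        proof (rule eq_vecI)
          fix p assume "p < dim_vec (beta M *\<^sub>v w' (Suc i))"
          then have p: "p < d2" using ab by simp
          note z = mult_mat_zero_vec[OF ab(1)] mult_mat_zero_vec[OF ab(2)]
          show "(alpha M *\<^sub>v w' i) $ p = (beta M *\<^sub>v w' (Suc i)) $ p"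
          proof (cases "i < k + 1")
            case True
            then show ?thesis using row[OF True p] p z by (cases i) (auto simp: w'_def)
          next
            case False
            then show ?thesis using p z by (cases i) (auto simp: w'_def)
          qed
        qed (use ab in auto)
      qed
      moreover have "w' 0 \<noteq> 0\<^sub>v d1" using v0 by (simp add: w'_def)
      ultimately show False using min[of "k + 1" w' 0] nk by simp
    qed
    then obtain g where g: "g \<in> carrier_mat 1 ((k + 1) * d2)" "g * A = 0\<^sub>m 1 (k * d1)" "g * b = 1\<^sub>m 1"
      using image_or_functional[OF A b] by blast
    \<comment> \<open>By \<open>g * A = 0\<close> the rows of \<open>G2\<close> satisfy \<open>g j * beta M = g (j + 1) * alpha M\<close>; such tuples are
      the homomorphisms \<open>M \<rightarrow> ind_I n\<close>.\<close>
    define G2 where "G2 = mat (n - 1) d2 (\<lambda>(i, p). g $$ (0, i * d2 + p))"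
    \<comment> \<open>The equation for \<open>alpha\<close> forces all rows but the last, and the
      equation for \<open>beta\<close> forces the last one; \<open>link\<close> is the compatibility
      of the two.\<close>
    define G1 where "G1 = mat n d1 (\<lambda>(i, q). if i < n - 1 then (G2 * alpha M) $$ (i, q) else (G2 * beta M) $$ (n - 2, q))"
    have G: "G1 \<in> carrier_mat n d1" "G2 \<in> carrier_mat (n - 1) d2" by (auto simp: G1_def G2_def)
    have link: "(G2 * beta M) $$ (j, q) = (G2 * alpha M) $$ (Suc j, q)" if jq: "j < k" "q < d1" for j q
    proof -
      have "0 = (g * A) $$ (0, j * d1 + q)" unfolding g(2) using block_index_less[OF jq] by simp
      also have "\<dots> = (\<Sum>a<(k+1)*d2. g $$ (0, a) * A $$ (a, j * d1 + q))"
        using g(1) A block_index_less[OF jq] by (auto simp: scalar_prod_def atLeast0LessThan)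
      also have "\<dots> = (\<Sum>i<k+1. \<Sum>p<d2. G2 $$ (i, p) * (X $$ (i, j) * alpha M $$ (p, q) + Y $$ (i, j) * beta M $$ (p, q)))"
        unfolding sum_blocks A_def
        by (intro sum.cong refl) (use jq nk in \<open>auto simp: index_pencil[OF XY M] G2_def\<close>)
      also have "\<dots> = (\<Sum>i<k+1. X $$ (i, j) * (G2 * alpha M) $$ (i, q) + Y $$ (i, j) * (G2 * beta M) $$ (i, q))"
      proof -
        have mv: "(G2 * Z) $$ (i, q) = (\<Sum>p<d2. G2 $$ (i, p) * Z $$ (p, q))"
          if "Z \<in> carrier_mat d2 d1" "i < k + 1" for Z i
          using that jq nk G carrier_matD[OF G(2)] by (auto simp: scalar_prod_def atLeast0LessThan intro!: sum.cong)
        show ?thesis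
          by (intro sum.cong refl) (simp add: mv[OF ab(1)] mv[OF ab(2)] sum_distrib_left sum.distrib algebra_simps)
      qed
      also have "\<dots> = (\<Sum>i<k+1. (if i = j then (G2 * beta M) $$ (i, q) else 0) -
            (if i = Suc j then (G2 * alpha M) $$ (i, q) else 0))"
        using jq by (intro sum.cong refl) (auto simp: X_def Y_def sub_diag_def main_diag_def)
      also have "\<dots> = (G2 * beta M) $$ (j, q) - (G2 * alpha M) $$ (Suc j, q)"
        using jq unfolding sum_subtractf by (simp add: sum.delta del: sum.lessThan_Suc)
      finally show ?thesis by simp
    qed
    have aG: "G2 * alpha M = alpha (ind_I n) * G1"
    proof (rule eq_matI)
      fix i q assume "i < dim_row (alpha (ind_I n) * G1)" "q < dim_col (alpha (ind_I n) * G1)"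
      then have iq: "i < n - 1" "q < d1" using I G by auto
      show "(G2 * alpha M) $$ (i, q) = (alpha (ind_I n) * G1) $$ (i, q)"
        unfolding ind_I_mult_left(1)[OF G(1) iq] using iq by (simp add: G1_def)
    qed (use ab G I in auto)
    have bG: "G2 * beta M = beta (ind_I n) * G1"
    proof (rule eq_matI)
      fix i q assume "i < dim_row (beta (ind_I n) * G1)" "q < dim_col (beta (ind_I n) * G1)"
      then have iq: "i < n - 1" "q < d1" using I G by auto
      show "(G2 * beta M) $$ (i, q) = (beta (ind_I n) * G1) $$ (i, q)"
        unfolding ind_I_mult_left(2)[OF G(1) iq] using iq link[of i q] nk
        by (cases "i = k") (auto simp: G1_def)
    qed (use ab G I in auto)
    \<comment> \<open>Only block 0 of \<open>b\<close> is nonzero, so \<open>g * b\<close> pairs the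
      first row of \<open>G2\<close> with \<open>alpha M\<close> applied to \<open>v 0\<close>; this
      is the top left entry of \<open>G1 * F1\<close>.\<close>
    have "1 = (g * b) $$ (0, 0)" unfolding g(3) by simp
    also have "\<dots> = (\<Sum>a<(k+1)*d2. g $$ (0, a) * b $$ (a, 0))"
      using g(1) b by (auto simp: scalar_prod_def atLeast0LessThan)
    also have "\<dots> = (\<Sum>i<k+1. \<Sum>p<d2. if i = 0 then G2 $$ (0, p) * (alpha M *\<^sub>v v 0) $ p else 0)"
      unfolding sum_blocks by (intro sum.cong refl) (use b_idx nk in \<open>auto simp: G2_def\<close>)
    also have "\<dots> = (\<Sum>i<k+1. if i = 0 then (\<Sum>p<d2. G2 $$ (0, p) * (alpha M *\<^sub>v v 0) $ p) else 0)"
      by (intro sum.cong refl) auto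
    also have "\<dots> = (\<Sum>p<d2. G2 $$ (0, p) * (alpha M *\<^sub>v v 0) $ p)"
      by (simp add: sum.delta del: sum.lessThan_Suc)
    also have "\<dots> = (G2 * (alpha M * F1)) $$ (0, 0)"
    proof -
      have aF1: "alpha M * F1 \<in> carrier_mat d2 n" using ab F by simp
      have "(alpha M * F1) $$ (p, 0) = (alpha M *\<^sub>v v 0) $ p" if "p < d2" for p
        using that ab F n colF[of 0] by simp
      moreover have "(G2 * (alpha M * F1)) $$ (0, 0) = (\<Sum>p<d2. G2 $$ (0, p) * (alpha M * F1) $$ (p, 0))"
        using G(2) nk n carrier_matD[OF G(2)] carrier_matD[OF aF1]
        by (simp add: scalar_prod_def atLeast0LessThan del: index_mult_mat(2,3))
      ultimately show ?thesis by simp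
    qed
    also have "G2 * (alpha M * F1) = alpha (ind_I n) * (G1 * F1)"
      using aG ab G F I mult_mat_assoc[of G2 "alpha M" F1] mult_mat_assoc[of "alpha (ind_I n)" G1 F1] by simp
    also have "(alpha (ind_I n) * (G1 * F1)) $$ (0, 0) = (G1 * F1) $$ (0, 0)"
      using nk G F by (intro ind_I_mult_left(1)[of _ _ n]) auto
    finally show ?thesis using aG bG G by metis
  qed
  then obtain G1 G2 where G: "G1 \<in> carrier_mat n d1" "G2 \<in> carrier_mat (n - 1) d2" "(G1 * F1) $$ (0, 0) = 1"
    and aG: "G2 * alpha M = alpha (ind_I n) * G1" and bG: "G2 * beta M = beta (ind_I n) * G1" by blast
  have "alpha (ind_I n) * (G1 * F1) = G2 * F2 * alpha (ind_I n)"
  proof -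
    have "alpha (ind_I n) * (G1 * F1) = G2 * (alpha M * F1)"
      using aG G(1,2) F I ab mult_mat_assoc[of G2 "alpha M" F1] mult_mat_assoc[of "alpha (ind_I n)" G1 F1] by simp
    then show ?thesis using aF G(2) F I by (simp add: mult_mat_assoc)
  qed
  moreover have "beta (ind_I n) * (G1 * F1) = G2 * F2 * beta (ind_I n)"
  proof -
    have "beta (ind_I n) * (G1 * F1) = G2 * (beta M * F1)"
      using bG G(1,2) F I ab mult_mat_assoc[of G2 "beta M" F1] mult_mat_assoc[of "beta (ind_I n)" G1 F1] by simp
    then show ?thesis using bF G(2) F I by (simp add: mult_mat_assoc)
  qed
  ultimately have "G1 * F1 = 1\<^sub>m n" "G2 * F2 = 1\<^sub>m (n - 1)"
    using ind_I_endomorphism[OF n _ _ _ _ G(3), of "G2 * F2"] G F by auto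
  then show "retract (ind_I n) M"
    unfolding retract_def dims using F G aF bF aG bG n
    by (intro exI[of _ F1] exI[of _ F2] exI[of _ G1] exI[of _ G2]) (simp add: dims_ind)
qed

lemma retract_ind_I_exists:
  assumes M: "M \<in> kron_reps d1 d2" and chain: "kernel_chain M n v" "v j \<noteq> 0\<^sub>v d1"
  obtains m where "m \<ge> 1" "retract (ind_I m) M"
proof -
  define m where "m = (LEAST m. \<exists>w i. kernel_chain M m w \<and> w i \<noteq> 0\<^sub>v d1)"
  have "\<exists>w i. kernel_chain M m w \<and> w i \<noteq> 0\<^sub>v d1"
    unfolding m_def using chain by (intro LeastI[of "\<lambda>m. \<exists>w i. kernel_chain M m w \<and> w i \<noteq> 0\<^sub>v d1" n]) blast
  then obtain w i where "kernel_chain M m w" "w i \<noteq> 0\<^sub>v d1" by blast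
  from retract_ind_I_if_kernel_chain[OF M this] show ?thesis
    using that[of m] Least_le[of "\<lambda>m. \<exists>w i. kernel_chain M m w \<and> w i \<noteq> 0\<^sub>v d1"] unfolding m_def by blast
qed

text \<open>A nonconstant polynomial vanishing everywhere would leave \<open>p + 1\<close>
  nonconstant without a root.\<close>

lemma alg_closed_poly_zero:
  assumes "\<And>x. poly (p :: 'a :: alg_closed_field poly) x = 0"
  shows "p = 0"
proof (cases "degree p = 0")
  case True
  then obtain c where "p = [:c:]" by (rule degree_eq_zeroE)
  then show ?thesis using assms[of 0] by simp
next
  case False
  then have "degree (p + 1) > 0" by (simp add: degree_add_eq_left)
  then obtain x where "poly (p + 1) x = 0" using alg_closed_imp_poly_has_root by blast
  then show ?thesis using assms by simp
qed

text \<open>A singular matrix over the integral domain of polynomials has a nonzero kernel vector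
  with polynomial entries, and the coefficients of that vector form the chain.\<close>

lemma kernel_chain_exists:
  fixes M :: "'a :: alg_closed_field kron_rep"
  assumes M: "M \<in> kron_reps d1 d2" and le: "d2 \<le> d1"
    and sing: "d2 = d1 \<Longrightarrow> \<forall>l. det (l \<cdot>\<^sub>m alpha M - beta M) = 0"
  obtains n v j where "kernel_chain M n v" "v j \<noteq> 0\<^sub>v d1"
proof -
  have ab: "alpha M \<in> carrier_mat d2 d1" "beta M \<in> carrier_mat d2 d1" using M by (auto simp: kron_reps_def)
  \<comment> \<open>The polynomial matrix \<open>x * alpha M - beta M\<close>, padded with zero rows
    to a square so that determinants apply. A padding row makes the determinant zero at once when
    \<open>d2 < d1\<close>.\<close>
  define A where "A = mat d1 d1 (\<lambda>(i, j). if i < d2 then [:- beta M $$ (i, j), alpha M $$ (i, j):] else 0)"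
  have A: "A \<in> carrier_mat d1 d1" by (simp add: A_def)
  have "det A = 0"
  proof (cases "d2 = d1")
    case True
    have "poly (det A) l = 0" for l
    proof -
      have "poly (det A) l = det (l \<cdot>\<^sub>m alpha M - beta M)"
        by (rule poly_det_cong[of _ d1]) (use ab True A in \<open>auto simp: A_def\<close>)
      then show ?thesis using sing True by simp
    qed
    then show ?thesis by (rule alg_closed_poly_zero)
  next
    case False
    then have d: "d2 < d1" using le by simp
    have "row A d2 = 0\<^sub>v d1" using d by (intro eq_vecI) (auto simp: A_def)
    moreover have "A\<^sup>T *\<^sub>v unit_vec d1 d2 = row A d2"
      using A d by (intro eq_vecI) (auto simp: scalar_prod_right_unit)
    moreover have "unit_vec d1 d2 \<noteq> (0\<^sub>v d1 :: 'a poly vec)"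
      using d by (metis index_unit_vec(2) index_zero_vec(1) zero_neq_one)
    ultimately have "det A\<^sup>T = 0"
      using A by (subst det_0_iff_vec_prod_zero[of _ d1]) (auto intro!: exI[of _ "unit_vec d1 d2"])
    then show ?thesis using det_transpose[OF A] by simp
  qed
  then obtain p where p: "p \<in> carrier_vec d1" "p \<noteq> 0\<^sub>v d1" "A *\<^sub>v p = 0\<^sub>v d1"
    using det_0_iff_vec_prod_zero[OF A] by blast
  define v where "v i = vec d1 (\<lambda>q. coeff (p $ q) i)" for i
  \<comment> \<open>The sum of the degrees bounds each of them, so all coefficients from index
    \<open>n\<close> on vanish.\<close>
  define n where "n = Suc (\<Sum>q<d1. degree (p $ q))"
  have v: "v i \<in> carrier_vec d1" for i by (simp add: v_def)
  have row: "(beta M *\<^sub>v v i) $ r = (if i = 0 then 0 else (alpha M *\<^sub>v v (i - 1)) $ r)" if r: "r < d2" for r i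
  proof -
    have "0 = (A *\<^sub>v p) $ r" using p r le by simp
    also have "\<dots> = (\<Sum>q<d1. [:- beta M $$ (r, q), alpha M $$ (r, q):] * p $ q)"
    proof -
      have "(A *\<^sub>v p) $ r = (\<Sum>q<d1. A $$ (r, q) * p $ q)"
        using p(1) A r le carrier_matD[OF A] by (simp add: scalar_prod_def atLeast0LessThan)
      also have "\<dots> = (\<Sum>q<d1. [:- beta M $$ (r, q), alpha M $$ (r, q):] * p $ q)"
        by (intro sum.cong refl) (use r le in \<open>simp add: A_def\<close>)
      finally show ?thesis .
    qed
    finally have "0 = coeff (\<Sum>q<d1. [:- beta M $$ (r, q), alpha M $$ (r, q):] * p $ q) i" by simp
    also have "\<dots> = (\<Sum>q<d1. (if i = 0 then 0 else alpha M $$ (r, q) * coeff (p $ q) (i - 1)) -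
        beta M $$ (r, q) * coeff (p $ q) i)"
      unfolding coeff_sum by (intro sum.cong refl) (auto simp: coeff_pCons split: nat.splits)
    also have "\<dots> = (if i = 0 then 0 else (\<Sum>q<d1. alpha M $$ (r, q) * coeff (p $ q) (i - 1))) -
        (\<Sum>q<d1. beta M $$ (r, q) * coeff (p $ q) i)"
      by (auto simp: sum_subtractf)
    finally show ?thesis
      using r ab by (auto simp: scalar_prod_def atLeast0LessThan v_def)
  qed
  have "kernel_chain M n v"
    unfolding kernel_chain_def carrier_matD[OF ab(1)]
  proof (intro conjI allI impI)
    show "beta M *\<^sub>v v 0 = 0\<^sub>v d2"
      using ab row[of _ 0] by (intro eq_vecI) auto
    show "alpha M *\<^sub>v v i = beta M *\<^sub>v v (Suc i)" for i
      using ab row[of _ "Suc i"] by (intro eq_vecI) (auto simp del: index_mult_mat_vec)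
    show "v i = 0\<^sub>v d1" if "n \<le> i" for i
    proof (rule eq_vecI)
      fix q assume "q < dim_vec (0\<^sub>v d1 :: 'a vec)"
      then have q: "q < d1" by simp
      have "degree (p $ q) \<le> (\<Sum>q<d1. degree (p $ q))"
        using q by (intro member_le_sum) auto
      then show "v i $ q = 0\<^sub>v d1 $ q" using q that by (simp add: v_def n_def coeff_eq_0)
    qed (simp add: v_def)
  qed (rule v)
  moreover have "\<exists>j. v j \<noteq> 0\<^sub>v d1"
  proof (rule ccontr)
    assume "\<not> ?thesis"
    then have *: "v j $ q = 0" if "q < d1" for j q using that by simp
    have "p = 0\<^sub>v d1"
      using p(1) * by (intro eq_vecI) (auto simp: v_def poly_eq_iff)
    with p(2) show False by simp
  qed
  ultimately show ?thesis using that by blast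
qed

text \<open>Deflation: an eigenvector becomes the first basis vector,
  \<open>complement_of_left_invertible\<close> completes the basis, and the induction hypothesis
  triangularizes the remaining diagonal block.\<close>

lemma similar_upper_triangular:
  assumes "(A :: 'a :: alg_closed_field mat) \<in> carrier_mat n n"
  shows "\<exists>B. B \<in> carrier_mat n n \<and> upper_triangular B \<and> similar_mat A B"
  using assms
proof (induction n arbitrary: A)
  case 0
  then show ?case by (intro exI[of _ A]) (auto intro: similar_mat_refl)
next
  case (Suc n)
  note A = Suc.prems
  have "degree (char_poly A) > 0" using degree_monic_char_poly[OF A] by simp
  then obtain e where "poly (char_poly A) e = 0" using alg_closed_imp_poly_has_root by blast
  then have "eigenvalue A e" using eigenvalue_root_char_poly[OF A] by simp
  then obtain v where v: "v \<in> carrier_vec (Suc n)" "v \<noteq> 0\<^sub>v (Suc n)" "A *\<^sub>v v = e \<cdot>\<^sub>v v"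
    using A unfolding eigenvalue_def eigenvector_def by auto
  define F where "F = mat_of_cols (Suc n) [v]"
  have F: "F \<in> carrier_mat (Suc n) 1" and colF: "col F 0 = v" using v by (auto simp: F_def)
  have AF: "A * F = e \<cdot>\<^sub>m F"
  proof (rule eq_matI)
    fix i j assume "i < dim_row (e \<cdot>\<^sub>m F)" "j < dim_col (e \<cdot>\<^sub>m F)"
    then have ij: "i < Suc n" "j = 0" using F by auto
    have "(A * F) $$ (i, j) = (A *\<^sub>v v) $ i" using ij A F colF by simp
    also have "\<dots> = (e \<cdot>\<^sub>m F) $$ (i, j)" using ij v F colF by (auto simp: F_def mat_of_cols_def)
    finally show "(A * F) $$ (i, j) = (e \<cdot>\<^sub>m F) $$ (i, j)" .
  qed (use A F in auto)
  \<comment> \<open>The matrix without columns turns \<open>image_or_functional\<close> into a left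
    inverse of the nonzero column \<open>F\<close>.\<close>
  have "F \<noteq> 0\<^sub>m (Suc n) 0 * u" if "u \<in> carrier_mat 0 1" for u
  proof
    assume "F = 0\<^sub>m (Suc n) 0 * u"
    then have "F = 0\<^sub>m (Suc n) 1" using that by simp
    with colF v(2) show False by simp
  qed
  then obtain G where G: "G \<in> carrier_mat 1 (Suc n)" "G * F = 1\<^sub>m 1"
    using image_or_functional[OF zero_carrier_mat F, of 0] by blast
  obtain X Y where XY: "X \<in> carrier_mat (Suc n) n" "Y \<in> carrier_mat n (Suc n)"
    "F * G + X * Y = 1\<^sub>m (Suc n)" "Y * X = 1\<^sub>m n" "G * X = 0\<^sub>m 1 n" "Y * F = 0\<^sub>m n 1"
    using complement_of_left_invertible[OF F G] by (metis diff_Suc_1)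
  define P Q where "P = append_cols F X" and "Q = G @\<^sub>r Y"
  have PQ: "P \<in> carrier_mat (Suc n) (Suc n)" "Q \<in> carrier_mat (Suc n) (Suc n)"
    using append_cols_carrier[OF F XY(1)] carrier_append_rows[OF G(1) XY(2)] by (auto simp: P_def Q_def)
  have inv: "P * Q = 1\<^sub>m (Suc n)" "Q * P = 1\<^sub>m (Suc n)"
    unfolding P_def Q_def append_cols_mult_append_rows[OF F XY(1) G(1) XY(2)]
      append_rows_mult_append_cols[OF G(1) XY(2) F XY(1)] using G XY by auto
  define B where "B = four_block_mat (e \<cdot>\<^sub>m 1\<^sub>m 1) (G * (A * X)) (0\<^sub>m n 1) (Y * (A * X))"
  have AX: "A * X \<in> carrier_mat (Suc n) n" using A XY by simp
  have eF: "e \<cdot>\<^sub>m F \<in> carrier_mat (Suc n) 1" using F by simp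
  have "Q * (A * P) = B"
    unfolding P_def Q_def mult_append_cols[OF A F XY(1)] AF append_rows_mult_append_cols[OF G(1) XY(2) eF AX] B_def
    using G F XY by (auto simp: mult_smult_distrib[OF G(1) F] mult_smult_distrib[OF XY(2) F])
  then have "A = P * B * Q"
  proof -
    assume eq: "Q * (A * P) = B"
    have "P * B * Q = (P * Q) * A * (P * Q)" unfolding eq[symmetric] using A PQ by (simp add: mult_mat_assoc)
    then show "A = P * B * Q" using inv A by simp
  qed
  moreover have B: "B \<in> carrier_mat (Suc n) (Suc n)"
    unfolding B_def using four_block_carrier_mat[of "e \<cdot>\<^sub>m 1\<^sub>m 1" 1 1 "Y * (A * X)" n n] AX XY by simp
  ultimately have 1: "similar_mat A B"
    using PQ inv A by (intro similar_matI[of _ _ P Q "Suc n"]) auto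
  obtain C where C: "C \<in> carrier_mat n n" "upper_triangular C" "similar_mat (Y * (A * X)) C"
    using Suc.IH[of "Y * (A * X)"] AX XY by auto
  have "similar_mat (e \<cdot>\<^sub>m 1\<^sub>m 1) (e \<cdot>\<^sub>m 1\<^sub>m 1)" by (rule similar_mat_refl[of _ 1]) simp
  \<comment> \<open>Conjugating the lower right block alone changes the upper right block to some
    \<open>D\<close>, which is harmless for triangularity.\<close>
  from similar_mat_four_block_0_ex[OF this C(3), of "G * (A * X)" 1 n]
  obtain D where D: "D \<in> carrier_mat 1 n" "similar_mat B (four_block_mat (e \<cdot>\<^sub>m 1\<^sub>m 1) D (0\<^sub>m n 1) C)"
    unfolding B_def using AX G XY by auto
  have "upper_triangular (four_block_mat (e \<cdot>\<^sub>m 1\<^sub>m 1) D (0\<^sub>m n 1) C)"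
    by (rule upper_triangular_four_block[of _ 1 _ n]) (use C in auto)
  moreover have "four_block_mat (e \<cdot>\<^sub>m 1\<^sub>m 1) D (0\<^sub>m n 1) C \<in> carrier_mat (Suc n) (Suc n)"
    using four_block_carrier_mat[of "e \<cdot>\<^sub>m 1\<^sub>m 1" 1 1 C n n] C by simp
  ultimately show ?case using similar_mat_trans[OF 1 D(2)] by blast
qed

lemma jordan_nf_exists_alg_closed:
  assumes "(A :: 'a :: alg_closed_field mat) \<in> carrier_mat n n"
  shows "\<exists>n_as. jordan_nf A n_as"
proof -
  obtain B where B: "B \<in> carrier_mat n n" "upper_triangular B" "similar_mat A B"
    using similar_upper_triangular[OF assms] by blast
  then show ?thesis
    using triangular_to_jnf_vector[OF B(1,2)] similar_mat_trans[OF B(3)] unfolding jordan_nf_def by blast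
qed

section \<open>Regular pencils over an algebraically closed field\<close>

lemma kron_iso_conjugate:
  assumes "P \<in> carrier_mat d d" "Q \<in> carrier_mat d d" "P * Q = 1\<^sub>m d" "Q * P = 1\<^sub>m d"
    and "A \<in> carrier_mat d d" "B \<in> carrier_mat d d" "A' \<in> carrier_mat d d" "B' \<in> carrier_mat d d"
    and "Q * A = A' * Q" "Q * B = B' * (Q :: 'a :: field mat)"
  shows "kron_iso (Rep A B) (Rep A' B')"
  by (rule kron_isoI[of _ d d _ Q P Q P]) (use assms in \<open>auto simp: kron_reps_def\<close>)

lemma similar_mat_wit_intertwines:
  assumes "A \<in> carrier_mat n n" "similar_mat_wit A B P Q"
  shows "Q * A = B * Q"
proof -
  note w = similar_mat_witD2[OF assms]
  have "Q * A = Q * (P * B * Q)" using w(3) by (rule arg_cong)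
  also have "\<dots> = Q * P * (B * Q)" using w(5-7) by (simp add: assoc_mult_mat[of Q n n P n "B * Q" n])
  finally show ?thesis using w(2,5,7) by simp
qed

lemma ind_R_in_indecs: "n \<ge> 1 \<Longrightarrow> ind_R n l \<in> indecs"
  unfolding indecs_def by blast

lemma diag_block_mat_ones:
  "diag_block_mat (map (\<lambda>(n, a). 1\<^sub>m n) n_as) = 1\<^sub>m (sum_list (map fst n_as))"
  by (induction n_as) (auto simp: Let_def)

text \<open>An identity at \<open>alpha\<close> is preserved by conjugating with the same matrix at
  both vertices, so the Jordan form of \<open>C\<close> lists the summands at finite points.\<close>

lemma decomposable_one_left:
  assumes C: "(C :: 'a :: alg_closed_field mat) \<in> carrier_mat d d"
  shows "decomposable (Rep (1\<^sub>m d) C)"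
proof -
  obtain n_as where jnf: "jordan_nf C n_as" using jordan_nf_exists_alg_closed[OF C] by blast
  then obtain P Q where wit: "similar_mat_wit C (jordan_matrix n_as) P Q"
    unfolding jordan_nf_def similar_mat_def by blast
  note w = similar_mat_witD2[OF C wit] and QC = similar_mat_wit_intertwines[OF C wit]
  have d: "sum_list (map fst n_as) = d" using w(5) by (metis carrier_matD(1) jordan_matrix_dim(1))
  have pos: "n \<ge> 1" if "(n, a) \<in> set n_as" for n a
    using jnf that unfolding jordan_nf_def by (force simp: Suc_le_eq)
  have "kron_direct_sum (map (\<lambda>(n, a). ind_R n (Pt a)) n_as) = Rep (1\<^sub>m d) (jordan_matrix n_as)"
    by (simp add: diag_block_mat_ones[unfolded case_prod_unfold] kron_direct_sum_def jordan_matrix_def comp_def case_prod_unfold d)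
  moreover have "kron_iso (Rep (1\<^sub>m d) C) (Rep (1\<^sub>m d) (jordan_matrix n_as))"
    using w(7) by (intro kron_iso_conjugate[OF w(6,7,1,2) one_carrier_mat C one_carrier_mat w(5) _ QC])
      (simp only: left_mult_one_mat right_mult_one_mat)
  moreover have "set (map (\<lambda>(n, a). ind_R n (Pt a)) n_as) \<subseteq> indecs"
    by (auto simp: ind_R_in_indecs simp del: ind_R.simps dest: pos)
  ultimately show ?thesis unfolding decomposable_def by metis
qed

text \<open>The eigenvalue hypothesis makes all Jordan blocks nilpotent, and these together with an
  identity at \<open>beta\<close> are exactly the summands at infinity.\<close>

lemma decomposable_one_right:
  assumes C: "(C :: 'a :: alg_closed_field mat) \<in> carrier_mat d d" and ev: "\<And>k. eigenvalue C k \<Longrightarrow> k = 0"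
  shows "decomposable (Rep C (1\<^sub>m d))"
proof -
  obtain n_as where jnf: "jordan_nf C n_as" using jordan_nf_exists_alg_closed[OF C] by blast
  then obtain P Q where wit: "similar_mat_wit C (jordan_matrix n_as) P Q"
    unfolding jordan_nf_def similar_mat_def by blast
  note w = similar_mat_witD2[OF C wit] and QC = similar_mat_wit_intertwines[OF C wit]
  have d: "sum_list (map fst n_as) = d" using w(5) by (metis carrier_matD(1) jordan_matrix_dim(1))
  have pos: "n \<ge> 1" if "(n, a) \<in> set n_as" for n a
    using jnf that unfolding jordan_nf_def by (force simp: Suc_le_eq)
  have zero: "a = 0" if "(n, a) \<in> set n_as" for n a
  proof -
    have "poly (char_poly C) a = (\<Prod>(n, b)\<leftarrow>n_as. poly [:- b, 1:] a ^ n)"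
      unfolding jordan_nf_char_poly[OF jnf] by (simp add: poly_prod_list comp_def case_prod_unfold o_def)
    also have "\<dots> = 0"
      using that pos[OF that] by (force simp: prod_list_zero_iff)
    finally show ?thesis using ev eigenvalue_root_char_poly[OF C] by blast
  qed
  have "jordan_matrix n_as = diag_block_mat (map (\<lambda>(n, a). jordan_block n 0) n_as)"
    unfolding jordan_matrix_def by (intro arg_cong[of _ _ diag_block_mat] map_cong) (use zero in auto)
  then have "kron_direct_sum (map (\<lambda>(n, a). ind_R n Infty) n_as) = Rep (jordan_matrix n_as) (1\<^sub>m d)"
    by (simp add: diag_block_mat_ones[unfolded case_prod_unfold] kron_direct_sum_def comp_def case_prod_unfold d)
  moreover have "kron_iso (Rep C (1\<^sub>m d)) (Rep (jordan_matrix n_as) (1\<^sub>m d))"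
    using w(7) by (intro kron_iso_conjugate[OF w(6,7,1,2) C one_carrier_mat w(5) one_carrier_mat QC])
      (simp only: left_mult_one_mat right_mult_one_mat)
  moreover have "set (map (\<lambda>(n, a). ind_R n Infty) n_as) \<subseteq> indecs"
    by (auto simp: ind_R_in_indecs simp del: ind_R.simps dest: pos)
  ultimately show ?thesis unfolding decomposable_def by metis
qed

text \<open>For \<open>a\<close> nonzero the first matrix is invertible and can be normalized to the
  identity. For \<open>a = 0\<close> the second is, having diagonal \<open>-1\<close>, and
  normalizing it leaves a nilpotent first matrix.\<close>

lemma decomposable_jordan_block_pencil:
  fixes a l :: "'a :: alg_closed_field"
  shows "decomposable (Rep (jordan_block n a) (l \<cdot>\<^sub>m jordan_block n a - 1\<^sub>m n))"
proof -
  define J where "J = jordan_block n a"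
  define H where "H = l \<cdot>\<^sub>m J - 1\<^sub>m n"
  have J: "J \<in> carrier_mat n n" and H: "H \<in> carrier_mat n n" by (auto simp: J_def H_def)
  have M: "Rep J H \<in> kron_reps n n" using J H by (simp add: kron_reps_def)
  have "decomposable (Rep J H)"
  proof (cases "a = 0")
    case False
    have "det J \<noteq> 0"
      by (rule det_nonzero_if_upper_triangular[OF J]) (use False in \<open>auto simp: J_def index_jordan_block\<close>)
    then obtain K where K: "K \<in> carrier_mat n n" "J * K = 1\<^sub>m n" "K * J = 1\<^sub>m n"
      using det_nonzero_inverse[OF J] by metis
    have KH: "K * H \<in> carrier_mat n n" using K H by simp
    have "kron_iso (Rep J H) (Rep (1\<^sub>m n) (K * H))"
      by (rule kron_isoI[OF M, of _ "1\<^sub>m n" "1\<^sub>m n" K J]) (use J H K in \<open>auto simp: kron_reps_def\<close>)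
    then show ?thesis
      using decomposable_kron_iso[OF M _ _ decomposable_one_left[OF KH]] KH by (simp add: kron_reps_def)
  next
    case True
    have "det H \<noteq> 0"
      by (rule det_nonzero_if_upper_triangular[OF H]) (use True in \<open>auto simp: J_def H_def index_jordan_block\<close>)
    then obtain K where K: "K \<in> carrier_mat n n" "H * K = 1\<^sub>m n" "K * H = 1\<^sub>m n"
      using det_nonzero_inverse[OF H] by metis
    have KJ: "K * J \<in> carrier_mat n n" using K J by simp
    have iso: "kron_iso (Rep J H) (Rep (K * J) (1\<^sub>m n))"
      by (rule kron_isoI[OF M, of _ "1\<^sub>m n" "1\<^sub>m n" K H]) (use J H K in \<open>auto simp: kron_reps_def\<close>)
    \<comment> \<open>An eigenvector for a nonzero \<open>k\<close> would lie in the kernel of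
      \<open>J - k * H\<close>, which is upper triangular with diagonal \<open>k\<close>.\<close>
    have "k = 0" if ev: "eigenvalue (K * J) k" for k
    proof (rule ccontr)
      assume k: "k \<noteq> 0"
      obtain v where v: "v \<in> carrier_vec n" "v \<noteq> 0\<^sub>v n" "K * J *\<^sub>v v = k \<cdot>\<^sub>v v"
        using ev KJ unfolding eigenvalue_def eigenvector_def by auto
      have "J = H * (K * J)" using H J K by (simp add: K(2) flip: assoc_mult_mat[of H n n K n J n])
      then have "J *\<^sub>v v = H * (K * J) *\<^sub>v v" by simp
      also have "\<dots> = H *\<^sub>v (K * J *\<^sub>v v)" using H KJ v(1) by (rule assoc_mult_mat_vec)
      also have "\<dots> = k \<cdot>\<^sub>v (H *\<^sub>v v)" unfolding v(3) using H v by (simp add: mult_mat_vec)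
      finally have Jv: "J *\<^sub>v v = k \<cdot>\<^sub>v (H *\<^sub>v v)" .
      have "det (J - k \<cdot>\<^sub>m H) \<noteq> 0"
        by (rule det_nonzero_if_upper_triangular[of _ n])
          (use True k in \<open>auto simp: J_def H_def index_jordan_block\<close>)
      moreover have "(J - k \<cdot>\<^sub>m H) *\<^sub>v v = 0\<^sub>v n"
      proof -
        have "(J - k \<cdot>\<^sub>m H) *\<^sub>v v = J *\<^sub>v v - (k \<cdot>\<^sub>m H) *\<^sub>v v"
          using J H v by (intro minus_mult_distrib_mat_vec[of _ n n]) auto
        also have "(k \<cdot>\<^sub>m H) *\<^sub>v v = k \<cdot>\<^sub>v (H *\<^sub>v v)" using H v by (intro eq_vecI) auto
        finally show ?thesis unfolding Jv using H v by (intro eq_vecI) auto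
      qed
      moreover have "J - k \<cdot>\<^sub>m H \<in> carrier_mat n n" using H by (intro minus_carrier_mat) simp
      ultimately show False using det_0_iff_vec_prod_zero v(1,2) by blast
    qed
    then show ?thesis
      using decomposable_kron_iso[OF M _ iso decomposable_one_right[OF KJ]] KJ by (simp add: kron_reps_def)
  qed
  then show ?thesis by (simp add: J_def H_def)
qed

text \<open>After multiplication by the inverse of the invertible member, \<open>beta\<close> is a
  polynomial in \<open>T\<close>, so the Jordan form of the single matrix \<open>T\<close> puts both
  matrices into block diagonal form at once.\<close>

lemma decomposable_regular:
  fixes M :: "'a :: alg_closed_field kron_rep"
  assumes M: "M \<in> kron_reps d d" and reg: "det (l \<cdot>\<^sub>m alpha M - beta M) \<noteq> 0"
  shows "decomposable M"
proof -
  have ab: "alpha M \<in> carrier_mat d d" "beta M \<in> carrier_mat d d" using M by (auto simp: kron_reps_def)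
  have D: "l \<cdot>\<^sub>m alpha M - beta M \<in> carrier_mat d d" using ab by auto
  obtain K where K: "K \<in> carrier_mat d d" "(l \<cdot>\<^sub>m alpha M - beta M) * K = 1\<^sub>m d" "K * (l \<cdot>\<^sub>m alpha M - beta M) = 1\<^sub>m d"
    using det_nonzero_inverse[OF D reg] by metis
  define T where "T = K * alpha M"
  have T: "T \<in> carrier_mat d d" using K ab by (simp add: T_def)
  define N where "N = Rep T (l \<cdot>\<^sub>m T - 1\<^sub>m d)"
  have N: "N \<in> kron_reps d d" using T by (auto simp: N_def kron_reps_def)
  have "K * (l \<cdot>\<^sub>m alpha M - beta M) = l \<cdot>\<^sub>m T - K * beta M"
    unfolding T_def using K ab by (subst mult_minus_distrib_mat[of _ d d _ d]) (auto simp: mult_smult_distrib[of _ d d _ d])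
  moreover have "K * beta M = l \<cdot>\<^sub>m T - (l \<cdot>\<^sub>m T - K * beta M)"
    using K(1) ab T by (intro eq_matI) auto
  ultimately have Kb: "K * beta M = l \<cdot>\<^sub>m T - 1\<^sub>m d" unfolding K(3) by simp
  have 1: "kron_iso M N"
    by (rule kron_isoI[OF M N, of "1\<^sub>m d" "1\<^sub>m d" K "l \<cdot>\<^sub>m alpha M - beta M"])
      (use K D T Kb in \<open>auto simp: N_def T_def\<close>)
  obtain n_as where "jordan_nf T n_as" using jordan_nf_exists_alg_closed[OF T] by blast
  then obtain P Q where wit: "similar_mat_wit T (jordan_matrix n_as) P Q"
    unfolding jordan_nf_def similar_mat_def by blast
  note w = similar_mat_witD2[OF T wit]
  define J where "J = jordan_matrix n_as"
  have J: "J \<in> carrier_mat d d" using w(5) by (simp add: J_def)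
  have QT: "Q * T = J * Q" unfolding J_def by (rule similar_mat_wit_intertwines[OF T wit])
  have QT': "Q * (l \<cdot>\<^sub>m T - 1\<^sub>m d) = (l \<cdot>\<^sub>m J - 1\<^sub>m d) * Q"
    using w(7) T J QT by (simp add: mult_minus_distrib_mat[of _ d d _ d] minus_mult_distrib_mat[of _ d d _ _ d]
        mult_smult_distrib[of _ d d _ d] mult_smult_assoc_mat[of _ d d _ d])
  define K' where "K' = Rep J (l \<cdot>\<^sub>m J - 1\<^sub>m d)"
  have K': "K' \<in> kron_reps d d" using J by (auto simp: K'_def kron_reps_def)
  have 2: "kron_iso N K'"
    unfolding N_def K'_def by (rule kron_iso_conjugate[OF w(6,7,1,2) T _ J _ QT QT']) (use T J in auto)
  have d: "sum_list (map fst n_as) = d" using w(5) by (metis carrier_matD(1) jordan_matrix_dim(1))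
  have "diag_block_mat (map (\<lambda>(n, a). l \<cdot>\<^sub>m jordan_block n a - 1\<^sub>m n) n_as) =
      l \<cdot>\<^sub>m jordan_matrix n_as - 1\<^sub>m (sum_list (map fst n_as))"
  proof (induction n_as)
    case Nil
    then show ?case by (intro eq_matI) (auto simp: jordan_matrix_def)
  next
    case (Cons na n_as)
    obtain n a where na: "na = (n, a)" by force
    show ?case
      using Cons by (intro eq_matI) (auto simp: na jordan_matrix_def Let_def dim_diag_block_mat comp_def case_prod_unfold)
  qed
  then have "K' = kron_direct_sum (map (\<lambda>(n, a). Rep (jordan_block n a) (l \<cdot>\<^sub>m jordan_block n a - 1\<^sub>m n)) n_as)"
    by (simp add: kron_direct_sum_def K'_def J_def jordan_matrix_def comp_def case_prod_unfold d)
  moreover have "decomposable (kron_direct_sum (map (\<lambda>(n, a). Rep (jordan_block n a) (l \<cdot>\<^sub>m jordan_block n a - 1\<^sub>m n)) n_as))"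
    by (rule conjunct1[OF decomposable_kron_direct_sum])
      (auto simp: decomposable_jordan_block_pencil kron_reps_def intro!: exI minus_carrier_mat)
  ultimately have "decomposable K'" by simp
  then show ?thesis
    using decomposable_kron_iso[OF N K' 2] decomposable_kron_iso[OF M N 1] by blast
qed

theorem kronecker_decomposition:
  fixes M :: "'a :: alg_closed_field kron_rep"
  assumes "M \<in> kron_reps d1 d2"
  shows "decomposable M"
  using assms
proof (induction "d1 + d2" arbitrary: M d1 d2 rule: less_induct)
  case less
  note M = less.prems
  \<comment> \<open>The summand has positive total dimension, even \<open>ind_I 1\<close> and
    \<open>ind_P 1\<close>, so its complement falls under the induction hypothesis.\<close>
  have split: "decomposable M" if S: "S \<in> kron_reps s1 s2" "S \<in> indecs" "s1 + s2 > 0" and r: "retract S M" for S s1 s2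
  proof -
    obtain N where N: "s1 \<le> d1" "s2 \<le> d2" "N \<in> kron_reps (d1 - s1) (d2 - s2)" "kron_iso M (kron_sum S N)"
      using retract_splits[OF S(1) M r] by metis
    have "decomposable N" by (rule less.hyps[OF _ N(3)]) (use N(1,2) S(3) in linarith)
    then have "decomposable (kron_sum S N)"
      using decomposable_kron_sum[OF S(1) decomposable_indec[OF S(2)] N(3)] by simp
    moreover have "kron_sum S N \<in> kron_reps d1 d2"
      using kron_sum_in_kron_reps[OF S(1) N(3)] N(1,2) by simp
    ultimately show ?thesis using decomposable_kron_iso[OF M _ N(4)] by blast
  qed
  have ab: "alpha M \<in> carrier_mat d2 d1" "beta M \<in> carrier_mat d2 d1" using M by (auto simp: kron_reps_def)
  have M': "kron_dual M \<in> kron_reps d2 d1" using M by simp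
  \<comment> \<open>More columns than rows, or a square pencil singular at every finite point, gives
    a chain for \<open>M\<close>; more rows than columns gives one for the dual.\<close>
  consider n v j where "kernel_chain M n v" "v j \<noteq> 0\<^sub>v d1"
    | n v j where "kernel_chain (kron_dual M) n v" "v j \<noteq> 0\<^sub>v d2"
    | l where "d2 = d1" "det (l \<cdot>\<^sub>m alpha M - beta M) \<noteq> 0"
  proof -
    consider "d2 < d1" | "d1 < d2" | "d2 = d1" "\<forall>l. det (l \<cdot>\<^sub>m alpha M - beta M) = 0"
      | l where "d2 = d1" "det (l \<cdot>\<^sub>m alpha M - beta M) \<noteq> 0"
      by force
    then show ?thesis
    proof cases
      case 1
      then show ?thesis using kernel_chain_exists[OF M] that(1) by (metis less_imp_le less_irrefl)
    next
      case 2
      then show ?thesis using kernel_chain_exists[OF M'] that(2) by (metis less_imp_le less_irrefl)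
    next
      case 3
      then show ?thesis using kernel_chain_exists[OF M] that(1) by (metis order_refl)
    next
      case 4
      then show ?thesis using that(3) by blast
    qed
  qed
  then show ?case
  proof cases
    case (1 n v j)
    obtain m where m: "m \<ge> 1" "retract (ind_I m) M" using retract_ind_I_exists[OF M 1] by blast
    then show ?thesis
      by (intro split[OF ind_I_in_kron_reps[OF m(1)]]) (auto simp: indecs_def)
  next
    case (2 n v j)
    obtain m where m: "m \<ge> 1" "retract (ind_I m) (kron_dual M)" using retract_ind_I_exists[OF M' 2] by blast
    then have "retract (ind_P m) M"
      using retract_kron_dual[OF ind_I_in_kron_reps[OF m(1)] M' m(2)] by (simp add: kron_dual_ind_I)
    then show ?thesis
      using m by (intro split[OF ind_P_in_kron_reps[OF m(1)]]) (auto simp: indecs_def)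
  next
    case (3 l)
    then show ?thesis using decomposable_regular M by blast
  qed
qed

subsection \<open>The cokernel\<close>

text \<open>\<open>quotient_space\<close> is a bare record whose vector space laws are not part of
  its definition. They are transported along the surjection \<open>f\<close>, which is compatible
  with all operations.\<close>

lemma vectorspace_surjective_image:
  assumes V: "vectorspace K V"
    and surj: "carrier Q = f ` carrier V"
    and add: "\<And>x y. x \<in> carrier V \<Longrightarrow> y \<in> carrier V \<Longrightarrow> f x \<oplus>\<^bsub>Q\<^esub> f y = f (x \<oplus>\<^bsub>V\<^esub> y)"
    and zero: "\<zero>\<^bsub>Q\<^esub> = f \<zero>\<^bsub>V\<^esub>"
    and smult: "\<And>c x. c \<in> carrier K \<Longrightarrow> x \<in> carrier V \<Longrightarrow> c \<odot>\<^bsub>Q\<^esub> f x = f (c \<odot>\<^bsub>V\<^esub> x)"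
  shows "linear_map K V Q f"
proof -
  interpret V: vectorspace K V by fact
  have "abelian_group Q"
  proof (rule abelian_groupI)
    fix x assume "x \<in> carrier Q"
    then obtain a where a: "a \<in> carrier V" "x = f a" using surj by auto
    have "f (\<ominus>\<^bsub>V\<^esub> a) \<oplus>\<^bsub>Q\<^esub> x = \<zero>\<^bsub>Q\<^esub>" using a by (simp add: add zero V.l_neg)
    then show "\<exists>y\<in>carrier Q. y \<oplus>\<^bsub>Q\<^esub> x = \<zero>\<^bsub>Q\<^esub>" using a surj by blast
  qed (use surj in \<open>auto simp: add zero V.a_ac\<close>)
  moreover have "Module.module_axioms K Q"
    by unfold_locales
      (use surj in \<open>auto simp: add smult V.smult_l_distr V.smult_r_distr V.smult_assoc1 V.smult_one\<close>)
  ultimately have "Module.module K Q"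
    by (intro Module.module.intro V.R.cring_axioms)
  then have "vectorspace K Q"
    by (intro vectorspace.intro V.field_axioms)
  moreover have "f \<in> LinearCombinations.module_hom K V Q"
    unfolding LinearCombinations.module_hom_def using surj by (auto simp: add smult)
  ultimately show ?thesis
    using V by (intro linear_map.intro mod_hom.intro mod_hom_axioms.intro V.module_axioms \<open>Module.module K Q\<close>)
qed

text \<open>Rank-nullity for the quotient map: it is onto, and its kernel is the image of
  \<open>A\<close>.\<close>

lemma coker_dim_plus_mat_rank:
  assumes A: "(A :: 'a :: field mat) \<in> carrier_mat r c"
  shows "coker_dim A + mat_rank A = r"
proof -
  interpret V: vec_space "TYPE('a)" r .
  define W where "W = {A *\<^sub>v v | v. v \<in> carrier_vec c}"
  define Q where "Q = quotient_space V.V W"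
  have W: "W = (*\<^sub>v) A ` carrier_vec c" by (auto simp: W_def)
  have W_sub: "W \<subseteq> carrier_vec r" using A by (auto simp: W_def)
  have W_add: "x + y \<in> W" if "x \<in> W" "y \<in> W" for x y
  proof -
    from that obtain v w where "v \<in> carrier_vec c" "w \<in> carrier_vec c" "x = A *\<^sub>v v" "y = A *\<^sub>v w"
      by (auto simp: W)
    then show ?thesis
      using mult_add_distrib_mat_vec[OF A, of v w] by (auto simp: W intro!: image_eqI[of _ _ "v + w"])
  qed
  have W_smult: "k \<cdot>\<^sub>v x \<in> W" if "x \<in> W" for k x
  proof -
    from that obtain v where "v \<in> carrier_vec c" "x = A *\<^sub>v v" by (auto simp: W)
    then show ?thesis
      using mult_mat_vec[OF A, of v k] by (auto simp: W intro!: image_eqI[of _ _ "k \<cdot>\<^sub>v v"])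
  qed
  have W_zero: "0\<^sub>v r \<in> W"
    using mult_mat_zero_vec[OF A] by (auto simp: W intro!: image_eqI[of _ _ "0\<^sub>v c"])
  have ab_group: "abelian_group (module_vec TYPE('a) r)"
    using vec_module[where ?'a = 'a, of r] by (rule Module.module.axioms(2))
  have sub: "subgroup W (add_monoid (module_vec TYPE('a) r))"
  proof (rule group.subgroupI[OF abelian_group.a_group[OF ab_group]])
    show "inv\<^bsub>add_monoid V.V\<^esub> x \<in> W" if "x \<in> W" for x
    proof -
      have "inv\<^bsub>add_monoid V.V\<^esub> x = \<ominus>\<^bsub>V.V\<^esub> x" by (simp add: a_inv_def)
      also have "\<dots> = - x" using that W_sub by (intro V.vec_neg) auto
      also have "\<dots> = (- 1) \<cdot>\<^sub>v x" by (intro eq_vecI) auto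
      finally show ?thesis using W_smult[OF that] by simp
    qed
  qed (use W_sub W_zero W_add in \<open>auto\<close>)
  then interpret W: abelian_subgroup W V.V
    by (intro abelian_subgroupI3 additive_subgroup.intro ab_group)
  define f where "f x = W +>\<^bsub>V.V\<^esub> x" for x
  have f_absorb: "f (w + x) = f x" if "w \<in> W" "x \<in> carrier_vec r" for w x
  proof -
    have "f x = W +>\<^bsub>V.V\<^esub> (w + x)"
      unfolding f_def using that W_sub
      by (intro abelian_group.a_repr_independence[OF ab_group _ _ sub]) (auto simp: a_r_coset_def')
    then show ?thesis by (simp add: f_def)
  qed
  have f_self: "x \<in> f x" if "x \<in> carrier_vec r" for x
    using that W_zero by (auto simp: f_def a_r_coset_def' intro!: bexI[of _ "0\<^sub>v r"])
  have lin: "linear_map class_ring V.V Q f"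
  proof (rule vectorspace_surjective_image[OF V.vectorspace_axioms])
    show "carrier Q = f ` carrier V.V"
      by (auto simp: Q_def quotient_space_def A_RCOSETS_def' f_def)
    show "f x \<oplus>\<^bsub>Q\<^esub> f y = f (x \<oplus>\<^bsub>V.V\<^esub> y)" if "x \<in> carrier V.V" "y \<in> carrier V.V" for x y
      using W.a_rcos_sum[OF that] by (simp add: Q_def quotient_space_def f_def)
    show "\<zero>\<^bsub>Q\<^esub> = f \<zero>\<^bsub>V.V\<^esub>"
      using abelian_group.a_coset_join2[OF ab_group _ sub W_zero] by (simp add: Q_def quotient_space_def f_def)
    show "k \<odot>\<^bsub>Q\<^esub> f x = f (k \<odot>\<^bsub>V.V\<^esub> x)" if x: "x \<in> carrier V.V" for k x
    proof -
      \<comment> \<open>Scalar multiplication of cosets is a union over all representatives; closure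
        of \<open>W\<close> under scaling makes every member of that union the same coset.\<close>
      have "f (k \<cdot>\<^sub>v v) = f (k \<cdot>\<^sub>v x)" if v: "v \<in> f x" for v
      proof -
        obtain w where w: "w \<in> W" "v = w + x" using v by (auto simp: f_def a_r_coset_def')
        have wx: "w \<in> carrier_vec r" "x \<in> carrier_vec r" using w(1) x W_sub by auto
        have "f (k \<cdot>\<^sub>v v) = f (k \<cdot>\<^sub>v w + k \<cdot>\<^sub>v x)"
          unfolding w(2) smult_add_distrib_vec[OF wx] ..
        also have "\<dots> = f (k \<cdot>\<^sub>v x)"
          using W_smult[OF w(1)] wx(2) by (intro f_absorb) auto
        finally show ?thesis .
      qed
      moreover have "x \<in> f x" using f_self x by simp
      ultimately have "(\<Union>v\<in>f x. f (k \<cdot>\<^sub>v v)) = f (k \<cdot>\<^sub>v x)" by blast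
      then show ?thesis by (simp add: Q_def quotient_space_def f_def)
    qed
  qed
  interpret L: linear_map class_ring V.V Q f by (rule lin)
  have "carrier Q = f ` carrier V.V"
    by (auto simp: Q_def quotient_space_def A_RCOSETS_def' f_def)
  then have "L.im = carrier Q" by (simp add: L.im_def)
  then have im: "Q\<lparr>carrier := L.im\<rparr> = Q" by simp
  have zeroQ: "\<zero>\<^bsub>Q\<^esub> = W" by (simp add: Q_def quotient_space_def)
  have ker: "L.ker = W"
  proof
    show "L.ker \<subseteq> W"
    proof
      fix x assume "x \<in> L.ker"
      then have x: "x \<in> carrier_vec r" "f x = W" by (auto simp: L.ker_def zeroQ)
      have "x \<in> f x" by (rule f_self[OF x(1)])
      then show "x \<in> W" using x by simp
    qed
    show "W \<subseteq> L.ker"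
      using W_sub abelian_group.a_coset_join2[OF ab_group _ sub] by (auto simp: L.ker_def zeroQ f_def)
  qed
  have "vectorspace.dim class_ring Q + mat_rank A = r"
    using L.rank_nullity[OF V.fin_dim] mat_rank_eq_dim_image[OF A]
    unfolding im ker V.dim_is_n W by simp
  then show ?thesis
    using A by (simp add: coker_dim_def Q_def W_def)
qed

lemma P_mat_2_eq:
  assumes M: "M \<in> kron_reps d1 d2"
  shows "P_mat 2 M = append_cols (beta M) (alpha M)"
proof -
  have ab: "alpha M \<in> carrier_mat d2 d1" "beta M \<in> carrier_mat d2 d1" using M by (auto simp: kron_reps_def)
  show ?thesis
  proof (rule eq_mat_blocksI[of _ 1 d2 2 d1])
    show "P_mat 2 M \<in> carrier_mat (1 * d2) (2 * d1)"
      using block_matrix_carrier[of d2 d1 1 2] ab by (auto simp: P_mat_def kron_blocks_def)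
    show "append_cols (beta M) (alpha M) \<in> carrier_mat (1 * d2) (2 * d1)"
      using append_cols_carrier[OF ab(2,1)] by (simp add: mult_2)
    fix i p j q assume "i < (1 :: nat)" and p: "p < d2" and j: "j < (2 :: nat)" and q: "q < d1"
    then have i: "i = 0" by simp
    have "j * d1 + q < d1 + d1" using block_index_less[OF j q] by simp
    note idx = index_append_cols[OF ab(2,1) p this]
    have "P_mat 2 M $$ (i * d2 + p, j * d1 + q) =
        (if j = i then beta M else if j = i + 1 then alpha M else zero_block M) $$ (p, q)"
      unfolding P_mat_def kron_blocks_def carrier_matD[OF ab(1)]
      by (rule index_block_matrix) (use p j q i in auto)
    then show "P_mat 2 M $$ (i * d2 + p, j * d1 + q) = append_cols (beta M) (alpha M) $$ (i * d2 + p, j * d1 + q)"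
      using idx i j q by (auto simp: less_2_cases_iff)
  qed
qed

lemma I_mat_1_eq:
  assumes M: "M \<in> kron_reps d1 d2"
  shows "I_mat 1 M = beta M @\<^sub>r alpha M"
proof -
  have ab: "alpha M \<in> carrier_mat d2 d1" "beta M \<in> carrier_mat d2 d1" using M by (auto simp: kron_reps_def)
  show ?thesis
  proof (rule eq_mat_blocksI[of _ 2 d2 1 d1])
    show "I_mat 1 M \<in> carrier_mat (2 * d2) (1 * d1)"
      using block_matrix_carrier[of d2 d1 2 1] ab by (auto simp: I_mat_def kron_blocks_def numeral_2_eq_2)
    show "beta M @\<^sub>r alpha M \<in> carrier_mat (2 * d2) (1 * d1)"
      using carrier_append_rows[OF ab(2,1)] by (simp add: mult_2)
    fix i p j q assume i: "i < (2 :: nat)" and p: "p < d2" and "j < (1 :: nat)" and q: "q < d1"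
    then have j: "j = 0" by simp
    have "i * d2 + p < d2 + d2" using block_index_less[OF i p] by simp
    note idx = index_append_rows[OF ab(2,1) this q]
    have "I_mat 1 M $$ (i * d2 + p, j * d1 + q) =
        (if i = j then beta M else if i = j + 1 then alpha M else zero_block M) $$ (p, q)"
      unfolding I_mat_def kron_blocks_def carrier_matD[OF ab(1)]
      by (rule index_block_matrix) (use p j q i in auto)
    then show "I_mat 1 M $$ (i * d2 + p, j * d1 + q) = (beta M @\<^sub>r alpha M) $$ (i * d2 + p, j * d1 + q)"
      using idx i j p by (auto simp: less_2_cases_iff)
  qed
qed

theorem theorem4p3:
  fixes M :: "'a::alg_closed_field kron_rep"
    and d1 d2 n :: nat
    and l :: "'a proj_line"
  assumes "M \<in> kron_reps d1 d2" and "n \<ge> 1"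
  shows
    "int (kron_mult M (ind_P n)) =
       (if n \<ge> 2 then 2 * int (p_rank n M) - int (p_rank (n - 1) M) - int (p_rank (n + 1) M)
        else int d2 - int (p_rank 2 M)) \<and>
     int (kron_mult M (ind_I n)) =
       (if n \<ge> 2 then 2 * int (i_rank (n - 1) M) - int (i_rank n M) - int (i_rank (n - 2) M)
        else int d1 - int (i_rank 1 M)) \<and>
     int (kron_mult M (ind_R n l)) =
       (if n \<ge> 2 then int (r_rank (n - 1) l M) + int (r_rank (n + 1) l M) - 2 * int (r_rank n l M)
        else int (r_rank 2 l M) - 2 * int (r_rank 1 l M)) \<and>
     kron_mult M (ind_P 1) = coker_dim (append_cols (beta M) (alpha M)) \<and>
     kron_mult M (ind_I 1) = kernel_dim (beta M @\<^sub>r alpha M)"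
proof -
  note M = assms(1) and n = assms(2)
  have ab: "alpha M \<in> carrier_mat d2 d1" "beta M \<in> carrier_mat d2 d1"
    using M by (auto simp: kron_reps_def)
  then have dims: "dim_row (alpha M) = d2" "dim_col (alpha M) = d1" by auto
  note formulas = kron_mult_formulas[OF M decomposable_imp_is_decomposition[OF kronecker_decomposition[OF M]]]
  \<comment> \<open>The case \<open>n = 1\<close> of the formula involves \<open>P_mat 2\<close>,
    which is the single block row; its rank and cokernel dimension add up to \<open>d2\<close>. The
    next case is analogous, with \<open>I_mat 1\<close> and the kernel.\<close>
  have "int (kron_mult M (ind_P 1)) = int d2 - int (mat_rank (append_cols (beta M) (alpha M)))"
    using formulas(1)[OF le_refl] p_rank_eq[OF M, of 2]
    by (simp add: P_formula_def dims P_mat_2_eq[OF M])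
  then have P1: "kron_mult M (ind_P 1) = coker_dim (append_cols (beta M) (alpha M))"
    using coker_dim_plus_mat_rank[OF append_cols_carrier[OF ab(2,1)]] by linarith
  have "int (kron_mult M (ind_I 1)) = int d1 - int (mat_rank (beta M @\<^sub>r alpha M))"
    using formulas(2)[OF le_refl] i_rank_eq[OF M, of 1]
    by (simp add: I_formula_def dims I_mat_1_eq[OF M, unfolded One_nat_def])
  then have I1: "kron_mult M (ind_I 1) = kernel_dim (beta M @\<^sub>r alpha M)"
    using mat_rank_plus_kernel_dim[OF carrier_append_rows[OF ab(2,1)]] by linarith
  show ?thesis
    using formulas[OF n] P1 I1 by (simp add: P_formula_def I_formula_def R_formula_def dims)
qed

end
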